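(* Let $0\ne h_0\in W^{1,\infty}(S^1)$ be $4$-fold rotationally symmetric, odd at $0$ and non-negative on $[0,\pi/4]$. Assume further that the support of $h_0$ restricted to $[0,\pi/4]$ is contained in $[0,\epsilon]$ for some $0<\epsilon\le1/4$. Let $h(t,\theta)$ be the solution of the 1D system $$\partial_th+2H\partial_\theta h=0,\qquad h(0,\theta)=h_0(\theta).$$ Then $$\frac1{t+\|h_0\|_{L^1}^{-1}}\le\|h(t)\|_{L^1}\le\frac1{(1-8\epsilon^2)t+\|h_0\|_{L^1}^{-1}},\qquad\forall t\ge0.$$ In particular, the solution converges to the rest state in $L^1$ as $t\to+\infty$. On the other hand, $$h_0'(0)\left(\|h_0\|_{L^1}t+1\right)^{2(1-2\epsilon^2)}\le\|h'(t)\|_{L^\infty}\le\|h_0'\|_{L^\infty}\left((1-8\epsilon^2)\|h_0\|_{L^1}t+1\right)^{2(1-8\epsilon^2)^{-1}},\qquad\forall t\ge0,$$ assuming $h_0'(0)>0$.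
   Context: $S^1=\{\theta:-\pi\le\theta<\pi\}$ is the circle; $4$-fold symmetric means $h_0(\theta+\pi/2)=h_0(\theta)$; odd at $0$ means $h_0(-\theta)=-h_0(\theta)$. Prime denotes $\partial_\theta$. $H(t,\cdot)$ is the unique solution on $S^1$ of $4H+H''=h$ with $\int_{-\pi}^{\pi}H(\theta)e^{\pm2i\theta}d\theta=0$. The system is globally well-posed: $h(t,\phi(t,\theta))=h_0(\theta)$ where $\frac{d}{dt}\phi(t,\theta)=2H(t,\phi(t,\theta))$, $\phi(0,\theta)=\theta$, and $4$-fold symmetry, oddness, and non-negativity on $[0,\pi/4]$ are preserved. The $L^1$ norm is taken over $(0,\pi/4)$: $\|h\|_{L^1}=\int_0^{\pi/4}|h(\theta)|d\theta$. *)

theory Defs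
  imports "HOL-Analysis.Analysis" "HOL-Probability.Essential_Supremum"
begin

text \<open>Functions on the circle are \<open>2\<pi>\<close>-periodic functions on the real line, and
  integrals and norms over the circle are taken over the fundamental domain \<open>[-\<pi>, \<pi>)\<close>.\<close>

definition periodic :: "(real \<Rightarrow> real) \<Rightarrow> bool" where
  "periodic f \<longleftrightarrow> (\<forall>\<theta>. f (\<theta> + 2 * pi) = f \<theta>)"

definition circle :: "real measure" where
  "circle = restrict_space lborel {-pi..<pi}"

definition test_function :: "(real \<Rightarrow> real) \<Rightarrow> bool" where
  "test_function \<psi> \<longleftrightarrow>
     periodic \<psi> \<and> (\<forall>n \<theta>. ((deriv ^^ n) \<psi>) differentiable (at \<theta>))"

definition is_weak_derivative :: "(real \<Rightarrow> real) \<Rightarrow> (real \<Rightarrow> real) \<Rightarrow> bool" where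
  "is_weak_derivative f g \<longleftrightarrow> integrable circle g \<and>
     (\<forall>\<psi>. test_function \<psi> \<longrightarrow>
        (LINT \<theta>|circle. f \<theta> * deriv \<psi> \<theta>) = - (LINT \<theta>|circle. g \<theta> * \<psi> \<theta>))"

definition Linf_norm :: "(real \<Rightarrow> real) \<Rightarrow> ereal" where
  "Linf_norm g = esssup circle (\<lambda>\<theta>. ereal \<bar>g \<theta>\<bar>)"

text \<open>Elements of \<open>W\<^sup>1\<^sup>,\<^sup>\<infinity>(S\<^sup>1)\<close> are represented by their continuous representative, so that
  pointwise values make sense; boundedness of \<open>f\<close> itself is then automatic.\<close>

definition W1inf :: "(real \<Rightarrow> real) set" where
  "W1inf = {f. periodic f \<and> continuous_on UNIV f \<and>
                (\<exists>g. is_weak_derivative f g \<and> Linf_norm g < \<infinity>)}"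

text \<open>The weak derivative is unique up to null sets, so its \<open>L\<^sup>\<infinity>\<close> norm does not depend on the
  choice made here.\<close>

definition weak_derivative :: "(real \<Rightarrow> real) \<Rightarrow> real \<Rightarrow> real" where
  "weak_derivative f = (SOME g. is_weak_derivative f g)"

definition L1_norm :: "(real \<Rightarrow> real) \<Rightarrow> real" where
  "L1_norm f = (LBINT \<theta>:{0..pi/4}. \<bar>f \<theta>\<bar>)"

definition stream_function :: "(real \<Rightarrow> real) \<Rightarrow> (real \<Rightarrow> real) \<Rightarrow> bool" where
  "stream_function f F \<longleftrightarrow> periodic F \<and>
     (\<forall>\<theta>. F differentiable (at \<theta>) \<and> deriv F differentiable (at \<theta>) \<and>
          4 * F \<theta> + deriv (deriv F) \<theta> = f \<theta>) \<and>
     (LINT \<theta>|circle. complex_of_real (F \<theta>) * exp (2 * \<i> * of_real \<theta>)) = 0 \<and>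
     (LINT \<theta>|circle. complex_of_real (F \<theta>) * exp (- 2 * \<i> * of_real \<theta>)) = 0"

text \<open>The equation \<open>\<partial>\<^sub>t h + 2 H \<partial>\<^sub>\<theta> h = 0\<close> at almost every point of space-time, since the solution
  is only Lipschitz.\<close>

definition transport_equation :: "(real \<Rightarrow> real \<Rightarrow> real) \<Rightarrow> (real \<Rightarrow> real \<Rightarrow> real) \<Rightarrow> bool" where
  "transport_equation H h \<longleftrightarrow>
     (AE (t, \<theta>) in (lborel :: (real \<times> real) measure). 0 < t \<longrightarrow>
        (\<lambda>s. h s \<theta>) differentiable (at t) \<and> h t differentiable (at \<theta>) \<and>
        deriv (\<lambda>s. h s \<theta>) t + 2 * H t \<theta> * deriv (h t) \<theta> = 0)"

definition flow_map :: "(real \<Rightarrow> real \<Rightarrow> real) \<Rightarrow> (real \<Rightarrow> real \<Rightarrow> real) \<Rightarrow> bool" where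
  "flow_map H \<phi> \<longleftrightarrow> (\<forall>\<theta>. \<phi> 0 \<theta> = \<theta>) \<and>
     (\<forall>\<theta>. \<forall>t\<ge>0. ((\<lambda>s. \<phi> s \<theta>) has_real_derivative 2 * H t (\<phi> t \<theta>)) (at t within {0..}))"

text \<open>The well-posed solution of the Cauchy problem on \<open>[0, \<infinity>)\<close>: it satisfies the equation
  and is transported by the flow of \<open>2 H\<close>.\<close>

definition is_solution :: "(real \<Rightarrow> real) \<Rightarrow> (real \<Rightarrow> real \<Rightarrow> real) \<Rightarrow> bool" where
  "is_solution h0 h \<longleftrightarrow>
     h 0 = h0 \<and> (\<forall>t\<ge>0. h t \<in> W1inf) \<and>
     continuous_on ({0..} \<times> UNIV) (\<lambda>(t, \<theta>). h t \<theta>) \<and>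
     (\<exists>H. (\<forall>t\<ge>0. stream_function (h t) (H t)) \<and> transport_equation H h \<and>
          (\<exists>\<phi>. flow_map H \<phi> \<and> (\<forall>t\<ge>0. \<forall>\<theta>. h t (\<phi> t \<theta>) = h0 \<theta>)))"

end

theory Submission
  imports Defs
begin

text \<open>On \<open>[0, \<pi>/4]\<close> the mass \<open>L\<close> of \<open>h\<close> satisfies \<open>L' = S\<^sup>2 - C\<^sup>2\<close>, where \<open>C\<close> and \<open>S\<close> are the integrals of
  \<open>h cos 2\<theta>\<close> and \<open>h sin 2\<theta>\<close>. The flow pushes the support towards \<open>0\<close>, so \<open>h\<close> stays supported in
  \<open>[0, \<epsilon>]\<close>, which pinches \<open>C\<^sup>2 - S\<^sup>2\<close> between \<open>(1 - 8\<epsilon>\<^sup>2) L\<^sup>2\<close> and \<open>L\<^sup>2\<close>. The strain satisfies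
  \<open>H' \<ge> - L\<close> everywhere and \<open>H'(0) = - C\<close>; integrating it along trajectories bounds the compression
  of the flow, hence the Lipschitz constant of \<open>h\<close>, from both sides. The Lipschitz constant is the
  \<open>L\<^sup>\<infinity>\<close> norm of the weak derivative, and the symmetries of \<open>h\<close> follow from uniqueness of the flow.\<close>

section \<open>Stream functions\<close>

text \<open>The law for the mass is an energy identity: \<open>4 H^2 + (H')^2\<close> has space
  derivative \<open>2 H' h\<close>, and \<open>H\<close> vanishes at both ends of the quarter, so
  the mass changes at the rate of a difference of boundary values of \<open>(H')^2\<close>. Green's
  formula identifies these boundary values with the two moments. The 8 comes from
  \<open>(1 - 2 e^2)^2 - (2 e)^2 = 1 - 8 e^2 + 4 e^4\<close>, where e is \<epsilon>, since cos 2x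
  \<ge> 1 - 2 e^2 and sin 2x \<le> 2 e on the support. The exponents arise by integrating the strain
  \<open>2 H'\<close> against the rational bounds for the mass. The obstacle is low regularity: the
  profile is only Lipschitz, and its derivative is an arbitrary representative known through smooth
  test functions. Hence time derivatives fall on the Jacobian of the flow instead of on
  \<open>h\<close>, and gradients are measured as Lipschitz constants. Passing between these and
  weak derivatives requires smooth periodic functions that approximate indicators of intervals; they
  are built from powers of (1 + cos z) / 2.\<close>

lemma integral_periodic_shift:
  fixes f :: "real \<Rightarrow> real"
  assumes cont: "continuous_on UNIV f" and per: "\<And>x. f (x + p) = f x" and "0 \<le> p"
  shows "integral {a..a+p} f = integral {b..b+p} f"
proof -
  have int: "f integrable_on {u..v}" for u v
    by (rule integrable_continuous_real) (rule continuous_on_subset[OF cont], simp)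
  have shift: "integral {u+p..v+p} f = integral {u..v} f" for u v
  proof -
    have "integral {u+p..v+p} f = integral {u..v} (\<lambda>x. f (x + p))"
      using integral_shift_real_ivl[of "u + p" p "v + p" f] by simp
    then show ?thesis by (simp add: per)
  qed
  have main: "integral {a..a+p} f = integral {b..b+p} f" if "a \<le> b" for a b
  proof -
    have "integral {a..a+p} f + integral {a+p..b+p} f = integral {a..b+p} f"
      by (rule Henstock_Kurzweil_Integration.integral_combine[OF _ _ int])
        (use that \<open>0 \<le> p\<close> in auto)
    moreover have "integral {a..b} f + integral {b..b+p} f = integral {a..b+p} f"
      by (rule Henstock_Kurzweil_Integration.integral_combine[OF _ _ int])
        (use that \<open>0 \<le> p\<close> in auto)
    ultimately show ?thesis using shift[of a b] by simp
  qed
  show ?thesis using main[of a b] main[of b a] by linarith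
qed

text \<open>The half-open fundamental domain and the closed interval differ by the null point
  \<open>pi\<close>. Continuous integrands on the circle can thus be handled with the fundamental
  theorem of calculus.\<close>

lemma integral_circle_eq:
  fixes f :: "real \<Rightarrow> 'a::euclidean_space"
  assumes "continuous_on UNIV f"
  shows "integrable circle f" "integral\<^sup>L circle f = integral {-pi..pi} f"
proof -
  have c: "continuous_on {-pi..pi} f" using assms continuous_on_subset by blast
  have i: "set_integrable lborel {-pi..pi} f"
    using borel_integrable_atLeastAtMost'[OF c] .
  have i2: "set_integrable lborel {-pi..<pi} f"
    by (rule set_integrable_subset[OF i]) auto
  then show "integrable circle f"
    unfolding circle_def set_integrable_def by (subst integrable_restrict_space) auto
  have "integral\<^sup>L circle f = set_lebesgue_integral lborel {-pi..<pi} f"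
    unfolding circle_def set_lebesgue_integral_def by (subst integral_restrict_space) auto
  also have "\<dots> = set_lebesgue_integral lborel {-pi..pi} f"
    unfolding set_lebesgue_integral_def
  proof (rule integral_cong_AE)
    show "AE x in lborel. indicat_real {-pi..<pi} x *\<^sub>R f x = indicat_real {-pi..pi} x *\<^sub>R f x"
      using AE_lborel_singleton[of pi] by eventually_elim (auto simp: indicator_def)
  qed (use i i2 in \<open>auto simp: set_integrable_def\<close>)
  also have "\<dots> = integral {-pi..pi} f"
    using set_borel_integral_eq_integral(2)[OF i] .
  finally show "integral\<^sup>L circle f = integral {-pi..pi} f" .
qed

section \<open>Reduction modulo a period\<close>

lemma shift_invariant_int:
  fixes p :: real
  assumes "\<And>x. f (x + p) = f x" shows "f (x + p * of_int n) = f x"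
proof (induction n)
  case (nonneg n) show ?case
  proof (induction n)
    case (Suc n) then show ?case using assms[of "x + p * of_int (int n)"] by (simp add: algebra_simps)
  qed simp
next
  case (neg n) show ?case
  proof (induction n)
    case 0 show ?case using assms[of "x - p"] by simp
  next
    case (Suc n) then show ?case using assms[of "x + p * of_int (- int (Suc (Suc n)))"] by (simp add: algebra_simps)
  qed
qed

lemma shift_into_interval:
  assumes "0 < (p :: real)"
  obtains n :: int where "x + p * of_int n \<in> {-(p / 2)..<p / 2}"
proof -
  define n where "n = - \<lfloor>(x + p / 2) / p\<rfloor>"
  have "of_int (-n) \<le> (x + p / 2) / p" "(x + p / 2) / p < of_int (-n) + 1"
    unfolding n_def by linarith+
  then have "x + p * of_int n \<in> {-(p / 2)..<p / 2}"
    using assms by (auto simp: field_simps)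
  then show ?thesis ..
qed

lemma periodic_int: "periodic f \<Longrightarrow> f (x + 2 * pi * of_int n) = f x"
  by (rule shift_invariant_int) (simp add: periodic_def)

lemma periodic_reduce:
  obtains n :: int where "x + 2 * pi * of_int n \<in> {-pi..<pi}"
proof (rule shift_into_interval[of "2 * pi" x])
  fix n :: int assume "x + 2 * pi * of_int n \<in> {-(2 * pi / 2)..<2 * pi / 2}"
  then show ?thesis by (intro that[of n]) simp
qed simp

text \<open>The defining properties of a stream function with its first derivative as a parameter and
  the orthogonality relations in real form.\<close>

definition stream_pair :: "(real \<Rightarrow> real) \<Rightarrow> (real \<Rightarrow> real) \<Rightarrow> (real \<Rightarrow> real) \<Rightarrow> bool" where
  "stream_pair f F F' \<longleftrightarrow> periodic F \<and>
     (\<forall>x. (F has_real_derivative F' x) (at x)) \<and>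
     (\<forall>x. (F' has_real_derivative f x - 4 * F x) (at x)) \<and>
     integral {-pi..pi} (\<lambda>x. F x * cos (2 * x)) = 0 \<and>
     integral {-pi..pi} (\<lambda>x. F x * sin (2 * x)) = 0"

lemma stream_function_pair:
  assumes "stream_function f F"
  shows "stream_pair f F (deriv F)"
proof -
  have d: "(F has_real_derivative deriv F x) (at x)"
      "(deriv F has_real_derivative deriv (deriv F) x) (at x)" for x
    using assms by (auto simp: stream_function_def DERIV_deriv_iff_real_differentiable)
  have e: "deriv (deriv F) x = f x - 4 * F x" for x
  proof -
    have "4 * F x + deriv (deriv F) x = f x" using assms unfolding stream_function_def by blast
    then show ?thesis by linarith
  qed
  have cF: "continuous_on UNIV F"
    by (rule DERIV_continuous_on[OF has_field_derivative_at_within[OF d(1)]])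
  let ?g = "\<lambda>x. complex_of_real (F x) * exp (2 * \<i> * of_real x)"
  have cg: "continuous_on UNIV ?g"
    by (intro continuous_intros cF)
  have "integral\<^sup>L circle ?g = 0"
    using assms[unfolded stream_function_def, THEN conjunct2, THEN conjunct2, THEN conjunct1] .
  then have "integral {-pi..pi} ?g = 0"
    using integral_circle_eq(2)[OF cg] by (rule trans[OF sym, rotated])
  moreover have "?g integrable_on {-pi..pi}"
    by (rule integrable_continuous_real) (rule continuous_on_subset[OF cg], simp)
  ultimately have gi: "(?g has_integral 0) {-pi..pi}"
    by (metis integrable_integral)
  \<comment> \<open>A single complex relation carries both real ones, as its real and imaginary
    parts.\<close>
  have "((\<lambda>x. Re (?g x)) has_integral Re 0) {-pi..pi}" "((\<lambda>x. Im (?g x)) has_integral Im 0) {-pi..pi}"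
    using has_integral_linear[OF gi bounded_linear_Re] has_integral_linear[OF gi bounded_linear_Im]
    by (simp_all add: o_def)
  moreover have "Re (?g x) = F x * cos (2 * x)" "Im (?g x) = F x * sin (2 * x)" for x
    by (simp_all add: Re_exp Im_exp)
  ultimately have "((\<lambda>x. F x * cos (2 * x)) has_integral 0) {-pi..pi}"
    "((\<lambda>x. F x * sin (2 * x)) has_integral 0) {-pi..pi}" by (simp_all only: zero_complex.simps)
  moreover have "periodic F" using assms unfolding stream_function_def by blast
  ultimately show ?thesis using d unfolding stream_pair_def
    by (auto simp: e integral_unique)
qed

lemma stream_pair_D:
  assumes "stream_pair f F F'"
  shows "(F has_real_derivative F' x) (at x)" "(F' has_real_derivative f x - 4 * F x) (at x)"
    "continuous_on UNIV F" "continuous_on UNIV F'" "periodic F" "periodic F'"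
proof -
  show d: "(F has_real_derivative F' x) (at x)" "(F' has_real_derivative f x - 4 * F x) (at x)" "periodic F" for x
    using assms by (auto simp: stream_pair_def)
  show "continuous_on UNIV F" "continuous_on UNIV F'"
    by (rule DERIV_continuous_on[OF has_field_derivative_at_within[OF d(1)]],
        rule DERIV_continuous_on[OF has_field_derivative_at_within[OF d(2)]])
  have "F' (x + 2 * pi) = F' x" for x
  proof -
    have "((\<lambda>x. F (x + 2 * pi)) has_real_derivative F' (x + 2 * pi)) (at x)"
      using DERIV_shift[of F "F' (x + 2 * pi)" x "2*pi"] d(1) by simp
    then show ?thesis using d(1)[of x] d(3) by (auto simp: periodic_def intro: DERIV_unique)
  qed
  then show "periodic F'" by (simp add: periodic_def)
qed

text \<open>Linearity turns the bound \<open>stream_pair_bound\<close> into uniqueness of the stream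
  function and into its Lipschitz dependence on the profile.\<close>

lemma stream_pair_diff:
  assumes "stream_pair f F F'" "stream_pair g G G'"
  shows "stream_pair (\<lambda>x. f x - g x) (\<lambda>x. F x - G x) (\<lambda>x. F' x - G' x)"
proof -
  note D = stream_pair_D[OF assms(1)] stream_pair_D[OF assms(2)]
  have I: "(\<lambda>x. F x * k (2 * x)) integrable_on {-pi..pi}" "(\<lambda>x. G x * k (2 * x)) integrable_on {-pi..pi}"
    if "continuous_on UNIV k" for k
    by (intro integrable_continuous_real continuous_intros continuous_on_subset[OF D(3)]
        continuous_on_subset[OF D(9)] continuous_on_compose2[OF that]; simp)+
  have "continuous_on UNIV (cos :: real \<Rightarrow> _)" "continuous_on UNIV (sin :: real \<Rightarrow> _)"
    by (intro continuous_intros)+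
  note I = I[OF this(1)] I[OF this(2)]
  have "integral {-pi..pi} (\<lambda>x. (F x - G x) * cos (2 * x)) = 0"
    "integral {-pi..pi} (\<lambda>x. (F x - G x) * sin (2 * x)) = 0"
    using assms I by (simp_all add: stream_pair_def left_diff_distrib integral_diff)
  then show ?thesis unfolding stream_pair_def
    using D(5,11) by (auto simp: periodic_def intro!: derivative_eq_intros D)
qed

text \<open>The equation and the orthogonality relations are invariant under odd reflection.
  Together with uniqueness this makes the stream function of an odd profile odd.\<close>

lemma stream_pair_reflect:
  assumes "stream_pair f F F'"
  shows "stream_pair (\<lambda>x. - f (- x)) (\<lambda>x. - F (- x)) (\<lambda>x. F' (- x))"
proof -
  note D = stream_pair_D[OF assms]
  have "integral {-pi..pi} (\<lambda>x. F (-x) * cos (2 * x)) = integral {-pi..pi} (\<lambda>x. F x * cos (2 * x))"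
    "integral {-pi..pi} (\<lambda>x. F (-x) * sin (2 * x)) = - integral {-pi..pi} (\<lambda>x. F x * sin (2 * x))"
    using Henstock_Kurzweil_Integration.integral_reflect_real[of pi "-pi" "\<lambda>x. F x * cos (2 * x)"]
     Henstock_Kurzweil_Integration.integral_reflect_real[of pi "-pi" "\<lambda>x. F x * sin (2 * x)"] by simp_all
  moreover have "F (- (x + 2 * pi)) = F (- x)" for x
    using D(5)[unfolded periodic_def, rule_format, of "- x - 2 * pi"] by simp
  moreover have "((\<lambda>x. F (- x)) has_real_derivative - F' (- x)) (at x)" for x
    using DERIV_mirror D(1) by (metis add.inverse_inverse)
  moreover have "((\<lambda>x. F' (- x)) has_real_derivative - (f (- x) - 4 * F (- x))) (at x)" for x
    using DERIV_mirror[of F' "f (- x) - 4 * F (- x)" x] D(2)[of "-x"] by simp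
  ultimately show ?thesis using assms unfolding stream_pair_def
    by (auto simp: periodic_def intro!: derivative_eq_intros)
qed

lemma stream_pair_shift:
  assumes "stream_pair f F F'"
  shows "stream_pair (\<lambda>x. f (x + pi / 2)) (\<lambda>x. F (x + pi / 2)) (\<lambda>x. F' (x + pi / 2))"
proof -
  note D = stream_pair_D[OF assms]
  \<comment> \<open>For \<open>k\<close> equal to \<open>cos\<close> or \<open>sin\<close>, a
    quarter turn is half a period of \<open>k (2 * x)\<close> and only flips its sign; periodicity
    then moves the window of integration back. A vanishing integral stays zero.\<close>
  have *: "integral {-pi..pi} (\<lambda>x. F (x + pi / 2) * k (2 * x)) = - integral {-pi..pi} (\<lambda>x. F x * k (2 * x))"
    if k: "continuous_on UNIV k" "\<And>x. k (x + pi) = - k x" for k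
  proof -
    have kp: "k (y + pi * 4) = k y" for y
      using k(2)[of y] k(2)[of "y+pi"] k(2)[of "y+2*pi"] k(2)[of "y+3*pi"] by (simp add: algebra_simps)
    let ?g = "\<lambda>x. F x * k (2 * x)"
    have c: "continuous_on UNIV ?g"
      by (intro continuous_intros D continuous_on_compose2[OF k(1)]) auto
    have p: "?g (x + 2 * pi) = ?g x" for x
      using D(5) kp[of "2 * x"] by (simp add: periodic_def algebra_simps)
    have "k (2 * x) = - k (2 * (x + pi / 2))" for x
      using k(2)[of "2 * x"] by (simp add: distrib_left)
    then have "integral {-pi..pi} (\<lambda>x. F (x + pi / 2) * k (2 * x)) = - integral {-pi..pi} (\<lambda>x. ?g (x + pi / 2))"
      by simp
    moreover have "integral {-pi..pi} (\<lambda>x. ?g (x + pi / 2)) = integral {-pi + pi/2..pi + pi/2} ?g"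
      using integral_shift_real_ivl[of "- pi + pi / 2" "pi / 2" "pi + pi / 2" ?g] by simp
    moreover have "integral {-pi + pi/2..pi + pi/2} ?g = integral {-pi..pi} ?g"
    proof -
      have "-pi + pi/2 + 2 * pi = pi + pi/2" "-pi + 2 * pi = pi" by simp_all
      then show ?thesis using integral_periodic_shift[OF c p, of "-pi+pi/2" "-pi"] by simp
    qed
    ultimately show ?thesis by argo
  qed
  have ints: "integral {-pi..pi} (\<lambda>x. F (x + pi / 2) * cos (2 * x)) = - integral {-pi..pi} (\<lambda>x. F x * cos (2 * x))"
    "integral {-pi..pi} (\<lambda>x. F (x + pi / 2) * sin (2 * x)) = - integral {-pi..pi} (\<lambda>x. F x * sin (2 * x))"
    using *[where k = cos] *[where k = sin] by (simp_all add: continuous_on_cos continuous_on_sin)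
  have per: "F (x + 2 * pi + pi / 2) = F (x + pi / 2)" for x
    using D(5)[unfolded periodic_def, rule_format, of "x + pi / 2"] by (simp add: add_ac)
  have "((\<lambda>x. F (x + pi / 2)) has_real_derivative F' (x + pi / 2)) (at x)" for x
    using DERIV_shift[of F "F' (x + pi / 2)" x "pi / 2"] D(1) by simp
  moreover have "((\<lambda>x. F' (x + pi / 2)) has_real_derivative (f (x + pi / 2) - 4 * F (x + pi / 2))) (at x)" for x
    using DERIV_shift[of F' "f (x + pi / 2) - 4 * F (x + pi / 2)" x "pi / 2"] D(2) by simp
  ultimately show ?thesis using ints assms per unfolding stream_pair_def
    by (simp add: periodic_def)
qed

text \<open>Variation of constants: \<open>F\<close> and \<open>F' / 2\<close> are the rotation of \<open>(A, B)\<close> by the angle \<open>2x\<close>.\<close>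

lemma stream_pair_rotate:
  assumes "stream_pair f F F'"
  obtains A B where
    "\<And>x. A x = F x * cos (2 * x) - F' x / 2 * sin (2 * x)"
    "\<And>x. B x = F x * sin (2 * x) + F' x / 2 * cos (2 * x)"
    "\<And>x. (A has_real_derivative - (f x * sin (2 * x)) / 2) (at x)"
    "\<And>x. (B has_real_derivative f x * cos (2 * x) / 2) (at x)"
    "\<And>x. F x = A x * cos (2 * x) + B x * sin (2 * x)"
    "\<And>x. F' x = 2 * (B x * cos (2 * x) - A x * sin (2 * x))"
proof -
  note D = stream_pair_D[OF assms(1)]
  define A where "A = (\<lambda>x. F x * cos (2 * x) - F' x / 2 * sin (2 * x))"
  define B where "B = (\<lambda>x. F x * sin (2 * x) + F' x / 2 * cos (2 * x))"
  have rot: "a = (a * c - b * s) * c + (a * s + b * c) * s" "b = (a * s + b * c) * c - (a * c - b * s) * s"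
    if "c * c + s * s = 1" for a b c s :: real
    using that by algebra+
  have 1: "(A has_real_derivative - (f x * sin (2 * x)) / 2) (at x)"
    "(B has_real_derivative f x * cos (2 * x) / 2) (at x)" for x
    unfolding A_def B_def
    by (rule derivative_eq_intros D refl | simp add: field_simps)+
  have 2: "F x = A x * cos (2 * x) + B x * sin (2 * x)"
    "F' x = 2 * (B x * cos (2 * x) - A x * sin (2 * x))" for x
    using rot(1)[OF sin_cos_squared_add3[of "2 * x"], of "F x" "F' x / 2"]
      rot(2)[OF sin_cos_squared_add3[of "2 * x"], of "F' x / 2" "F x"] by (simp_all add: A_def B_def)
  show ?thesis by (rule that[OF fun_cong[OF A_def] fun_cong[OF B_def] 1 2])
qed

text \<open>The rotated coordinates \<open>A\<close> and \<open>B\<close> have derivatives at most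
  \<open>M / 2\<close>, so on \<open>[-pi, pi]\<close> they stay within \<open>pi * M / 2\<close> of
  their values at 0. Those two values are the coefficients of the homogeneous solutions cos 2x and
  sin 2x, which the orthogonality relations control. This gives \<open>5/2 * pi * M\<close> for
  \<open>A\<close> and \<open>B\<close>, and hence the constants 5 and 10.\<close>

lemma stream_pair_bound:
  assumes sp: "stream_pair f F F'" and M: "\<And>x. \<bar>f x\<bar> \<le> M"
  shows "\<bar>F x\<bar> \<le> 5 * pi * M" "\<bar>F' x\<bar> \<le> 10 * pi * M"
proof -
  note D = stream_pair_D[OF sp]
  obtain A B where defs: "\<And>x. A x = F x * cos (2 * x) - F' x / 2 * sin (2 * x)"
      "\<And>x. B x = F x * sin (2 * x) + F' x / 2 * cos (2 * x)"
    and AB: "\<And>x. (A has_real_derivative - (f x * sin (2 * x)) / 2) (at x)"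
      "\<And>x. (B has_real_derivative f x * cos (2 * x) / 2) (at x)"
      "\<And>x. F x = A x * cos (2 * x) + B x * sin (2 * x)"
      "\<And>x. F' x = 2 * (B x * cos (2 * x) - A x * sin (2 * x))"
    by (rule stream_pair_rotate[OF sp]) (rule that, assumption+)
  have M0: "0 \<le> M" using M[of 0] by linarith
  have grow: "\<bar>G x - G 0\<bar> \<le> pi * M / 2"
    if "\<And>x. (G has_real_derivative G' x) (at x)" "\<And>x. \<bar>G' x\<bar> \<le> M / 2" "x \<in> {-pi..pi}" for G G' x
  proof -
    have "norm (G x - G 0) \<le> M / 2 * norm (x - 0)"
      by (rule field_differentiable_bound[of UNIV G G']) (use that in \<open>auto intro: has_field_derivative_at_within\<close>)
    also have "\<dots> \<le> M / 2 * pi" using that M0 by (intro mult_left_mono) auto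
    finally show ?thesis by (simp add: mult.commute)
  qed
  have gA: "\<bar>A x - A 0\<bar> \<le> pi * M / 2" and gB: "\<bar>B x - B 0\<bar> \<le> pi * M / 2" if "x \<in> {-pi..pi}" for x
  proof -
    have "\<bar>f x * k\<bar> \<le> M" if "\<bar>k\<bar> \<le> 1" for k x
      using mult_mono[OF M that] M0 by (simp add: abs_mult)
    then have "\<bar>- (f x * sin (2 * x)) / 2\<bar> \<le> M / 2" "\<bar>f x * cos (2 * x) / 2\<bar> \<le> M / 2" for x by auto
    then show "\<bar>A x - A 0\<bar> \<le> pi * M / 2" "\<bar>B x - B 0\<bar> \<le> pi * M / 2"
      using grow[OF AB(1) _ that] grow[OF AB(2) _ that] by auto
  qed
  \<comment> \<open>\<open>R\<close> is what remains of \<open>F\<close> after removing the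
    homogeneous solution with the data of \<open>F\<close> at 0.\<close>
  define R where "R = (\<lambda>x. (A x - A 0) * cos (2 * x) + (B x - B 0) * sin (2 * x))"
  have FR: "F x = A 0 * cos (2 * x) + B 0 * sin (2 * x) + R x" for x
    using AB(3)[of x] by (simp add: R_def left_diff_distrib)
  have Rb: "\<bar>R x\<bar> \<le> pi * M" if "x \<in> {-pi..pi}" for x
  proof -
    have "\<bar>R x\<bar> \<le> \<bar>A x - A 0\<bar> * \<bar>cos (2 * x)\<bar> + \<bar>B x - B 0\<bar> * \<bar>sin (2 * x)\<bar>"
      unfolding R_def abs_mult[symmetric] by (rule abs_triangle_ineq)
    also have "\<dots> \<le> (pi * M / 2) * 1 + (pi * M / 2) * 1"
      using gA[OF that] gB[OF that] M0 by (intro add_mono mult_mono) auto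
    finally show ?thesis by (simp add: mult.commute)
  qed
  have cA: "continuous_on UNIV A" "continuous_on UNIV B"
    by (rule DERIV_continuous_on[OF has_field_derivative_at_within[OF AB(1)]],
        rule DERIV_continuous_on[OF has_field_derivative_at_within[OF AB(2)]])
  have cR: "continuous_on UNIV R" unfolding R_def by (intro continuous_intros cA)
  have kb: "\<bar>integral {-pi..pi} (\<lambda>x. R x * k x)\<bar> \<le> pi * M * (2 * pi)"
    if "continuous_on UNIV k" "\<And>x. \<bar>k x\<bar> \<le> 1" for k
  proof -
    have "norm (integral {-pi..pi} (\<lambda>x. R x * k x)) \<le> pi * M * (pi - (- pi))"
    proof (rule integral_bound)
      show "continuous_on {-pi..pi} (\<lambda>x. R x * k x)"
        by (intro continuous_intros continuous_on_subset[OF cR] continuous_on_subset[OF that(1)]) auto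
      show "norm (R x * k x) \<le> pi * M" if "x \<in> {-pi..pi}" for x
      proof -
        have "\<bar>R x\<bar> * \<bar>k x\<bar> \<le> pi * M * 1"
          by (intro mult_mono Rb that \<open>\<bar>k x\<bar> \<le> 1\<close>) (use M0 in simp_all)
        then show ?thesis by (simp add: abs_mult)
      qed
    qed simp
    then show ?thesis by (simp add: mult.assoc)
  qed
  have cc: "((\<lambda>x. cos (2 * x) * cos (2 * x)) has_integral pi) {-pi..pi}"
  proof -
    have "((\<lambda>x. cos (2 * x) * cos (2 * x)) has_integral (pi / 2 + sin (4 * pi) / 8) - ((-pi) / 2 + sin (4 * (-pi)) / 8)) {-pi..pi}"
    proof (rule fundamental_theorem_of_calculus)
      fix x :: real
      have "((\<lambda>x. x / 2 + sin (4 * x) / 8) has_real_derivative 1 / 2 + cos (4 * x) / 2) (at x within {-pi..pi})"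
        by (auto intro!: derivative_eq_intros)
      moreover have "1 / 2 + cos (4 * x) / 2 = cos (2 * x) * cos (2 * x)"
        using cos_double_cos[of "2*x"] by (simp add: power2_eq_square field_simps)
      ultimately show "((\<lambda>x. x / 2 + sin (4 * x) / 8) has_vector_derivative cos (2 * x) * cos (2 * x)) (at x within {-pi..pi})"
        by (simp only: has_real_derivative_iff_has_vector_derivative)
    qed simp
    moreover have "sin (4 * pi) = 0" using sin_npi[of 4] by simp
    ultimately show ?thesis by simp
  qed
  have ss_eq: "sin (2 * x) * sin (2 * x) = 1 - cos (2 * x) * cos (2 * x)" for x :: real
    using sin_cos_squared_add3[of "2*x"] by linarith
  have ss: "((\<lambda>x. sin (2 * x) * sin (2 * x)) has_integral pi) {-pi..pi}"
    unfolding ss_eq using has_integral_diff[OF has_integral_const_real[of "1 :: real" "-pi" pi] cc] by simp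
  have sc: "((\<lambda>x. sin (2 * x) * cos (2 * x)) has_integral 0) {-pi..pi}"
  proof -
    have "((\<lambda>x. sin (2 * x) * cos (2 * x)) has_integral (sin (2 * pi))^2 / 4 - (sin (2 * (-pi)))^2 / 4) {-pi..pi}"
      by (rule fundamental_theorem_of_calculus)
        (auto intro!: derivative_eq_intros simp: has_real_derivative_iff_has_vector_derivative[symmetric])
    then show ?thesis by (simp only: mult_minus_right sin_minus power2_minus diff_self)
  qed
  have cR': "((\<lambda>x. R x * k x) has_integral integral {-pi..pi} (\<lambda>x. R x * k x)) {-pi..pi}"
    if "continuous_on UNIV k" for k
    by (intro integrable_integral integrable_continuous_real continuous_intros
        continuous_on_subset[OF cR] continuous_on_subset[OF that]) auto
  have ccont: "continuous_on UNIV (\<lambda>x::real. cos (2 * x))" "continuous_on UNIV (\<lambda>x::real. sin (2 * x))"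
    by (intro continuous_intros)+
  have "((\<lambda>x. F x * cos (2 * x)) has_integral (A 0 * pi + B 0 * 0 + integral {-pi..pi} (\<lambda>x. R x * cos (2 * x)))) {-pi..pi}"
    using has_integral_add[OF has_integral_add[OF has_integral_mult_right[OF cc, of "A 0"] has_integral_mult_right[OF sc, of "B 0"]] cR'[OF ccont(1)]]
    by (simp add: FR algebra_simps)
  then have eA: "A 0 * pi + integral {-pi..pi} (\<lambda>x. R x * cos (2 * x)) = 0"
    using sp by (simp add: stream_pair_def integral_unique)
  have "((\<lambda>x. F x * sin (2 * x)) has_integral (A 0 * 0 + B 0 * pi + integral {-pi..pi} (\<lambda>x. R x * sin (2 * x)))) {-pi..pi}"
    using has_integral_add[OF has_integral_add[OF has_integral_mult_right[OF sc, of "A 0"] has_integral_mult_right[OF ss, of "B 0"]] cR'[OF ccont(2)]]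
    by (simp add: FR algebra_simps)
  then have eB: "B 0 * pi + integral {-pi..pi} (\<lambda>x. R x * sin (2 * x)) = 0"
    using sp by (simp add: stream_pair_def integral_unique)
  \<comment> \<open>The factor \<open>pi\<close> is the squared norm of cos 2x, and of sin 2x, over
    a full circle; the mixed integral vanishes, so the two coefficients decouple.\<close>
  have sm: "\<bar>a\<bar> \<le> 2 * pi * M" if "a * pi + I = 0" "\<bar>I\<bar> \<le> pi * M * (2 * pi)" for a I
  proof -
    have "\<bar>a\<bar> * pi = \<bar>I\<bar>" using that(1) by (metis abs_minus_cancel abs_mult abs_of_pos eq_neg_iff_add_eq_0 pi_gt_zero)
    then have "\<bar>a\<bar> * pi \<le> (2 * pi * M) * pi" using that(2) by (simp add: algebra_simps)
    then show ?thesis using mult_le_cancel_right_pos[OF pi_gt_zero] by blast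
  qed
  have AB0: "\<bar>A 0\<bar> \<le> 2 * pi * M" "\<bar>B 0\<bar> \<le> 2 * pi * M"
    by (rule sm[OF eA kb[OF ccont(1)]], simp) (rule sm[OF eB kb[OF ccont(2)]], simp)
  have ABx: "\<bar>A x\<bar> \<le> 5/2 * pi * M" "\<bar>B x\<bar> \<le> 5/2 * pi * M" if "x \<in> {-pi..pi}" for x
    using gA[OF that] gB[OF that] AB0 by linarith+
  have fin: "\<bar>F x\<bar> \<le> 5 * pi * M \<and> \<bar>F' x\<bar> \<le> 10 * pi * M" if "x \<in> {-pi..pi}" for x
  proof -
    have *: "\<bar>a * cos (2 * x)\<bar> \<le> 5/2 * pi * M \<and> \<bar>a * sin (2 * x)\<bar> \<le> 5/2 * pi * M" if "\<bar>a\<bar> \<le> 5/2 * pi * M" for a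
    proof -
      have "\<bar>a\<bar> * \<bar>k\<bar> \<le> 5/2 * pi * M * 1" if "\<bar>k\<bar> \<le> 1" for k
        by (intro mult_mono \<open>\<bar>a\<bar> \<le> 5/2 * pi * M\<close> that) (use M0 in simp_all)
      then show ?thesis by (simp add: abs_mult)
    qed
    note b1 = *[OF ABx(1)[OF that]] and b2 = *[OF ABx(2)[OF that]]
    show ?thesis
    proof
      show "\<bar>F x\<bar> \<le> 5 * pi * M"
        using b1[THEN conjunct1] b2[THEN conjunct2] AB(3)[of x] by linarith
      show "\<bar>F' x\<bar> \<le> 10 * pi * M"
      proof -
        have "\<bar>2 * (q - p)\<bar> \<le> 4 * c" if "\<bar>p\<bar> \<le> c" "\<bar>q\<bar> \<le> c" for p q c :: real
          using that by (auto simp: abs_le_iff)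
        from this[OF b1[THEN conjunct2] b2[THEN conjunct1]] show ?thesis by (simp add: AB(4)[of x] mult_ac)
      qed
    qed
  qed
  obtain n :: int where n: "x + 2 * pi * of_int n \<in> {-pi..<pi}" by (rule periodic_reduce)
  show "\<bar>F x\<bar> \<le> 5 * pi * M" "\<bar>F' x\<bar> \<le> 10 * pi * M"
    using fin[of "x + 2 * pi * of_int n"] n
    unfolding periodic_int[OF D(5)] periodic_int[OF D(6)] by auto
qed

section \<open>Weak derivatives and Lipschitz constants\<close>

text \<open>Counting orders lets closure under products be proved by induction: the Leibniz rule at
  order n + 1 needs the factors and their derivatives only to order n. Smoothness in the sense of
  \<open>test_function\<close> follows from all orders together.\<close>

fun differentiable_upto :: "nat \<Rightarrow> (real \<Rightarrow> real) \<Rightarrow> bool" where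
  "differentiable_upto 0 f \<longleftrightarrow> True"
| "differentiable_upto (Suc n) f \<longleftrightarrow> (\<forall>x. f differentiable (at x)) \<and> differentiable_upto n (deriv f)"

lemma differentiable_upto_SucI:
  assumes "\<And>x. (f has_real_derivative f' x) (at x)" "differentiable_upto n f'"
  shows "differentiable_upto (Suc n) f"
proof -
  have "deriv f = f'" using assms(1) DERIV_imp_deriv by blast
  then show ?thesis using assms by (auto simp: real_differentiable_def)
qed

lemma differentiable_upto_mono: "differentiable_upto (Suc n) f \<Longrightarrow> differentiable_upto n f"
  by (induction n arbitrary: f) auto

lemma differentiable_upto_SucD:
  "differentiable_upto (Suc n) f \<Longrightarrow> (f has_real_derivative deriv f x) (at x)"
  by (simp add: DERIV_deriv_iff_real_differentiable)

lemma differentiable_upto_iterate: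
  "differentiable_upto (Suc n) f \<Longrightarrow> (deriv ^^ n) f differentiable (at x)"
proof (induction n arbitrary: f)
  case (Suc n)
  have "(deriv ^^ Suc n) f = (deriv ^^ n) (deriv f)" by (simp add: funpow_swap1)
  then show ?case using Suc.IH[of "deriv f"] Suc.prems by simp
qed simp

lemma differentiable_upto_const: "differentiable_upto n (\<lambda>x. c)"
proof (induction n arbitrary: c)
  case (Suc n) show ?case by (rule differentiable_upto_SucI[OF _ Suc.IH[of 0]]) auto
qed simp

lemma differentiable_upto_add:
  "differentiable_upto n f \<Longrightarrow> differentiable_upto n g \<Longrightarrow> differentiable_upto n (\<lambda>x. f x + g x)"
proof (induction n arbitrary: f g)
  case (Suc n)
  show ?case
    by (rule differentiable_upto_SucI[OF DERIV_add[OF differentiable_upto_SucD differentiable_upto_SucD]])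
      (use Suc in auto)
qed simp

lemma differentiable_upto_mult:
  "differentiable_upto n f \<Longrightarrow> differentiable_upto n g \<Longrightarrow> differentiable_upto n (\<lambda>x. f x * g x)"
proof (induction n arbitrary: f g)
  case (Suc n)
  have "differentiable_upto n (\<lambda>x. deriv f x * g x + deriv g x * f x)"
    by (intro differentiable_upto_add Suc.IH) (use Suc.prems differentiable_upto_mono in auto)
  then show ?case
    by (rule differentiable_upto_SucI[OF DERIV_mult[OF differentiable_upto_SucD[OF Suc.prems(1)] differentiable_upto_SucD[OF Suc.prems(2)]]])
qed simp

lemma differentiable_upto_power: "differentiable_upto n f \<Longrightarrow> differentiable_upto n (\<lambda>x. f x ^ k)"
  by (induction k) (auto intro: differentiable_upto_const differentiable_upto_mult)

lemma differentiable_upto_sin_cos: "differentiable_upto n sin" "differentiable_upto n cos"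
proof (induction n)
  case (Suc n)
  show "differentiable_upto (Suc n) sin" by (rule differentiable_upto_SucI[OF DERIV_sin Suc(2)])
  have "differentiable_upto n (\<lambda>x. (-1) * sin x)"
    by (intro differentiable_upto_mult differentiable_upto_const Suc)
  then show "differentiable_upto (Suc n) cos"
    by (intro differentiable_upto_SucI[OF DERIV_cos]) simp
qed simp_all

text \<open>The powers \<open>cos_weight z ^ n\<close>, once normalised, form an approximate identity. Their
  antiderivatives and their masses over a period obey the same recursion, which comes from
  differentiating \<open>sin z * cos_weight z ^ n\<close>.\<close>

definition cos_weight :: "real \<Rightarrow> real" where "cos_weight z = (1 + cos z) / 2"

fun cos_kernel_int :: "nat \<Rightarrow> real \<Rightarrow> real" where
  "cos_kernel_int 0 z = z"
| "cos_kernel_int (Suc n) z =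
     ((2 * real n + 1) * cos_kernel_int n z + sin z * cos_weight z ^ n) / (2 * real n + 2)"

fun cos_kernel_mass :: "nat \<Rightarrow> real" where
  "cos_kernel_mass 0 = 2 * pi"
| "cos_kernel_mass (Suc n) = (2 * real n + 1) / (2 * real n + 2) * cos_kernel_mass n"

lemma cos_kernel_mass_pos: "cos_kernel_mass n > 0"
  by (induction n) auto

lemma cos_weight_bounds: "0 \<le> cos_weight z" "cos_weight z \<le> 1"
  unfolding cos_weight_def using add_left_mono[OF cos_ge_minus_one[of z], of 1] by simp_all

lemma cos_weight_lt_1: "z \<noteq> 0 \<Longrightarrow> \<bar>z\<bar> < 2 * pi \<Longrightarrow> cos_weight z < 1"
proof -
  assume z: "z \<noteq> 0" "\<bar>z\<bar> < 2 * pi"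
  have "cos z \<noteq> 1"
  proof
    assume "cos z = 1"
    then obtain n :: int where "z = of_int n * 2 * pi" by (auto simp: cos_one_2pi_int)
    then have n: "n \<noteq> 0" "\<bar>real_of_int n\<bar> * (2 * pi) < 1 * (2 * pi)" using z by (auto simp: abs_mult)
    then have "\<bar>real_of_int n\<bar> < 1" using pi_gt_zero by (subst (asm) mult_less_cancel_right) auto
    then show False using n(1) by linarith
  qed
  then have "cos z < 1" using cos_le_one[of z] by linarith
  then show ?thesis by (simp add: cos_weight_def)
qed

lemma cos_weight_deriv: "(cos_weight has_real_derivative - sin z / 2) (at z)"
  unfolding cos_weight_def[abs_def] by (auto intro!: derivative_eq_intros)

lemma cos_kernel_int_deriv: "(cos_kernel_int n has_real_derivative cos_weight z ^ n) (at z)"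
proof (induction n)
  case 0 show ?case by (simp add: cos_kernel_int.simps(1)[abs_def])
next
  case (Suc n)
  let ?w = "cos_weight z"
  have key: "cos z * ?w ^ n + sin z * (real n * ?w ^ (n - 1) * (- sin z / 2)) =
      (2 * real n + 2) * ?w ^ Suc n - (2 * real n + 1) * ?w ^ n"
  proof -
    \<comment> \<open>Written in \<open>w = cos_weight z\<close>, both cos z and sin^2 z are
      polynomials, so the derivative of \<open>sin z * w ^ n\<close> becomes a combination of
      \<open>w ^ n\<close> and \<open>w ^ Suc n\<close>.\<close>
    have c: "cos z = 2 * ?w - 1" by (simp add: cos_weight_def field_simps)
    have s: "sin z * sin z = 4 * ?w * (1 - ?w)"
      using sin_cos_squared_add3[of z] unfolding c by (simp add: algebra_simps)
    have "sin z * (real n * ?w ^ (n - 1) * (- sin z / 2)) = - (real n * ?w ^ (n - 1) / 2) * (sin z * sin z)"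
      by simp
    also have "\<dots> = - 2 * (1 - ?w) * (real n * (?w * ?w ^ (n - 1)))"
      unfolding s by algebra
    \<comment> \<open>At n = 0 the exponent \<open>n - 1\<close> is truncated, but the factor
      \<open>real n\<close> vanishes.\<close>
    also have "real n * (?w * ?w ^ (n - 1)) = real n * ?w ^ n" by (cases n) simp_all
    finally have X: "sin z * (real n * ?w ^ (n - 1) * (- sin z / 2)) = - 2 * (1 - ?w) * (real n * ?w ^ n)" .
    have "(2 * w - 1) * p + - 2 * (1 - w) * (real n * p) = (2 * real n + 2) * (w * p) - (2 * real n + 1) * p" for w p :: real
      by (simp add: algebra_simps)
    then show ?thesis unfolding X c power_Suc .
  qed
  have "(cos_kernel_int (Suc n) has_real_derivative
      ((2 * real n + 1) * ?w ^ n + (cos z * ?w ^ n + sin z * (real n * ?w ^ (n - 1) * (- sin z / 2)))) / (2 * real n + 2)) (at z)"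
    unfolding cos_kernel_int.simps(2)[abs_def]
    by (rule derivative_eq_intros Suc.IH cos_weight_deriv refl | simp)+
  moreover have "((2 * real n + 1) * ?w ^ n + (cos z * ?w ^ n + sin z * (real n * ?w ^ (n - 1) * (- sin z / 2)))) / (2 * real n + 2) = ?w ^ Suc n"
    unfolding key by (simp add: field_simps)
  ultimately show ?case by metis
qed

lemma cos_weight_periodic: "cos_weight (z + 2 * pi) = cos_weight z" "cos_weight (- z) = cos_weight z"
  by (simp_all add: cos_weight_def)

lemma cos_kernel_int_shift: "cos_kernel_int n (z + 2 * pi) = cos_kernel_int n z + cos_kernel_mass n"
proof (induction n)
  case (Suc n)
  have "(p * (a + m) + b) / d = (p * a + b) / d + p / d * m" for a b d m p :: real
    by (simp add: add_divide_distrib distrib_left)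
  then show ?case by (simp only: cos_kernel_int.simps cos_kernel_mass.simps Suc.IH cos_weight_periodic sin_periodic)
qed simp

lemma cos_kernel_int_minus: "cos_kernel_int n (- z) = - cos_kernel_int n z"
  by (induction n) (simp_all add: cos_weight_periodic field_simps)

lemma cos_kernel_int_pi: "cos_kernel_int n pi = cos_kernel_mass n / 2"
  using cos_kernel_int_shift[of n "-pi"] cos_kernel_int_minus[of n pi] by simp

lemma cos_kernel_mass_diff:
  "cos_kernel_mass n - cos_kernel_mass (Suc n) = cos_kernel_mass n / (2 * real n + 2)"
  by (simp add: field_simps)

lemma cos_kernel_int_mono: "x \<le> y \<Longrightarrow> cos_kernel_int n x \<le> cos_kernel_int n y"
  by (rule DERIV_nonneg_imp_nondecreasing) (use cos_kernel_int_deriv cos_weight_bounds in \<open>auto intro!: exI\<close>)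

lemma cos_kernel_diff_mono:
  "x \<le> y \<Longrightarrow> cos_kernel_int n x - cos_kernel_int (Suc n) x \<le> cos_kernel_int n y - cos_kernel_int (Suc n) y"
proof (rule DERIV_nonneg_imp_nondecreasing, assumption)
  fix z
  have "((\<lambda>z. cos_kernel_int n z - cos_kernel_int (Suc n) z) has_real_derivative cos_weight z ^ n - cos_weight z ^ Suc n) (at z)"
    by (intro DERIV_diff cos_kernel_int_deriv)
  moreover have "0 \<le> cos_weight z ^ n - cos_weight z ^ Suc n"
    using cos_weight_bounds[of z] by (simp add: mult_left_le_one_le)
  ultimately show "\<exists>d. ((\<lambda>z. cos_kernel_int n z - cos_kernel_int (Suc n) z) has_real_derivative d) (at z) \<and> 0 \<le> d" by blast
qed

text \<open>After this normalisation the function is odd and rises by 1 per period. As n grows it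
  tends to 1/2 on (0, 2 pi) and to -1/2 on (-2 pi, 0), so differences of translates approximate
  indicators of intervals.\<close>

definition cos_kernel_primitive :: "nat \<Rightarrow> real \<Rightarrow> real" where
  "cos_kernel_primitive n z = cos_kernel_int n z / cos_kernel_mass n"

text \<open>A Chebyshev estimate for the kernel mass beyond \<open>z\<close>. On
  \<open>[z, pi]\<close> one has \<open>cos_weight u ^ n \<le> c * (cos_weight u ^ n - cos_weight u
  ^ Suc n)\<close> with \<open>c = 1 / (1 - cos_weight z)\<close>, and the difference of consecutive
  powers has total mass only \<open>cos_kernel_mass n / (2 * real n + 2)\<close>.\<close>

lemma cos_kernel_primitive_tail:
  assumes "0 < z" "z \<le> pi"
  shows "\<bar>1 / 2 - cos_kernel_primitive n z\<bar> \<le> 1 / (1 - cos_weight z) * inverse (real (Suc n))"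
proof -
  define c where "c = 1 / (1 - cos_weight z)"
  have wz: "cos_weight z < 1" using cos_weight_lt_1[of z] assms by auto
  have c0: "0 < c" using wz by (simp add: c_def)
  define D where "D = (\<lambda>u. cos_kernel_int n u - cos_kernel_int (Suc n) u)"
  have D0: "D 0 = 0" using cos_kernel_int_minus[of _ 0] by (simp add: D_def)
  have Dz: "0 \<le> D z" using cos_kernel_diff_mono[of 0 z n] assms D0 by (simp add: D_def)
  have Dpi: "D pi = cos_kernel_mass n / (4 * real n + 4)"
    using cos_kernel_mass_diff[of n] by (simp add: D_def cos_kernel_int_pi field_simps)
  have "c * D z - cos_kernel_int n z \<le> c * D pi - cos_kernel_int n pi"
  proof (rule DERIV_nonneg_imp_nondecreasing[OF assms(2)])
    fix u assume u: "z \<le> u" "u \<le> pi"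
    have "cos u \<le> cos z" using u assms by (intro cos_monotone_0_pi_le) auto
    then have "1 \<le> c * (1 - cos_weight u)" using wz by (simp add: c_def cos_weight_def field_simps)
    then have "0 \<le> cos_weight u ^ n * (c * (1 - cos_weight u) - 1)"
      using cos_weight_bounds[of u] by simp
    then have "0 \<le> c * (cos_weight u ^ n - cos_weight u ^ Suc n) - cos_weight u ^ n"
      by (simp add: algebra_simps)
    moreover have "((\<lambda>u. c * D u - cos_kernel_int n u) has_real_derivative
        c * (cos_weight u ^ n - cos_weight u ^ Suc n) - cos_weight u ^ n) (at u)"
      unfolding D_def by (intro DERIV_diff DERIV_cmult cos_kernel_int_deriv)
    ultimately show "\<exists>d. ((\<lambda>u. c * D u - cos_kernel_int n u) has_real_derivative d) (at u) \<and> 0 \<le> d" by blast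
  qed
  then have "cos_kernel_mass n / 2 - cos_kernel_int n z \<le> c * (cos_kernel_mass n / (4 * real n + 4))"
    using Dz c0 unfolding Dpi cos_kernel_int_pi by (smt (verit) mult_nonneg_nonneg)
  also have "\<dots> \<le> cos_kernel_mass n * (c * inverse (real (Suc n)))"
  proof -
    have "cos_kernel_mass n / (4 * real n + 4) \<le> cos_kernel_mass n * inverse (real (Suc n))"
      unfolding divide_inverse
      using cos_kernel_mass_pos[of n] by (intro mult_left_mono le_imp_inverse_le) auto
    from mult_left_mono[OF this, of c] c0 show ?thesis by (simp only: mult_ac less_imp_le)
  qed
  finally have "cos_kernel_mass n * (1 / 2 - cos_kernel_primitive n z) \<le> cos_kernel_mass n * (c * inverse (real (Suc n)))"
    using cos_kernel_mass_pos[of n] by (simp add: cos_kernel_primitive_def right_diff_distrib)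
  then have "1 / 2 - cos_kernel_primitive n z \<le> c * inverse (real (Suc n))"
    using mult_le_cancel_left_pos[OF cos_kernel_mass_pos[of n]] by blast
  moreover have "cos_kernel_primitive n z \<le> 1 / 2"
    using cos_kernel_int_mono[OF assms(2), of n] cos_kernel_mass_pos[of n]
    by (simp add: cos_kernel_primitive_def cos_kernel_int_pi field_simps)
  ultimately show ?thesis by (simp add: c_def)
qed

lemma cos_kernel_primitive_shift: "cos_kernel_primitive n (z + 2 * pi) = cos_kernel_primitive n z + 1"
  using cos_kernel_mass_pos[of n] by (simp add: cos_kernel_primitive_def cos_kernel_int_shift add_divide_distrib)

lemma cos_kernel_primitive_minus: "cos_kernel_primitive n (- z) = - cos_kernel_primitive n z"
  by (simp add: cos_kernel_primitive_def cos_kernel_int_minus)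

lemma cos_kernel_primitive_tendsto:
  assumes "0 < z" "z < 2 * pi"
  shows "(\<lambda>n. cos_kernel_primitive n z) \<longlonglongrightarrow> 1 / 2" "(\<lambda>n. cos_kernel_primitive n (- z)) \<longlonglongrightarrow> - 1 / 2"
proof -
  have *: "(\<lambda>n. cos_kernel_primitive n z) \<longlonglongrightarrow> 1 / 2" if "0 < z" "z \<le> pi" for z
  proof (rule LIM_zero_cancel, rule Lim_null_comparison)
    show "\<forall>\<^sub>F n in sequentially. norm (cos_kernel_primitive n z - 1 / 2) \<le> 1 / (1 - cos_weight z) * inverse (real (Suc n))"
      using cos_kernel_primitive_tail[OF that] by (simp add: abs_minus_commute)
    show "(\<lambda>n. 1 / (1 - cos_weight z) * inverse (real (Suc n))) \<longlonglongrightarrow> 0"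
      using tendsto_mult_right_zero[OF LIMSEQ_inverse_real_of_nat] by blast
  qed
  show 1: "(\<lambda>n. cos_kernel_primitive n z) \<longlonglongrightarrow> 1 / 2"
  proof (cases "z \<le> pi")
    case False
    \<comment> \<open>Quasi-periodicity and oddness reflect an argument beyond \<open>pi\<close> to
      \<open>2 * pi - z\<close>, where the tail estimate applies.\<close>
    have "cos_kernel_primitive n z = 1 - cos_kernel_primitive n (2 * pi - z)" for n
      using cos_kernel_primitive_shift[of n "z - 2 * pi"] cos_kernel_primitive_minus[of n "2 * pi - z"] by simp
    moreover have "(\<lambda>n. 1 - cos_kernel_primitive n (2 * pi - z)) \<longlonglongrightarrow> 1 - 1 / 2"
      using False assms by (intro tendsto_diff tendsto_const *) auto
    ultimately show ?thesis by simp
  qed (use * assms in auto)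
  show "(\<lambda>n. cos_kernel_primitive n (- z)) \<longlonglongrightarrow> - 1 / 2"
    using tendsto_minus[OF 1] by (simp add: cos_kernel_primitive_minus)
qed

lemma cos_kernel_primitive_mono: "x \<le> y \<Longrightarrow> cos_kernel_primitive n x \<le> cos_kernel_primitive n y"
  using cos_kernel_int_mono cos_kernel_mass_pos[of n] by (auto simp: cos_kernel_primitive_def intro!: divide_right_mono)

lemma cos_kernel_primitive_bound:
  assumes "\<bar>z\<bar> \<le> 2 * pi" shows "\<bar>cos_kernel_primitive n z\<bar> \<le> 1"
proof -
  have z: "cos_kernel_primitive n 0 = 0" using cos_kernel_primitive_minus[of n 0] by simp
  show ?thesis
  using cos_kernel_primitive_mono[of "- (2 * pi)" z n] cos_kernel_primitive_mono[of z "2 * pi" n] assms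
    cos_kernel_primitive_shift[of n 0] cos_kernel_primitive_minus[of n "2 * pi"] z by (simp add: abs_le_iff)
qed

lemma cos_kernel_primitive_deriv:
  "(cos_kernel_primitive n has_real_derivative cos_weight z ^ n / cos_kernel_mass n) (at z)"
  unfolding cos_kernel_primitive_def[abs_def] by (intro DERIV_cdivide cos_kernel_int_deriv)

text \<open>Korovkin's argument: continuity bounds \<open>f s - f y\<close> by a small constant plus a multiple of
  \<open>1 - cos_weight (y - s)\<close>, whose mean against the kernel is \<open>1 / (2n + 2)\<close>.\<close>

lemma cos_kernel_approximation:
  assumes cont: "continuous_on {-pi..pi} f" and y: "-pi < y" "y < pi"
  shows "(\<lambda>n. integral {-pi..pi} (\<lambda>s. f s * (cos_weight (y - s) ^ n / cos_kernel_mass n))) \<longlonglongrightarrow> f y"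
proof (rule LIMSEQ_I)
  fix r :: real assume r: "0 < r"
  define e where "e = r / 2"
  have e: "0 < e" using r by (simp add: e_def)
  have cw: "continuous_on A cos_weight" for A
    unfolding cos_weight_def[abs_def] by (intro continuous_intros) simp
  obtain d where d: "0 < d" "\<And>s. s \<in> {-pi..pi} \<Longrightarrow> \<bar>s - y\<bar> < d \<Longrightarrow> \<bar>f s - f y\<bar> < e"
  proof -
    have "y \<in> {-pi..pi}" using y by simp
    with cont e obtain d where "d > 0" "\<forall>s\<in>{-pi..pi}. dist s y < d \<longrightarrow> dist (f s) (f y) < e"
      unfolding continuous_on_iff by blast
    then show ?thesis by (intro that[of d]) (simp_all add: dist_real_def)
  qed
  \<comment> \<open>Away from the d-neighbourhood of \<open>y\<close> the quotient below is
    continuous on a compact set: there 0 < |y - s| < 2 pi, so its denominator has no zero.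
    \<open>B\<close> is a bound for that quotient.\<close>
  obtain B where B: "0 \<le> B" "\<And>s. s \<in> {-pi..pi} \<Longrightarrow> \<bar>f s - f y\<bar> \<le> e + B * (1 - cos_weight (y - s))"
  proof -
    let ?S = "{-pi..pi} - {y - d<..<y + d}"
    let ?q = "\<lambda>s. \<bar>f s - f y\<bar> / (1 - cos_weight (y - s))"
    have lt: "cos_weight (y - s) < 1" if "s \<in> ?S" for s
      by (rule cos_weight_lt_1) (use that y d(1) in auto)
    have "continuous_on ?S ?q"
      by (intro continuous_intros continuous_on_subset[OF cont] continuous_on_compose2[OF cw[of UNIV]])
        (use lt in \<open>auto simp: less_le\<close>)
    moreover have "compact ?S" by (intro compact_diff) auto
    ultimately have "bounded (?q ` ?S)" using compact_continuous_image compact_imp_bounded by blast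
    then obtain B where B: "0 < B" "\<And>s. s \<in> ?S \<Longrightarrow> \<bar>?q s\<bar> \<le> B" unfolding bounded_pos by auto
    show ?thesis
    proof (rule that[of B])
      fix s assume s: "s \<in> {-pi..pi}"
      show "\<bar>f s - f y\<bar> \<le> e + B * (1 - cos_weight (y - s))"
      proof (cases "s \<in> ?S")
        case True
        have "?q s \<le> B" using B(2)[OF True] by linarith
        then have "\<bar>f s - f y\<bar> \<le> B * (1 - cos_weight (y - s))"
          using lt[OF True] by (simp add: pos_divide_le_eq)
        then show ?thesis using e by simp
      next
        case False
        then have "\<bar>f s - f y\<bar> < e" using d(2)[OF s] s by auto
        moreover have "0 \<le> B * (1 - cos_weight (y - s))" using B(1) cos_weight_bounds by simp
        ultimately show ?thesis by linarith
      qed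
    qed (use B in auto)
  qed
  have est: "\<bar>integral {-pi..pi} (\<lambda>s. f s * (cos_weight (y - s) ^ n / cos_kernel_mass n)) - f y\<bar> \<le> e + B / (2 * real n + 2)" for n
  proof -
    let ?k = "\<lambda>m s. cos_weight (y - s) ^ m / cos_kernel_mass n"
    have k: "((\<lambda>s. ?k m s) has_integral cos_kernel_mass m / cos_kernel_mass n) {-pi..pi}" for m
    proof -
      have "((\<lambda>s. ?k m s) has_integral (- cos_kernel_int m (y - pi) / cos_kernel_mass n - - cos_kernel_int m (y - (- pi)) / cos_kernel_mass n)) {-pi..pi}"
      proof (rule fundamental_theorem_of_calculus)
        fix s
        have "((\<lambda>s. - cos_kernel_int m (y - s) / cos_kernel_mass n) has_real_derivative ?k m s) (at s within {-pi..pi})"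
        proof -
          have "((\<lambda>s. cos_kernel_int m (y - s)) has_real_derivative cos_weight (y - s) ^ m * (0 - 1)) (at s within {-pi..pi})"
            by (rule DERIV_chain'[OF _ cos_kernel_int_deriv]) (intro derivative_intros)
          from DERIV_cdivide[OF DERIV_minus[OF this]] show ?thesis by simp
        qed
        then show "((\<lambda>s. - cos_kernel_int m (y - s) / cos_kernel_mass n) has_vector_derivative ?k m s) (at s within {-pi..pi})"
          by (simp only: has_real_derivative_iff_has_vector_derivative)
      qed simp
      moreover have "- cos_kernel_int m (y - pi) / cos_kernel_mass n - - cos_kernel_int m (y - (- pi)) / cos_kernel_mass n = cos_kernel_mass m / cos_kernel_mass n"
      proof -
        have "y - pi + 2 * pi = y - (- pi)" by simp
        then have "cos_kernel_int m (y - (- pi)) = cos_kernel_int m (y - pi) + cos_kernel_mass m"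
          by (metis cos_kernel_int_shift)
        then show ?thesis by (simp add: add_divide_distrib diff_divide_distrib)
      qed
      ultimately show ?thesis by metis
    qed
    have M: "cos_kernel_mass n > 0" by (rule cos_kernel_mass_pos)
    have k1: "(?k n has_integral 1) {-pi..pi}" using k[of n] M by simp
    \<comment> \<open>The mean of \<open>1 - cos_weight (y - s)\<close> is read off as the relative
      mass lost between two consecutive powers.\<close>
    have "(\<lambda>s. ?k n s - ?k (Suc n) s) = (\<lambda>s. (1 - cos_weight (y - s)) * ?k n s)"
      by (rule ext) (simp add: left_diff_distrib diff_divide_distrib)
    moreover have "cos_kernel_mass n / cos_kernel_mass n - cos_kernel_mass (Suc n) / cos_kernel_mass n = 1 / (2 * real n + 2)"
      unfolding diff_divide_distrib[symmetric] cos_kernel_mass_diff using M by simp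
    ultimately have k2: "((\<lambda>s. (1 - cos_weight (y - s)) * ?k n s) has_integral 1 / (2 * real n + 2)) {-pi..pi}"
      using has_integral_diff[OF k[of n] k[of "Suc n"]] by (simp only:)
    have fi: "(\<lambda>s. f s * ?k n s) integrable_on {-pi..pi}"
      by (intro integrable_continuous_real continuous_intros cont continuous_on_compose2[OF cw[of UNIV]]) (use M in auto)
    have "((\<lambda>s. f s * ?k n s - f y * ?k n s) has_integral (integral {-pi..pi} (\<lambda>s. f s * ?k n s) - f y * 1)) {-pi..pi}"
      by (intro has_integral_diff has_integral_mult_right k1 integrable_integral fi)
    then have i1: "((\<lambda>s. (f s - f y) * ?k n s) has_integral (integral {-pi..pi} (\<lambda>s. f s * ?k n s) - f y)) {-pi..pi}"
      by (simp add: left_diff_distrib diff_divide_distrib)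
    have i2: "((\<lambda>s. e * ?k n s + B * ((1 - cos_weight (y - s)) * ?k n s)) has_integral (e * 1 + B * (1 / (2 * real n + 2)))) {-pi..pi}"
      by (intro has_integral_add has_integral_mult_right k1 k2)
    have "norm (integral {-pi..pi} (\<lambda>s. (f s - f y) * ?k n s)) \<le>
        integral {-pi..pi} (\<lambda>s. e * ?k n s + B * ((1 - cos_weight (y - s)) * ?k n s))"
    proof (rule integral_norm_bound_integral)
      fix s assume s: "s \<in> {-pi..pi}"
      have k0: "0 \<le> ?k n s" using M cos_weight_bounds by simp
      have "norm ((f s - f y) * ?k n s) = \<bar>f s - f y\<bar> * ?k n s"
        unfolding real_norm_def abs_mult using k0 by (simp only: abs_of_nonneg)
      also have "\<dots> \<le> (e + B * (1 - cos_weight (y - s))) * ?k n s"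
        by (rule mult_right_mono[OF B(2)[OF s] k0])
      also have "\<dots> = e * ?k n s + B * ((1 - cos_weight (y - s)) * ?k n s)"
        by (simp only: distrib_right mult.assoc)
      finally show "norm ((f s - f y) * ?k n s) \<le> e * ?k n s + B * ((1 - cos_weight (y - s)) * ?k n s)" .
    qed (use i1 i2 in blast)+
    from this[unfolded integral_unique[OF i1] integral_unique[OF i2]] show ?thesis by simp
  qed
  have "(\<lambda>n. B * inverse (real (Suc n))) \<longlonglongrightarrow> 0"
    using tendsto_mult_right_zero[OF LIMSEQ_inverse_real_of_nat] by blast
  then obtain N where N: "\<And>n. n \<ge> N \<Longrightarrow> \<bar>B * inverse (real (Suc n))\<bar> < e"
    using e LIMSEQ_D[of _ 0 e] by fastforce
  show "\<exists>N. \<forall>n\<ge>N. norm (integral {-pi..pi} (\<lambda>s. f s * (cos_weight (y - s) ^ n / cos_kernel_mass n)) - f y) < r"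
  proof (intro exI[of _ N] allI impI)
    fix n assume "N \<le> n"
    have "B / (2 * real n + 2) \<le> B * inverse (real (Suc n))"
      using B(1) unfolding divide_inverse by (intro mult_left_mono le_imp_inverse_le) auto
    then have "B / (2 * real n + 2) < e" using N[OF \<open>N \<le> n\<close>] by linarith
    then show "norm (integral {-pi..pi} (\<lambda>s. f s * (cos_weight (y - s) ^ n / cos_kernel_mass n)) - f y) < r"
      unfolding real_norm_def using est[of n] e_def by linarith
  qed
qed

text \<open>One primitive alone gains 1 per period; the difference of two translates is periodic.
  Its derivative is a difference of two approximate identities, so pairing \<open>f\<close> with it
  samples \<open>f\<close> near \<open>x\<close> and near \<open>y\<close>.\<close>

lemma test_function_cos_kernel:
  "test_function (\<lambda>s. cos_kernel_primitive n (y - s) - cos_kernel_primitive n (x - s))" (is "test_function ?\<psi>")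
  "((\<lambda>s. cos_kernel_primitive n (y - s) - cos_kernel_primitive n (x - s)) has_real_derivative
     cos_weight (x - s) ^ n / cos_kernel_mass n - cos_weight (y - s) ^ n / cos_kernel_mass n) (at s)"
proof -
  show d: "(?\<psi> has_real_derivative
     cos_weight (x - s) ^ n / cos_kernel_mass n - cos_weight (y - s) ^ n / cos_kernel_mass n) (at s)" for s
    by (rule derivative_eq_intros DERIV_chain'[OF _ cos_kernel_primitive_deriv] refl | simp)+
  have w: "differentiable_upto m (\<lambda>s. cos_weight (y - s))" for m y
  proof -
    \<comment> \<open>Expanding \<open>cos (y - s)\<close> exhibits the weight as a trigonometric
      polynomial in \<open>s\<close>, so the closure rules apply.\<close>
    have "differentiable_upto m (\<lambda>s. 1 / 2 + (cos y / 2 * cos s + sin y / 2 * sin s))"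
      by (intro differentiable_upto_add differentiable_upto_mult differentiable_upto_const differentiable_upto_sin_cos)
    then show ?thesis by (simp add: cos_weight_def cos_diff add_divide_distrib)
  qed
  have "differentiable_upto m (\<lambda>s. inverse (cos_kernel_mass n) * cos_weight (x - s) ^ n +
      - inverse (cos_kernel_mass n) * cos_weight (y - s) ^ n)" for m
    by (intro differentiable_upto_add differentiable_upto_mult differentiable_upto_const differentiable_upto_power w)
  then have "differentiable_upto (Suc m) ?\<psi>" for m
    by (intro differentiable_upto_SucI[OF d]) (simp add: divide_inverse mult.commute)
  then have "(deriv ^^ m) ?\<psi> differentiable (at s)" for m s by (rule differentiable_upto_iterate)
  moreover have "periodic ?\<psi>"
  proof -
    have "cos_kernel_primitive n (y - (s + 2 * pi)) = cos_kernel_primitive n (y - s) - 1" for y s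
      using cos_kernel_primitive_shift[of n "y - (s + 2 * pi)"] by simp
    then show ?thesis by (simp add: periodic_def)
  qed
  ultimately show "test_function ?\<psi>" unfolding test_function_def by blast
qed

section \<open>Weak derivatives bounded in the essential supremum and Lipschitz functions\<close>

lemma AE_circle_neq: "AE s in circle. s \<noteq> a"
proof -
  have "AE s in lborel. s \<noteq> a" by (rule AE_lborel_singleton)
  then show ?thesis unfolding circle_def
    by (subst AE_restrict_space_iff) auto
qed

lemma AE_circle_mem: "AE s in circle. s \<in> {-pi<..<pi}"
proof -
  have "AE s in circle. s \<in> space circle" by (rule AE_space)
  with AE_circle_neq[of "-pi"] show ?thesis
    by eventually_elim (auto simp: circle_def space_restrict_space)
qed

text \<open>The fundamental theorem for weak derivatives. The test functions tend to the indicator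
  of \<open>{x<..y}\<close> off the two endpoints and stay bounded by 2, so dominated convergence
  handles the side with \<open>g\<close>; on the side with \<open>f\<close> the two approximate
  identities yield \<open>f y - f x\<close>. Keeping \<open>x\<close> and \<open>y\<close> inside
  (-pi, pi) keeps all arguments inside (-2 pi, 2 pi), where the limits are known.\<close>

lemma weak_derivative_integral:
  assumes g: "is_weak_derivative f g" and cont: "continuous_on UNIV f"
    and xy: "-pi < x" "x \<le> y" "y < pi"
  shows "(LINT s|circle. g s * indicator {x<..y} s) = f y - f x"
proof -
  have int: "integrable circle g" using g by (simp add: is_weak_derivative_def)
  have [measurable]: "g \<in> borel_measurable circle" using int by simp
  let ?\<psi> = "\<lambda>n s. cos_kernel_primitive n (y - s) - cos_kernel_primitive n (x - s)"
  let ?k = "\<lambda>n y s. cos_weight (y - s) ^ n / cos_kernel_mass n"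
  have cw: "continuous_on UNIV (\<lambda>s. cos_weight (y - s))" for y
    unfolding cos_weight_def[abs_def] by (intro continuous_intros) simp
  have ck: "continuous_on UNIV (\<lambda>s. f s * ?k n y s)" for n y
    using cos_kernel_mass_pos[of n] by (intro continuous_intros cont cw) auto
  have cd: "continuous_on UNIV (\<lambda>s. f s * (?k n x s - ?k n y s))" for n
    using cos_kernel_mass_pos[of n] by (intro continuous_intros cont cw) auto
  have dpsi: "deriv (?\<psi> n) = (\<lambda>s. ?k n x s - ?k n y s)" for n
    by (rule ext) (rule DERIV_imp_deriv[OF test_function_cos_kernel(2)])
  have contpsi: "continuous_on UNIV (?\<psi> n)" for n
    by (rule DERIV_continuous_on[OF has_field_derivative_at_within[OF test_function_cos_kernel(2)]])
  have eq: "(LINT s|circle. g s * ?\<psi> n s) =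
      integral {-pi..pi} (\<lambda>s. f s * ?k n y s) - integral {-pi..pi} (\<lambda>s. f s * ?k n x s)" for n
  proof -
    have "(LINT s|circle. f s * deriv (?\<psi> n) s) = - (LINT s|circle. g s * ?\<psi> n s)"
      using g test_function_cos_kernel(1) unfolding is_weak_derivative_def by blast
    moreover have "(LINT s|circle. f s * deriv (?\<psi> n) s) = integral {-pi..pi} (\<lambda>s. f s * ?k n x s - f s * ?k n y s)"
      unfolding dpsi by (subst integral_circle_eq(2)[OF cd]) (simp add: right_diff_distrib)
    moreover have "(\<lambda>s. f s * ?k n y s) integrable_on {-pi..pi}" for y
      by (rule integrable_continuous_real) (rule continuous_on_subset[OF ck], simp)
    ultimately show ?thesis by (simp add: Henstock_Kurzweil_Integration.integral_diff)
  qed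
  have "(\<lambda>n. LINT s|circle. g s * ?\<psi> n s) \<longlonglongrightarrow> f y - f x"
    unfolding eq using xy
    by (intro tendsto_diff cos_kernel_approximation continuous_on_subset[OF cont]) auto
  moreover have "(\<lambda>n. LINT s|circle. g s * ?\<psi> n s) \<longlonglongrightarrow> (LINT s|circle. g s * indicator {x<..y} s)"
  proof (rule integral_dominated_convergence[where w = "\<lambda>s. 2 * \<bar>g s\<bar>"])
    have [measurable]: "(\<lambda>s. s) \<in> borel_measurable circle" unfolding circle_def
      by (intro borel_measurable_restrict_space_iff[THEN iffD2] | simp add: measurable_restrict_space1)+
    have [measurable]: "?\<psi> n \<in> borel_measurable circle" for n
      unfolding circle_def by (rule measurable_restrict_space1) (use borel_measurable_continuous_onI[OF contpsi] in simp)
    show "(\<lambda>s. g s * ?\<psi> n s) \<in> borel_measurable circle" for n by measurable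
    show "(\<lambda>s. g s * indicator {x<..y} s) \<in> borel_measurable circle" by measurable
    show "integrable circle (\<lambda>s. 2 * \<bar>g s\<bar>)" using int by simp
    show "AE s in circle. (\<lambda>n. g s * ?\<psi> n s) \<longlonglongrightarrow> g s * indicator {x<..y} s"
      using AE_circle_mem AE_circle_neq[of x] AE_circle_neq[of y]
    proof eventually_elim
      fix s assume s: "s \<in> {-pi<..<pi}" "s \<noteq> x" "s \<noteq> y"
      have pos: "(\<lambda>n. cos_kernel_primitive n (z - s)) \<longlonglongrightarrow> 1 / 2" if "s < z" "z < pi" for z
        using that s by (intro cos_kernel_primitive_tendsto(1)) auto
      have neg: "(\<lambda>n. cos_kernel_primitive n (z - s)) \<longlonglongrightarrow> - 1 / 2" if "z < s" "-pi < z" for z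
        using cos_kernel_primitive_tendsto(2)[of "s - z"] that s by auto
      consider "s < x" | "x < s" "s < y" | "y < s" using s xy by linarith
      then have "(\<lambda>n. ?\<psi> n s) \<longlonglongrightarrow> indicator {x<..y} s"
      proof cases
        case 1 show ?thesis using tendsto_diff[OF pos[of y] pos[of x]] 1 xy by simp
      next
        case 2 show ?thesis using tendsto_diff[OF pos[of y] neg[of x]] 2 xy by simp
      next
        case 3 show ?thesis using tendsto_diff[OF neg[of y] neg[of x]] 3 xy by simp
      qed
      then show "(\<lambda>n. g s * ?\<psi> n s) \<longlonglongrightarrow> g s * indicator {x<..y} s" by (intro tendsto_mult tendsto_const)
    qed
    show "AE s in circle. norm (g s * ?\<psi> n s) \<le> 2 * \<bar>g s\<bar>" for n
      using AE_circle_mem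
    proof eventually_elim
      fix s assume s: "s \<in> {-pi<..<pi}"
      have "\<bar>cos_kernel_primitive n (y - s)\<bar> \<le> 1" "\<bar>cos_kernel_primitive n (x - s)\<bar> \<le> 1"
        by (rule cos_kernel_primitive_bound; use s xy in auto)+
      then have "\<bar>?\<psi> n s\<bar> \<le> 2" by linarith
      then have "\<bar>g s\<bar> * \<bar>?\<psi> n s\<bar> \<le> \<bar>g s\<bar> * 2" by (intro mult_left_mono) auto
      then show "norm (g s * ?\<psi> n s) \<le> 2 * \<bar>g s\<bar>" by (simp add: abs_mult)
    qed
  qed
  ultimately show ?thesis using LIMSEQ_unique by blast
qed


text \<open>On \<open>{a<..b}\<close> the Stieltjes measure of \<open>F\<close> agrees with \<open>p\<close> times Lebesgue measure, by a
  Dynkin-system argument; evaluating both on \<open>{p < 0}\<close> shows that set to be null.\<close>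

lemma AE_circle_nonneg:
  fixes p F :: "real \<Rightarrow> real"
  assumes int: "integrable circle p" and cont: "continuous_on UNIV F"
    and mono: "\<And>x y. x \<le> y \<Longrightarrow> F x \<le> F y"
    and eq: "\<And>x y. -pi < x \<Longrightarrow> x \<le> y \<Longrightarrow> y < pi \<Longrightarrow> (LINT s|circle. p s * indicator {x<..y} s) = F y - F x"
  shows "AE s in circle. 0 \<le> p s"
proof -
  define \<nu> where "\<nu> = interval_measure F"
  have sets_\<nu>: "sets \<nu> = sets borel" by (simp add: \<nu>_def)
  have rc: "continuous (at_right a) F" for a
    using cont by (auto simp: continuous_on_eq_continuous_within intro: continuous_within_subset)
  have [measurable]: "p \<in> borel_measurable circle" using int by simp
  have sets_circle: "A \<in> sets circle \<longleftrightarrow> A \<in> sets borel \<and> A \<subseteq> {-pi..<pi}" for A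
    unfolding circle_def by (subst sets_restrict_space_iff) auto
  have local: "AE s in circle. s \<in> {a<..b} \<longrightarrow> 0 \<le> p s" if ab: "-pi < a" "a \<le> b" "b < pi" for a b
  proof -
    let ?I = "{a<..b}"
    have em: "emeasure \<nu> {x<..y} = ennreal (F y - F x)" if "x \<le> y" for x y
      unfolding \<nu>_def by (rule emeasure_interval_measure_Ioc[OF that mono rc])
    have fin: "emeasure \<nu> (A \<inter> ?I) \<noteq> \<infinity>" if "A \<in> sets borel" for A
    proof -
      have "emeasure \<nu> (A \<inter> ?I) \<le> emeasure \<nu> ?I" by (intro emeasure_mono) (auto simp: sets_\<nu>)
      also have "\<dots> < \<infinity>" unfolding em[OF ab(2)] by simp
      finally show ?thesis by simp
    qed
    have mem: "A \<inter> ?I \<in> sets circle" if "A \<in> sets borel" for A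
      using that ab by (auto simp: sets_circle)
    have int_ind: "integrable circle (\<lambda>s. p s * indicator (A \<inter> ?I) s)" if "A \<in> sets borel" for A
      using integrable_mult_indicator[OF mem[OF that] int] by (simp add: mult.commute)
    have P: "measure \<nu> (A \<inter> ?I) = (LINT s|circle. p s * indicator (A \<inter> ?I) s)" if "A \<in> sets borel" for A
    proof -
      let ?G = "range (\<lambda>(c, d). {c<..d::real})"
      have borel: "sets borel = sigma_sets UNIV ?G"
        by (subst borel_sigma_sets_Ioc) (simp add: sets_measure_of)
      have stable: "Int_stable ?G"
      proof (rule Int_stableI)
        fix A B assume "A \<in> ?G" "B \<in> ?G"
        then obtain c d c' d' where "A = {c<..d}" "B = {c'<..d'}" by auto
        then have "A \<inter> B = {max c c'<..min d d'}" by auto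
        then show "A \<inter> B \<in> ?G" by (auto intro!: image_eqI[of _ _ "(max c c', min d d')"])
      qed
      have G: "?G \<subseteq> Pow UNIV" by simp
      have "A \<in> sigma_sets UNIV ?G" using that by (simp add: borel)
      with stable G show ?thesis
      proof (induction rule: sigma_sets_induct_disjoint)
        case (basic A)
        then obtain c d where A: "A = {c<..d}" by auto
        show ?case
        proof (cases "max c a \<le> min d b")
          case True
          have "A \<inter> ?I = {max c a<..min d b}" using A by auto
          moreover have "(LINT s|circle. p s * indicator {max c a<..min d b} s) = F (min d b) - F (max c a)"
            using True ab by (intro eq) auto
          moreover have "measure \<nu> {max c a<..min d b} = F (min d b) - F (max c a)"
            using em[OF True] mono[OF True] by (simp add: measure_def)
          ultimately show ?thesis by simp
        next
          case False
          then have "A \<inter> ?I = {}" using A by auto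
          then show ?thesis by simp
        qed
      next
        case (compl A)
        then have A: "A \<in> sets borel" by (simp add: borel)
        have I: "UNIV \<inter> ?I = ?I" "UNIV \<in> sets (borel :: real measure)" by auto
        have e: "(UNIV - A) \<inter> ?I = ?I - A \<inter> ?I" by auto
        have tot: "measure \<nu> ?I = (LINT s|circle. p s * indicator ?I s)"
          using eq[OF ab] em[OF ab(2)] mono[OF ab(2)] by (simp add: measure_def)
        have "measure \<nu> (?I - A \<inter> ?I) = measure \<nu> ?I - measure \<nu> (A \<inter> ?I)"
          using fin[OF I(2)] A by (intro measure_Diff) (auto simp: sets_\<nu>)
        also have "\<dots> = (LINT s|circle. p s * indicator ?I s - p s * indicator (A \<inter> ?I) s)"
          unfolding tot compl.IH using int_ind[OF I(2)] int_ind[OF A] by simp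
        also have "\<dots> = (LINT s|circle. p s * indicator (?I - A \<inter> ?I) s)"
          by (intro Bochner_Integration.integral_cong) (auto simp: indicator_def)
        finally show ?case unfolding e .
      next
        case (union A)
        then have A: "A i \<in> sets borel" for i by (auto simp: borel)
        have U: "(\<Union>i. A i) \<in> sets borel" using A by auto
        have e: "(\<Union>i. A i) \<inter> ?I = (\<Union>i. A i \<inter> ?I)" by auto
        have dis: "disjoint_family (\<lambda>i. A i \<inter> ?I)"
          using union(1) by (auto simp: disjoint_family_on_def)
        have "(\<lambda>i. measure \<nu> (A i \<inter> ?I)) sums measure \<nu> (\<Union>i. A i \<inter> ?I)"
          using fin[OF U] A dis unfolding e by (intro measure_UNION) (auto simp: sets_\<nu>)
        moreover have "(LINT s:(\<Union>i. A i \<inter> ?I)|circle. p s) = (\<Sum>i. LINT s:(A i \<inter> ?I)|circle. p s)"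
        proof (rule lebesgue_integral_countable_add)
          show "set_integrable circle (\<Union>i. A i \<inter> ?I) p"
            using int_ind[OF U] unfolding e set_integrable_def by (simp add: mult.commute)
        qed (use mem[OF A] dis in \<open>auto simp: disjoint_family_on_def\<close>)
        ultimately show ?case unfolding e
          by (simp add: set_lebesgue_integral_def union(3) mult.commute sums_iff)
      qed simp
    qed
    let ?A = "{s \<in> space circle. p s < 0}"
    have "?A \<in> sets circle" by measurable
    then have A: "?A \<in> sets borel" by (simp add: sets_circle)
    have "0 \<le> (LINT s|circle. p s * indicator (?A \<inter> ?I) s)" using P[OF A] by (metis measure_nonneg)
    moreover have nn: "AE s in circle. 0 \<le> - (p s * indicator (?A \<inter> ?I) s)"
      by (auto simp: indicator_def)
    then have "0 \<le> (LINT s|circle. - (p s * indicator (?A \<inter> ?I) s))" by (rule integral_nonneg_AE)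
    ultimately have "(LINT s|circle. - (p s * indicator (?A \<inter> ?I) s)) = 0" by simp
    then have "AE s in circle. - (p s * indicator (?A \<inter> ?I) s) = 0"
      using integral_nonneg_eq_0_iff_AE[OF integrable_minus[OF int_ind[OF A]] nn] by simp
    then show ?thesis using AE_space[of circle]
      by eventually_elim (auto simp: indicator_def split: if_splits)
  qed
  \<comment> \<open>The hypothesis on increments concerns only intervals inside (-pi, pi), so the
    circle is exhausted by intervals whose endpoints keep a distance 1/(n+1) from its cut.\<close>
  have "AE s in circle. s \<in> {- pi + 1 / real (n + 1) <.. pi - 1 / real (n + 1)} \<longrightarrow> 0 \<le> p s" for n
  proof (rule local)
    have "1 / real (n + 1) \<le> 1" by simp
    then show "- pi + 1 / real (n + 1) \<le> pi - 1 / real (n + 1)" using pi_gt3 by linarith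
  qed auto
  then have "AE s in circle. \<forall>n. s \<in> {- pi + 1 / real (n + 1) <.. pi - 1 / real (n + 1)} \<longrightarrow> 0 \<le> p s"
    by (intro AE_all_countable[THEN iffD2] allI)
  then show ?thesis using AE_circle_mem
  proof eventually_elim
    fix s assume a: "\<forall>n. s \<in> {- pi + 1 / real (n + 1) <.. pi - 1 / real (n + 1)} \<longrightarrow> 0 \<le> p s" "s \<in> {-pi<..<pi}"
    then have "0 < min (s + pi) (pi - s)" by auto
    then obtain n where n: "inverse (real (Suc n)) < min (s + pi) (pi - s)" using reals_Archimedean by blast
    then have "s \<in> {- pi + 1 / real (n + 1) <.. pi - 1 / real (n + 1)}" by (auto simp: divide_inverse)
    then show "0 \<le> p s" using a by blast
  qed
qed

text \<open>Lipschitz bounds on two intervals sharing an endpoint glue without loss in the constant.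
  Translates of one period are glued until they cover both points under comparison.\<close>

lemma periodic_lipschitz_extend:
  assumes per: "periodic f" and lip: "K-lipschitz_on {-pi..pi} f"
  shows "K-lipschitz_on UNIV f"
proof -
  have K: "0 \<le> K" using lip lipschitz_on_nonneg by blast
  have shift: "f (x - 2 * pi * of_int n) = f x" for x n
    using periodic_int[OF per, of x "- n"] by simp
  have cell: "K-lipschitz_on {2 * pi * of_int n - pi..2 * pi * of_int n + pi} f" for n :: int
  proof (rule lipschitz_onI[OF _ K])
    fix x y assume "x \<in> {2 * pi * of_int n - pi..2 * pi * of_int n + pi}" "y \<in> {2 * pi * of_int n - pi..2 * pi * of_int n + pi}"
    then have "x - 2 * pi * of_int n \<in> {-pi..pi}" "y - 2 * pi * of_int n \<in> {-pi..pi}" by auto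
    from lipschitz_onD[OF lip this] show "dist (f x) (f y) \<le> K * dist x y"
      by (simp add: shift dist_real_def)
  qed
  have main: "K-lipschitz_on {2 * pi * of_int n - pi..2 * pi * of_int n - pi + 2 * pi * real m} f" for n :: int and m
  proof (induction m)
    case 0 show ?case by (rule lipschitz_on_subset[OF cell[of n]]) auto
  next
    case (Suc m)
    have "K-lipschitz_on {2 * pi * of_int n - pi + 2 * pi * real m..2 * pi * of_int n - pi + 2 * pi * real (Suc m)} f"
      using cell[of "n + int m"] by (simp add: algebra_simps)
    from lipschitz_on_concat[OF Suc.IH this refl]
    have "K-lipschitz_on {2 * pi * of_int n - pi..2 * pi * of_int n - pi + 2 * pi * real (Suc m)}
       (\<lambda>x. if x \<le> 2 * pi * of_int n - pi + 2 * pi * real m then f x else f x)" .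
    then show ?case by (simp only: if_cancel)
  qed
  show ?thesis
  proof (rule lipschitz_onI[OF _ K])
    fix x y :: real
    define R where "R = \<bar>x\<bar> + \<bar>y\<bar>"
    obtain N :: nat where N: "R < real N" using reals_Archimedean2 by blast
    have "real N \<le> 2 * pi * real N" using pi_gt3 by (simp add: mult_le_cancel_right1)
    then have "{x, y} \<subseteq> {2 * pi * of_int (- int N) - pi..2 * pi * of_int (- int N) - pi + 2 * pi * real (2 * N + 1)}"
      using N pi_gt3 by (auto simp: R_def algebra_simps abs_le_iff)
    then show "dist (f x) (f y) \<le> K * dist x y" using lipschitz_onD[OF main[of "- int N" "2 * N + 1"]] by blast
  qed
qed

lemma weak_derivative_bound_imp_lipschitz:
  assumes g: "is_weak_derivative f g" and cont: "continuous_on UNIV f" and per: "periodic f"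
    and K: "Linf_norm g \<le> ereal K"
  shows "K-lipschitz_on UNIV f"
proof -
  have int: "integrable circle g" using g by (simp add: is_weak_derivative_def)
  have ae: "AE s in circle. \<bar>g s\<bar> \<le> K"
    using esssup_AE[of "\<lambda>s. ereal \<bar>g s\<bar>" circle]
    by eventually_elim (use K in \<open>auto simp: Linf_norm_def dest: order_trans\<close>)
  have pos: "emeasure circle (space circle) = ennreal (2 * pi)"
    unfolding circle_def by (simp add: emeasure_restrict_space space_restrict_space)
  \<comment> \<open>A negative \<open>K\<close> would make the almost everywhere bound on |g|
    contradictory, and the circle has positive measure.\<close>
  have K0: "0 \<le> K"
  proof (rule ccontr)
    assume "\<not> 0 \<le> K"
    have "AE s in circle. False"
      using ae by (rule AE_mp) (use \<open>\<not> 0 \<le> K\<close> in \<open>auto intro!: AE_I2\<close>)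
    then have "emeasure circle (space circle) = 0" using AE_iff_null[of circle "\<lambda>_. False"] by (auto simp: null_sets_def)
    then show False using pos by simp
  qed
  have le: "\<bar>f y - f x\<bar> \<le> K * (y - x)" if xy: "-pi < x" "x \<le> y" "y < pi" for x y
  proof -
    have [measurable]: "{x<..y} \<in> sets circle" unfolding circle_def
      using xy by (subst sets_restrict_space_iff) auto
    have m: "measure circle {x<..y} = y - x" unfolding circle_def
      using xy by (subst measure_restrict_space) auto
    have i: "integrable circle (\<lambda>s. K * indicator {x<..y} s)"
    proof (intro integrable_mult_right integrable_real_indicator)
      have "emeasure circle {x<..y} \<le> emeasure circle (space circle)" by (rule emeasure_space)
      also have "\<dots> < \<infinity>" unfolding pos by simp
      finally show "emeasure circle {x<..y} < \<infinity>" .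
    qed simp
    have ig: "integrable circle (\<lambda>s. g s * indicator {x<..y} s)"
      using integrable_mult_indicator[OF _ int, of "{x<..y}"] by (simp add: mult.commute)
    have "\<bar>f y - f x\<bar> \<le> (LINT s|circle. \<bar>g s * indicator {x<..y} s\<bar>)"
      unfolding weak_derivative_integral[OF g cont xy, symmetric] by (rule integral_abs_bound)
    also have "\<dots> \<le> (LINT s|circle. K * indicator {x<..y} s)"
    proof (rule integral_mono_AE)
      show "integrable circle (\<lambda>s. \<bar>g s * indicator {x<..y} s\<bar>)" using ig by (rule integrable_abs)
      show "AE s in circle. \<bar>g s * indicator {x<..y} s\<bar> \<le> K * indicator {x<..y} s"
        using ae by eventually_elim (simp add: indicator_def)
    qed (rule i)
    finally have "\<bar>f y - f x\<bar> \<le> (LINT s|circle. K * indicator {x<..y} s)" .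
    then show ?thesis using m by (simp add: integral_mult_right_zero)
  qed
  \<comment> \<open>The increment formula holds strictly inside the cut; continuity reaches the
    endpoints, and periodicity the whole line.\<close>
  have "K-lipschitz_on {-pi<..<pi} f"
    by (rule lipschitz_on_leI[OF _ K0]) (use le in \<open>auto simp: dist_real_def abs_minus_commute\<close>)
  then have "K-lipschitz_on (closure {-pi<..<pi}) f"
    by (rule lipschitz_on_closure) (rule continuous_on_subset[OF cont], simp)
  then have "K-lipschitz_on {-pi..pi} f" using pi_gt_zero by (simp add: closure_greaterThanLessThan)
  then show ?thesis by (rule periodic_lipschitz_extend[OF per])
qed

text \<open>Both \<open>K * x - f x\<close> and \<open>K * x + f x\<close> are nondecreasing, with
  densities \<open>K - g\<close> and \<open>K + g\<close>. Nonnegativity of these densities almost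
  everywhere is the claimed bound, and no pointwise differentiation of \<open>f\<close>
  enters.\<close>

lemma lipschitz_imp_weak_derivative_bound:
  assumes g: "is_weak_derivative f g" and lip: "K-lipschitz_on UNIV f"
  shows "Linf_norm g \<le> ereal K"
proof -
  have cont: "continuous_on UNIV f" using lip by (rule lipschitz_on_continuous_on)
  have int: "integrable circle g" using g by (simp add: is_weak_derivative_def)
  have K0: "0 \<le> K" using lip lipschitz_on_nonneg by blast
  have pos: "emeasure circle (space circle) = ennreal (2 * pi)"
    unfolding circle_def by (simp add: emeasure_restrict_space space_restrict_space)
  have ic: "integrable circle (\<lambda>s. K)" by (rule finite_measure.integrable_const, rule finite_measureI) (simp add: pos)
  have fl: "\<bar>f y - f x\<bar> \<le> K * (y - x)" if "x \<le> y" for x y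
    using lipschitz_onD[OF lip, of x y] that by (simp add: dist_real_def abs_minus_commute)
  have cI: "(LINT s|circle. K * indicator {x<..y} s) = K * (y - x)"
    "integrable circle (\<lambda>s. K * indicator {x<..y} s)" "integrable circle (\<lambda>s. g s * indicator {x<..y} s)"
    if xy: "-pi < x" "x \<le> y" "y < pi" for x y
  proof -
    have [measurable]: "{x<..y} \<in> sets circle" unfolding circle_def
      using xy by (subst sets_restrict_space_iff) auto
    have m: "measure circle {x<..y} = y - x" unfolding circle_def
      using xy by (subst measure_restrict_space) auto
    then show "(LINT s|circle. K * indicator {x<..y} s) = K * (y - x)" by (simp add: integral_mult_right_zero)
    show "integrable circle (\<lambda>s. K * indicator {x<..y} s)" "integrable circle (\<lambda>s. g s * indicator {x<..y} s)"
      using integrable_mult_indicator[OF _ ic, of "{x<..y}"] integrable_mult_indicator[OF _ int, of "{x<..y}"]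
      by (simp_all add: mult.commute)
  qed
  have "AE s in circle. 0 \<le> K - g s"
  proof (rule AE_circle_nonneg[where F = "\<lambda>x. K * x - f x"])
    show "(LINT s|circle. (K - g s) * indicator {x<..y} s) = (K * y - f y) - (K * x - f x)" if "-pi < x" "x \<le> y" "y < pi" for x y
      using cI[OF that] weak_derivative_integral[OF g cont that] by (simp add: left_diff_distrib right_diff_distrib)
    show "K * x - f x \<le> K * y - f y" if "x \<le> y" for x y using fl[OF that] by (simp add: right_diff_distrib abs_le_iff)
  qed (auto intro!: continuous_intros cont ic int)
  moreover have "AE s in circle. 0 \<le> K + g s"
  proof (rule AE_circle_nonneg[where F = "\<lambda>x. K * x + f x"])
    show "(LINT s|circle. (K + g s) * indicator {x<..y} s) = (K * y + f y) - (K * x + f x)" if "-pi < x" "x \<le> y" "y < pi" for x y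
      using cI[OF that] weak_derivative_integral[OF g cont that] by (simp add: distrib_right right_diff_distrib)
    show "K * x + f x \<le> K * y + f y" if "x \<le> y" for x y using fl[OF that] by (simp add: right_diff_distrib abs_le_iff)
  qed (auto intro!: continuous_intros cont ic int)
  ultimately have "AE s in circle. ereal \<bar>g s\<bar> \<le> ereal K"
    by eventually_elim (simp add: abs_le_iff)
  then show ?thesis unfolding Linf_norm_def
    by (intro esssup_I) (use int in auto)
qed

lemma W1inf_weak_derivative:
  assumes "f \<in> W1inf"
  shows "is_weak_derivative f (weak_derivative f)" "\<exists>K. K-lipschitz_on UNIV f" "periodic f" "continuous_on UNIV f"
proof -
  from assms obtain g where f: "periodic f" "continuous_on UNIV f" and g: "is_weak_derivative f g" "Linf_norm g < \<infinity>"
    by (auto simp: W1inf_def)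
  show "periodic f" "continuous_on UNIV f" by fact+
  show "is_weak_derivative f (weak_derivative f)"
    unfolding weak_derivative_def by (rule someI[of "is_weak_derivative f", OF g(1)])
  have "\<exists>K. Linf_norm g \<le> ereal K" using g(2) by (cases "Linf_norm g") auto
  then show "\<exists>K. K-lipschitz_on UNIV f" using weak_derivative_bound_imp_lipschitz[OF g(1) f(2,1)] by blast
qed

section \<open>The Lagrangian flow\<close>

lemma mvt_within_atLeast:
  fixes f :: "real \<Rightarrow> real"
  assumes "\<And>s. a \<le> s \<Longrightarrow> s \<le> b \<Longrightarrow> (f has_real_derivative f' s) (at s within {0..})" "0 \<le> a" "a < b"
  obtains s where "a < s" "s < b" "f b - f a = f' s * (b - a)"
proof -
  have "\<exists>s\<in>{a<..<b}. f b - f a = (\<lambda>x. f' s * x) (b - a)"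
  proof (rule mvt_simple[OF assms(3), of f "\<lambda>s x. f' s * x"])
    fix s assume s: "a \<le> s" "s \<le> b"
    show "(f has_derivative (\<lambda>x. f' s * x)) (at s within {a..b})"
      using DERIV_subset[OF assms(1), of s "{a..b}"] s assms(2)
      by (auto simp: has_field_derivative_def)
  qed
  then show ?thesis using that by auto
qed

lemma nondecreasing_within_atLeast:
  fixes f :: "real \<Rightarrow> real"
  assumes "\<And>s. a \<le> s \<Longrightarrow> s \<le> b \<Longrightarrow> (f has_real_derivative f' s) (at s within {0..})"
    and "\<And>s. a \<le> s \<Longrightarrow> s \<le> b \<Longrightarrow> 0 \<le> f' s" "0 \<le> a" "a \<le> b"
  shows "f a \<le> f b"
proof (cases "a = b")
  case False
  then have "a < b" using assms(4) by simp
  then obtain s where s: "a < s" "s < b" "f b - f a = f' s * (b - a)"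
    using mvt_within_atLeast[OF assms(1) assms(3), of b] by blast
  have "0 \<le> f' s * (b - a)" using assms(2)[of s] s \<open>a < b\<close> by (intro mult_nonneg_nonneg) auto
  then show ?thesis using s(3) by linarith
qed simp

lemma abs_diff_le_within_atLeast:
  fixes f :: "real \<Rightarrow> real"
  assumes d: "\<And>s. a \<le> s \<Longrightarrow> s \<le> b \<Longrightarrow> (f has_real_derivative f' s) (at s within {0..})"
    and bd: "\<And>s. a \<le> s \<Longrightarrow> s \<le> b \<Longrightarrow> \<bar>f' s\<bar> \<le> C" and ab: "0 \<le> a" "a \<le> b"
  shows "\<bar>f b - f a\<bar> \<le> C * (b - a)"
proof -
  have nn: "0 \<le> C - f' s" "0 \<le> C + f' s" if "a \<le> s" "s \<le> b" for s
    using bd[OF that] by linarith+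
  have "C * a - f a \<le> C * b - f b"
    by (rule nondecreasing_within_atLeast[where f = "\<lambda>s. C * s - f s" and f' = "\<lambda>s. C - f' s"])
      (use nn ab in \<open>auto intro!: derivative_eq_intros d\<close>)
  moreover have "C * a + f a \<le> C * b + f b"
    by (rule nondecreasing_within_atLeast[where f = "\<lambda>s. C * s + f s" and f' = "\<lambda>s. C + f' s"])
      (use nn ab in \<open>auto intro!: derivative_eq_intros d\<close>)
  ultimately show ?thesis by (simp add: abs_le_iff algebra_simps)
qed

lemma abs_diff_le_of_deriv:
  fixes f :: "real \<Rightarrow> real"
  assumes "\<And>x. (f has_real_derivative f' x) (at x)" "\<And>x. \<bar>f' x\<bar> \<le> C"
  shows "\<bar>f x - f y\<bar> \<le> C * \<bar>x - y\<bar>"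
  using field_differentiable_bound[of UNIV f f' C x y] assms by auto

lemma has_real_derivative_quadratic_remainder:
  fixes f :: "real \<Rightarrow> real"
  assumes "\<And>y. \<bar>f y - f x - D * (y - x)\<bar> \<le> B * \<bar>y - x\<bar>\<^sup>2"
  shows "(f has_real_derivative D) (at x)"
proof -
  have "((\<lambda>y. (f y - f x) / (y - x)) \<longlongrightarrow> D) (at x)"
  proof (rule LIM_zero_cancel, rule Lim_null_comparison)
    show "\<forall>\<^sub>F y in at x. norm ((f y - f x) / (y - x) - D) \<le> B * \<bar>y - x\<bar>"
      unfolding eventually_at_filter
    proof (rule always_eventually, intro allI impI)
      fix y assume "y \<noteq> x"
      then have "(f y - f x) / (y - x) - D = (f y - f x - D * (y - x)) / (y - x)" by (simp add: diff_divide_distrib)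
      then have "norm ((f y - f x) / (y - x) - D) = \<bar>f y - f x - D * (y - x)\<bar> / \<bar>y - x\<bar>" by simp
      also have "\<dots> \<le> B * \<bar>y - x\<bar>\<^sup>2 / \<bar>y - x\<bar>" by (rule divide_right_mono[OF assms]) simp
      also have "\<dots> = B * \<bar>y - x\<bar>"
        unfolding power2_eq_square mult.assoc[symmetric] using \<open>y \<noteq> x\<close> by (intro nonzero_mult_div_cancel_right) simp
      finally show "norm ((f y - f x) / (y - x) - D) \<le> B * \<bar>y - x\<bar>" .
    qed
    have "((\<lambda>y. B * \<bar>y - x\<bar>) \<longlongrightarrow> B * \<bar>x - x\<bar>) (at x)" by (intro tendsto_intros)
    then show "((\<lambda>y. B * \<bar>y - x\<bar>) \<longlongrightarrow> 0) (at x)" by simp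
  qed
  then show ?thesis by (simp add: has_field_derivative_iff)
qed

text \<open>These assumptions are preserved when a solution is reflected or rotated. The symmetries
  can therefore be obtained by instantiating the locale a second time and comparing the two
  flows.\<close>

locale lagrangian_solution =
  fixes h0 :: "real \<Rightarrow> real" and h H H' \<phi> :: "real \<Rightarrow> real \<Rightarrow> real"
  assumes lipschitz_initial: "\<exists>K. K-lipschitz_on UNIV h0"
    and periodic_h: "0 \<le> t \<Longrightarrow> periodic (h t)"
    and continuous_h: "continuous_on ({0..} \<times> UNIV) (\<lambda>(t, \<theta>). h t \<theta>)"
    and stream: "0 \<le> t \<Longrightarrow> stream_pair (h t) (H t) (H' t)"
    and flow_0: "\<phi> 0 \<theta> = \<theta>"
    and flow_deriv: "0 \<le> t \<Longrightarrow> ((\<lambda>s. \<phi> s \<theta>) has_real_derivative 2 * H t (\<phi> t \<theta>)) (at t within {0..})"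
    and transported: "0 \<le> t \<Longrightarrow> h t (\<phi> t \<theta>) = h0 \<theta>"
begin

text \<open>Since H'' = h - 4 H, the three quantities are the velocity and its first two space
  derivatives. One constant thus serves as speed limit and as Lipschitz constant of both velocity
  and strain up to time \<open>T\<close>.\<close>

definition velocity_bound :: "real \<Rightarrow> real \<Rightarrow> bool" where
  "velocity_bound T C \<longleftrightarrow> 0 \<le> T \<and> 0 < C \<and> (\<forall>t\<in>{0..T}. \<forall>x.
     \<bar>2 * H t x\<bar> \<le> C \<and> \<bar>2 * H' t x\<bar> \<le> C \<and> \<bar>2 * (h t x - 4 * H t x)\<bar> \<le> C)"

lemmas H_deriv = stream_pair_D(1)[OF stream]
lemmas H'_deriv = stream_pair_D(2)[OF stream]

lemma h_bounded:
  obtains M where "\<And>t x. 0 \<le> t \<Longrightarrow> t \<le> T \<Longrightarrow> \<bar>h t x\<bar> \<le> M"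
proof -
  have "compact ((\<lambda>(t, \<theta>). h t \<theta>) ` ({0..T} \<times> {-pi..pi}))"
    by (intro compact_continuous_image compact_Times continuous_on_subset[OF continuous_h]) auto
  from compact_imp_bounded[OF this] obtain M
    where M: "\<forall>z\<in>(\<lambda>(t, \<theta>). h t \<theta>) ` ({0..T} \<times> {-pi..pi}). norm z \<le> M"
    unfolding bounded_iff ..
  show ?thesis
  proof (rule that[of M])
    fix t x assume t: "0 \<le> t" "t \<le> T"
    obtain n :: int where n: "x + 2 * pi * of_int n \<in> {-pi..<pi}" by (rule periodic_reduce)
    have "norm ((\<lambda>(t, \<theta>). h t \<theta>) (t, x + 2 * pi * of_int n)) \<le> M"
      by (rule M[rule_format], rule imageI) (use t n in auto)
    then show "\<bar>h t x\<bar> \<le> M" by (simp only: prod.case periodic_int[OF periodic_h[OF t(1)]] real_norm_def)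
  qed
qed

lemma velocity_bound_exists:
  assumes "0 \<le> T" obtains C where "velocity_bound T C"
proof -
  obtain M where M: "\<And>t x. 0 \<le> t \<Longrightarrow> t \<le> T \<Longrightarrow> \<bar>h t x\<bar> \<le> M" by (rule h_bounded[of T]) (rule that, assumption)
  have M0: "0 \<le> M" using order_trans[OF abs_ge_zero M[OF order_refl assms]] .
  \<comment> \<open>With |H| \<le> 5 pi M and |H'| \<le> 10 pi M, the three quantities are at most
    10 pi M, 20 pi M and 2 M + 40 pi M; the summand 1 makes \<open>C\<close> positive even when
    \<open>M\<close> is 0.\<close>
  define C where "C = 60 * pi * M + 2 * M + 1"
  have piM: "0 \<le> pi * M" using M0 by simp
  have "velocity_bound T C" unfolding velocity_bound_def
  proof (intro conjI ballI allI)
    show "0 < C" unfolding C_def using M0 piM by (simp add: add_nonneg_pos)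
    fix t x assume "t \<in> {0..T}"
    then have t: "0 \<le> t" "t \<le> T" by auto
    have 1: "\<bar>H t x\<bar> \<le> 5 * pi * M" "\<bar>H' t x\<bar> \<le> 10 * pi * M" "\<bar>h t x\<bar> \<le> M"
      by (rule stream_pair_bound[OF stream[OF t(1)] M[OF t]] M[OF t])+
    show "\<bar>2 * H t x\<bar> \<le> C" "\<bar>2 * H' t x\<bar> \<le> C" "\<bar>2 * (h t x - 4 * H t x)\<bar> \<le> C"
      using 1 piM M0 unfolding C_def abs_le_iff right_diff_distrib by (simp_all only: mult.assoc) linarith+
  qed (use assms in auto)
  then show ?thesis by (rule that)
qed

section \<open>The flow and the strain on a bounded time interval\<close>

context
  fixes T C assumes vb: "velocity_bound T C"
begin

lemma C_pos: "0 < C"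
  using vb by (auto simp: velocity_bound_def)

lemma H_lipschitz: "t \<in> {0..T} \<Longrightarrow> \<bar>2 * H t x - 2 * H t y\<bar> \<le> C * \<bar>x - y\<bar>"
  by (rule abs_diff_le_of_deriv[where f' = "\<lambda>x. 2 * H' t x", OF DERIV_cmult[OF H_deriv]])
    (use vb in \<open>auto simp: velocity_bound_def\<close>)

lemma H'_lipschitz: "t \<in> {0..T} \<Longrightarrow> \<bar>2 * H' t x - 2 * H' t y\<bar> \<le> C * \<bar>x - y\<bar>"
  by (rule abs_diff_le_of_deriv[where f' = "\<lambda>x. 2 * (h t x - 4 * H t x)", OF DERIV_cmult[OF H'_deriv]])
    (use vb in \<open>auto simp: velocity_bound_def\<close>)

lemma flow_time_lipschitz:
  assumes "0 \<le> s" "s \<le> t" "t \<le> T" shows "\<bar>\<phi> t \<theta> - \<phi> s \<theta>\<bar> \<le> C * (t - s)"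
  by (rule abs_diff_le_within_atLeast[OF flow_deriv]) (use assms vb in \<open>auto simp: velocity_bound_def\<close>)

text \<open>Gronwall in both directions. The squared separation is used because it is
  differentiable; multiplied by \<open>exp (2 * C * s)\<close> it increases, multiplied by
  \<open>exp (- 2 * C * s)\<close> it decreases.\<close>

lemma flow_separation:
  assumes "t \<in> {0..T}"
  shows "\<bar>\<phi> t \<eta> - \<phi> t \<theta>\<bar> \<le> exp (C * t) * \<bar>\<eta> - \<theta>\<bar>" "\<bar>\<eta> - \<theta>\<bar> \<le> exp (C * t) * \<bar>\<phi> t \<eta> - \<phi> t \<theta>\<bar>"
proof -
  define u where "u s = \<phi> s \<eta> - \<phi> s \<theta>" for s
  define v where "v s = 2 * H s (\<phi> s \<eta>) - 2 * H s (\<phi> s \<theta>)" for s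
  have du: "(u has_real_derivative v s) (at s within {0..})" if "0 \<le> s" for s
    unfolding u_def[abs_def] v_def by (intro DERIV_diff flow_deriv that)
  have uv: "\<bar>u s * v s\<bar> \<le> C * (u s)\<^sup>2" if "0 \<le> s" "s \<le> t" for s
  proof -
    have "\<bar>u s\<bar> * \<bar>v s\<bar> \<le> \<bar>u s\<bar> * (C * \<bar>u s\<bar>)"
      unfolding u_def v_def using that assms by (intro mult_left_mono H_lipschitz) auto
    then show ?thesis by (simp add: abs_mult power2_eq_square mult_ac)
  qed
  have dE: "((\<lambda>s. exp (k * s) * (u s)\<^sup>2) has_real_derivative exp (k * s) * (k * (u s)\<^sup>2 + 2 * (u s * v s))) (at s within {0..})"
    if "0 \<le> s" for s k
    by (rule derivative_eq_intros du that refl | simp add: algebra_simps)+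
  have grow: "exp (2 * C * 0) * (u 0)\<^sup>2 \<le> exp (2 * C * t) * (u t)\<^sup>2"
  proof (rule nondecreasing_within_atLeast[OF dE])
    fix s assume s: "0 \<le> s" "s \<le> t"
    show "0 \<le> exp (2 * C * s) * (2 * C * (u s)\<^sup>2 + 2 * (u s * v s))"
      using uv[OF s] by (intro mult_nonneg_nonneg) (auto simp: abs_le_iff)
  qed (use assms in auto)
  have decay: "- (exp (- 2 * C * 0) * (u 0)\<^sup>2) \<le> - (exp (- 2 * C * t) * (u t)\<^sup>2)"
  proof (rule nondecreasing_within_atLeast[OF DERIV_minus[OF dE]])
    fix s assume s: "0 \<le> s" "s \<le> t"
    have "exp (- 2 * C * s) * (- 2 * C * (u s)\<^sup>2 + 2 * (u s * v s)) \<le> 0"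
      using uv[OF s] by (intro mult_nonneg_nonpos) (auto simp: abs_le_iff)
    then show "0 \<le> - (exp (- 2 * C * s) * (- 2 * C * (u s)\<^sup>2 + 2 * (u s * v s)))" by simp
  qed (use assms in auto)
  have u0: "u 0 = \<eta> - \<theta>" by (simp add: u_def flow_0)
  have e2: "(exp (C * t) * x)\<^sup>2 = exp (2 * C * t) * x\<^sup>2" for x
    by (simp add: power_mult_distrib exp_double[symmetric] mult.assoc)
  have "\<bar>\<eta> - \<theta>\<bar>\<^sup>2 \<le> (exp (C * t) * \<bar>u t\<bar>)\<^sup>2"
    using grow unfolding e2 by (simp add: u0)
  then show "\<bar>\<eta> - \<theta>\<bar> \<le> exp (C * t) * \<bar>\<phi> t \<eta> - \<phi> t \<theta>\<bar>"
    unfolding u_def by (rule power2_le_imp_le) simp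
  have "\<bar>u t\<bar>\<^sup>2 \<le> (exp (C * t) * \<bar>\<eta> - \<theta>\<bar>)\<^sup>2"
  proof -
    have "exp (2 * C * t) * (exp (- 2 * C * t) * (u t)\<^sup>2) \<le> exp (2 * C * t) * (u 0)\<^sup>2"
      using decay by (intro mult_left_mono) auto
    then show ?thesis unfolding e2 u0[symmetric] by (simp add: mult.assoc[symmetric] exp_add[symmetric])
  qed
  then show "\<bar>\<phi> t \<eta> - \<phi> t \<theta>\<bar> \<le> exp (C * t) * \<bar>\<eta> - \<theta>\<bar>"
    unfolding u_def by (rule power2_le_imp_le) simp
qed

lemma flow_separation_T:
  assumes "t \<in> {0..T}"
  shows "\<bar>\<phi> t \<eta> - \<phi> t \<theta>\<bar> \<le> exp (C * T) * \<bar>\<eta> - \<theta>\<bar>" "\<bar>\<eta> - \<theta>\<bar> \<le> exp (C * T) * \<bar>\<phi> t \<eta> - \<phi> t \<theta>\<bar>"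
proof -
  have "exp (C * t) * a \<le> exp (C * T) * a" if "0 \<le> a" for a
    using assms C_pos that by (intro mult_right_mono) auto
  then show "\<bar>\<phi> t \<eta> - \<phi> t \<theta>\<bar> \<le> exp (C * T) * \<bar>\<eta> - \<theta>\<bar>" "\<bar>\<eta> - \<theta>\<bar> \<le> exp (C * T) * \<bar>\<phi> t \<eta> - \<phi> t \<theta>\<bar>"
    using flow_separation[OF assms] order_trans abs_ge_zero by blast+
qed

lemma flow_continuous_space: "t \<in> {0..T} \<Longrightarrow> continuous_on UNIV (\<phi> t)"
  by (rule lipschitz_on_continuous_on[of "exp (C * T)"], rule lipschitz_onI)
    (use flow_separation_T in \<open>auto simp: dist_real_def\<close>)

text \<open>No trajectory moves farther than \<open>C * t\<close>, so the labels
  \<open>y - C * t\<close> and \<open>y + C * t\<close> are carried to opposite sides of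
  \<open>y\<close>, and the intermediate value theorem applies.\<close>

lemma flow_surj:
  assumes t: "t \<in> {0..T}" shows "\<exists>\<theta>. \<phi> t \<theta> = y"
proof -
  have d: "\<bar>\<phi> t \<theta> - \<theta>\<bar> \<le> C * t" for \<theta>
    using flow_time_lipschitz[of 0 t \<theta>] t by (simp add: flow_0)
  have Ct: "0 \<le> C * t" using C_pos t by simp
  have "\<exists>\<theta>\<ge>y - C * t. \<theta> \<le> y + C * t \<and> \<phi> t \<theta> = y"
  proof (rule IVT')
    show "\<phi> t (y - C * t) \<le> y" using d[of "y - C * t"] by linarith
    show "y \<le> \<phi> t (y + C * t)" using d[of "y + C * t"] by linarith
    show "y - C * t \<le> y + C * t" using Ct by linarith
    show "continuous_on {y - C * t..y + C * t} (\<phi> t)" using flow_continuous_space[OF t] continuous_on_subset by blast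
  qed
  then show ?thesis by blast
qed

text \<open>The profile is \<open>h0\<close> composed with the inverse flow. The factor
  \<open>a\<close> is left free: the crude exponential separation serves uniqueness, a sharp
  compression bound serves the final estimate.\<close>

lemma h_lipschitz_from_flow:
  assumes t: "t \<in> {0..T}" and K: "K-lipschitz_on UNIV h0"
    and sep: "\<And>\<eta> \<theta>. \<bar>\<eta> - \<theta>\<bar> \<le> a * \<bar>\<phi> t \<eta> - \<phi> t \<theta>\<bar>" and "0 \<le> a"
  shows "(K * a)-lipschitz_on UNIV (h t)"
proof (rule lipschitz_onI)
  have K0: "0 \<le> K" using K lipschitz_on_nonneg by blast
  then show "0 \<le> K * a" using \<open>0 \<le> a\<close> by simp
  fix x y
  obtain \<eta> \<theta> where e: "\<phi> t \<eta> = x" "\<phi> t \<theta> = y" using flow_surj[OF t] by blast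
  have "dist (h t x) (h t y) = dist (h0 \<eta>) (h0 \<theta>)" using transported[of t] t e by force
  also have "\<dots> \<le> K * \<bar>\<eta> - \<theta>\<bar>" using lipschitz_onD[OF K] by (simp add: dist_real_def)
  also have "\<dots> \<le> K * (a * \<bar>x - y\<bar>)" using sep[of \<eta> \<theta>] K0 unfolding e by (rule mult_left_mono)
  finally show "dist (h t x) (h t y) \<le> K * a * dist x y" by (simp add: dist_real_def mult.assoc)
qed

lemma flow_continuous: "continuous_on ({0..T} \<times> UNIV) (\<lambda>(t, \<theta>). \<phi> t \<theta>)"
proof (rule continuous_on_TimesI)
  show "local_lipschitz {0..T} UNIV \<phi>"
  proof (rule local_lipschitzI)
    fix t x assume "t \<in> {0..T}" "x \<in> (UNIV :: real set)"
    show "\<exists>u>0. \<exists>L. \<forall>t\<in>cball t u \<inter> {0..T}. L-lipschitz_on (cball x u \<inter> UNIV) (\<phi> t)"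
      by (rule exI[of _ 1], simp, rule exI[of _ "exp (C * T)"], intro ballI lipschitz_onI)
        (use flow_separation_T in \<open>auto simp: dist_real_def\<close>)
  qed
  fix x
  show "continuous_on {0..T} (\<lambda>t. \<phi> t x)"
    by (rule DERIV_continuous_on, rule DERIV_subset[OF flow_deriv]) auto
qed

lemma h_uniform:
  assumes "0 < e"
  obtains d where "0 < d" "\<And>s t x. s \<in> {0..T} \<Longrightarrow> t \<in> {0..T} \<Longrightarrow> \<bar>s - t\<bar> < d \<Longrightarrow> \<bar>h s x - h t x\<bar> \<le> e"
proof -
  have "uniformly_continuous_on ({0..T} \<times> {-pi..pi}) (\<lambda>(t, \<theta>). h t \<theta>)"
    by (intro compact_uniformly_continuous compact_Times continuous_on_subset[OF continuous_h]) auto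
  then obtain d where d: "0 < d" and D: "\<And>z z'. z \<in> {0..T} \<times> {-pi..pi} \<Longrightarrow> z' \<in> {0..T} \<times> {-pi..pi} \<Longrightarrow> dist z' z < d \<Longrightarrow>
      dist ((\<lambda>(t, \<theta>). h t \<theta>) z') ((\<lambda>(t, \<theta>). h t \<theta>) z) < e"
    using assms unfolding uniformly_continuous_on_def by metis
  show ?thesis
  proof (rule that[OF d])
    fix s t x assume st: "s \<in> {0..T}" "t \<in> {0..T}" "\<bar>s - t\<bar> < d"
    obtain n :: int where n: "x + 2 * pi * of_int n \<in> {-pi..<pi}" by (rule periodic_reduce)
    let ?y = "x + 2 * pi * of_int n"
    have "dist (h s ?y) (h t ?y) < e"
      using D[of "(t, ?y)" "(s, ?y)"] st n by (simp add: dist_Pair_Pair dist_real_def)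
    then show "\<bar>h s x - h t x\<bar> \<le> e"
      using st periodic_int[OF periodic_h, of s x n] periodic_int[OF periodic_h, of t x n]
      by (simp add: dist_real_def)
  qed
qed

text \<open>Joint continuity follows from a uniform Lipschitz bound in space and continuity in time
  at each fixed point. The latter holds because the map from profile to stream function is bounded
  in the supremum norm and \<open>h\<close> is continuous in time uniformly in space.\<close>

lemma stream_continuous:
  "continuous_on ({0..T} \<times> UNIV) (\<lambda>(t, x). H' t x)"
proof -
  have *: "continuous_on ({0..T} \<times> UNIV) (\<lambda>(t, x). G t x)"
    if L: "\<And>t x y. t \<in> {0..T} \<Longrightarrow> \<bar>2 * G t x - 2 * G t y\<bar> \<le> C * \<bar>x - y\<bar>"
      and B: "\<And>s t x e. s \<in> {0..T} \<Longrightarrow> t \<in> {0..T} \<Longrightarrow> (\<And>x. \<bar>h s x - h t x\<bar> \<le> e) \<Longrightarrow> \<bar>G s x - G t x\<bar> \<le> 10 * pi * e" for G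
  proof (rule continuous_on_TimesI)
    show "local_lipschitz {0..T} UNIV G"
    proof (rule local_lipschitzI)
      fix t x assume "t \<in> {0..T}" "x \<in> (UNIV :: real set)"
      have "\<bar>G t x - G t y\<bar> \<le> C * \<bar>x - y\<bar>" if "t \<in> {0..T}" for t x y
        using L[OF that, of x y] by (simp add: abs_le_iff)
      then show "\<exists>u>0. \<exists>L. \<forall>t\<in>cball t u \<inter> {0..T}. L-lipschitz_on (cball x u \<inter> UNIV) (G t)"
        by (intro exI[of _ 1] conjI exI[of _ C] ballI lipschitz_onI)
          (use C_pos in \<open>auto simp: dist_real_def\<close>)
    qed
    fix x
    show "continuous_on {0..T} (\<lambda>t. G t x)"
      unfolding continuous_on_iff
    proof (intro ballI allI impI)
      fix t e :: real assume t: "t \<in> {0..T}" and e: "0 < e"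
      \<comment> \<open>The derivative of the stream function costs a factor \<open>10 * pi\<close>,
        which leaves \<open>e / 2\<close>.\<close>
      then have "0 < e / (20 * pi)" by simp
      then obtain d where d: "0 < d" "\<And>s t x. s \<in> {0..T} \<Longrightarrow> t \<in> {0..T} \<Longrightarrow> \<bar>s - t\<bar> < d \<Longrightarrow> \<bar>h s x - h t x\<bar> \<le> e / (20 * pi)"
        using h_uniform by blast
      have "dist (G s x) (G t x) < e" if "s \<in> {0..T}" "dist s t < d" for s
      proof -
        have "\<bar>G s x - G t x\<bar> \<le> 10 * pi * (e / (20 * pi))"
          using d(2)[of s t] that t by (intro B) (auto simp: dist_real_def)
        also have "\<dots> < e" using e by simp
        finally show ?thesis by (simp add: dist_real_def)
      qed
      then show "\<exists>d>0. \<forall>s\<in>{0..T}. dist s t < d \<longrightarrow> dist (G s x) (G t x) < e" using d(1) by blast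
    qed
  qed
  show "continuous_on ({0..T} \<times> UNIV) (\<lambda>(t, x). H' t x)"
  proof (rule *[OF H'_lipschitz])
    fix s t x e assume "s \<in> {0..T}" "t \<in> {0..T}" "\<And>x. \<bar>h s x - h t x\<bar> \<le> e"
    then show "\<bar>H' s x - H' t x\<bar> \<le> 10 * pi * e"
      using stream_pair_bound(2)[OF stream_pair_diff[OF stream stream], of s t e x] by simp
  qed
qed

lemma strain_continuous: "continuous_on ({0..T} \<times> UNIV) (\<lambda>(t, \<theta>). 2 * H' t (\<phi> t \<theta>))"
proof -
  have "continuous_on ({0..T} \<times> UNIV) (\<lambda>z. (\<lambda>(t, x). H' t x) (fst z, (\<lambda>(t, \<theta>). \<phi> t \<theta>) z))"
    by (rule continuous_on_compose2[OF stream_continuous])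
      (auto intro!: continuous_intros flow_continuous)
  then show ?thesis by (auto simp: split_beta intro!: continuous_intros)
qed

lemma strain_continuous_time: "continuous_on {0..T} (\<lambda>s. 2 * H' s (\<phi> s \<theta>))"
proof -
  have "continuous_on {0..T} (\<lambda>s. (\<lambda>(t, \<theta>). 2 * H' t (\<phi> t \<theta>)) (s, \<theta>))"
    by (rule continuous_on_compose2[OF strain_continuous]) (auto intro!: continuous_intros)
  then show ?thesis by (simp only: prod.case)
qed

end

text \<open>Liouville's formula: the linearised flow J satisfies J' = 2 H' J along the trajectory,
  with J = 1 initially. The solution of that equation is written down first;
  \<open>flow_deriv_space\<close> then shows that it is the space derivative of the flow.\<close>

definition jacobian :: "real \<Rightarrow> real \<Rightarrow> real" where
  "jacobian t \<theta> = exp (integral {0..t} (\<lambda>s. 2 * H' s (\<phi> s \<theta>)))"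

lemma jacobian_pos: "0 < jacobian t \<theta>" and jacobian_0: "jacobian 0 \<theta> = 1"
  by (simp_all add: jacobian_def)

section \<open>Differentiability of the flow in space\<close>

context
  fixes T C assumes vb: "velocity_bound T C"
begin

lemma jacobian_deriv_time:
  assumes t: "t \<in> {0..T}"
  shows "((\<lambda>s. jacobian s \<theta>) has_real_derivative jacobian t \<theta> * (2 * H' t (\<phi> t \<theta>))) (at t within {0..T})"
proof -
  have "((\<lambda>u. integral {0..u} (\<lambda>s. 2 * H' s (\<phi> s \<theta>))) has_real_derivative 2 * H' t (\<phi> t \<theta>)) (at t within {0..T})"
    by (rule integral_has_real_derivative[OF strain_continuous_time[OF vb] t])
  then show ?thesis unfolding jacobian_def by (rule DERIV_chain'[OF _ DERIV_exp, THEN DERIV_cong]) simp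
qed

lemma jacobian_bounds:
  assumes t: "t \<in> {0..T}"
  shows "jacobian t \<theta> \<le> exp (C * T)" "exp (- (C * T)) \<le> jacobian t \<theta>"
proof -
  have "\<bar>integral {0..t} (\<lambda>s. 2 * H' s (\<phi> s \<theta>))\<bar> \<le> C * (t - 0)"
    unfolding real_norm_def[symmetric]
    by (rule integral_bound)
      (use t vb in \<open>auto simp: velocity_bound_def intro!: continuous_on_subset[OF strain_continuous_time[OF vb]]\<close>)
  also have "\<dots> \<le> C * T" using t vb by (auto simp: velocity_bound_def)
  finally show "jacobian t \<theta> \<le> exp (C * T)" "exp (- (C * T)) \<le> jacobian t \<theta>"
    unfolding jacobian_def by (auto simp: abs_le_iff)
qed

text \<open>The exponent is Lipschitz in the label, because the strain is \<open>C\<close>-Lipschitz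
  in space and trajectories separate by at most the factor \<open>exp (C * T)\<close>; in time it is
  an indefinite integral.\<close>

lemma jacobian_continuous: "continuous_on ({0..T} \<times> UNIV) (\<lambda>(t, \<theta>). jacobian t \<theta>)"
proof -
  let ?I = "\<lambda>t \<theta>. integral {0..t} (\<lambda>s. 2 * H' s (\<phi> s \<theta>))"
  have C: "0 < C" "0 \<le> T" using vb by (auto simp: velocity_bound_def)
  have int: "(\<lambda>s. 2 * H' s (\<phi> s \<theta>)) integrable_on {0..t}" if "t \<in> {0..T}" for t \<theta>
    using that by (intro integrable_continuous_real continuous_on_subset[OF strain_continuous_time[OF vb]]) auto
  have "continuous_on ({0..T} \<times> UNIV) (\<lambda>(t, \<theta>). ?I t \<theta>)"
  proof (rule continuous_on_TimesI)
    show "local_lipschitz {0..T} UNIV ?I"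
    proof (rule local_lipschitzI)
      fix t x assume "t \<in> {0..T}" "x \<in> (UNIV :: real set)"
      have "\<bar>?I t x - ?I t y\<bar> \<le> C * exp (C * T) * T * \<bar>x - y\<bar>" if t: "t \<in> {0..T}" for t x y
      proof -
        have "?I t x - ?I t y = integral {0..t} (\<lambda>s. 2 * H' s (\<phi> s x) - 2 * H' s (\<phi> s y))"
          by (rule Henstock_Kurzweil_Integration.integral_diff[symmetric]) (use int t in auto)
        also have "norm \<dots> \<le> (C * (exp (C * T) * \<bar>x - y\<bar>)) * (t - 0)"
        proof (rule integral_bound)
          fix s assume s: "s \<in> {0..t}"
          have "\<bar>2 * H' s (\<phi> s x) - 2 * H' s (\<phi> s y)\<bar> \<le> C * \<bar>\<phi> s x - \<phi> s y\<bar>"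
            using s t by (intro H'_lipschitz[OF vb]) auto
          also have "\<dots> \<le> C * (exp (C * T) * \<bar>x - y\<bar>)"
            using s t C by (intro mult_left_mono flow_separation_T(1)[OF vb]) auto
          finally show "norm (2 * H' s (\<phi> s x) - 2 * H' s (\<phi> s y)) \<le> C * (exp (C * T) * \<bar>x - y\<bar>)" by simp
        qed (use t in \<open>auto intro!: continuous_intros continuous_on_subset[OF strain_continuous_time[OF vb], simplified]\<close>)
        also have "\<dots> \<le> (C * (exp (C * T) * \<bar>x - y\<bar>)) * T"
          using t C by (intro mult_left_mono) auto
        finally show ?thesis by (simp add: mult_ac)
      qed
      then show "\<exists>u>0. \<exists>L. \<forall>t\<in>cball t u \<inter> {0..T}. L-lipschitz_on (cball x u \<inter> UNIV) (?I t)"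
        by (intro exI[of _ 1] conjI exI[of _ "C * exp (C * T) * T"] ballI lipschitz_onI)
          (use C in \<open>auto simp: dist_real_def\<close>)
    qed
    fix \<theta>
    show "continuous_on {0..T} (\<lambda>t. ?I t \<theta>)"
      by (rule indefinite_integral_continuous_1) (use int C in auto)
  qed
  then show ?thesis unfolding jacobian_def by (auto simp: split_beta intro!: continuous_intros)
qed

text \<open>The separation of two trajectories divided by the Jacobian changes only through the
  Taylor remainder of the velocity. That remainder is quadratic in the initial separation, so the
  quotient stays quadratically close to \<open>\<eta> - \<theta>\<close>.\<close>

lemma flow_deriv_space:
  assumes t: "t \<in> {0..T}"
  shows "(\<phi> t has_real_derivative jacobian t \<theta>) (at \<theta>)"
proof (rule has_real_derivative_quadratic_remainder)
  fix \<eta>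
  have C: "0 < C" "0 \<le> T" using vb by (auto simp: velocity_bound_def)
  \<comment> \<open>\<open>C\<close> is the Taylor constant, two exponentials come from the squared
    separation, and the third from dividing by the Jacobian.\<close>
  define B where "B = C * (exp (C * T) * (exp (C * T) * exp (C * T)))"
  have B0: "0 \<le> B" using C by (simp add: B_def)
  define E where "E s = (\<phi> s \<eta> - \<phi> s \<theta>) / jacobian s \<theta>" for s
  define r where "r s = 2 * H s (\<phi> s \<eta>) - 2 * H s (\<phi> s \<theta>) - 2 * H' s (\<phi> s \<theta>) * (\<phi> s \<eta> - \<phi> s \<theta>)" for s
  have taylor: "\<bar>2 * H s y - 2 * H s x - 2 * H' s x * (y - x)\<bar> \<le> C * \<bar>y - x\<bar>\<^sup>2" if s: "s \<in> {0..T}" for s x y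
  proof -
    have "norm ((2 * H s y - 2 * H' s x * y) - (2 * H s x - 2 * H' s x * x)) \<le> (C * \<bar>y - x\<bar>) * norm (y - x)"
    proof (rule field_differentiable_bound[where S = "closed_segment x y" and f' = "\<lambda>z. 2 * H' s z - 2 * H' s x"])
      fix z assume z: "z \<in> closed_segment x y"
      show "((\<lambda>z. 2 * H s z - 2 * H' s x * z) has_real_derivative 2 * H' s z - 2 * H' s x) (at z within closed_segment x y)"
        using s by (auto intro!: derivative_eq_intros has_field_derivative_at_within[OF H_deriv])
      have "\<bar>z - x\<bar> \<le> \<bar>y - x\<bar>" using z by (auto simp: closed_segment_eq_real_ivl split: if_splits)
      then have "C * \<bar>z - x\<bar> \<le> C * \<bar>y - x\<bar>" using C by simp
      then show "norm (2 * H' s z - 2 * H' s x) \<le> C * \<bar>y - x\<bar>"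
        using H'_lipschitz[OF vb s, of z x] by simp
    qed auto
    then show ?thesis by (simp add: power2_eq_square algebra_simps)
  qed
  have dE: "(E has_real_derivative r s / jacobian s \<theta>) (at s within {0..t})" if s: "s \<in> {0..t}" for s
  proof -
    have f: "((\<lambda>s. \<phi> s \<eta> - \<phi> s \<theta>) has_real_derivative 2 * H s (\<phi> s \<eta>) - 2 * H s (\<phi> s \<theta>)) (at s within {0..t})"
      by (rule DERIV_subset[OF DERIV_diff[OF flow_deriv flow_deriv]]) (use s in auto)
    have j: "((\<lambda>s. jacobian s \<theta>) has_real_derivative jacobian s \<theta> * (2 * H' s (\<phi> s \<theta>))) (at s within {0..t})"
      by (rule DERIV_subset[OF jacobian_deriv_time]) (use s t in auto)
    have nz: "jacobian s \<theta> \<noteq> 0" using jacobian_pos[of s \<theta>] by simp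
    show ?thesis unfolding E_def[abs_def]
      by (rule DERIV_cong[OF DERIV_divide[OF f j nz]]) (use nz in \<open>simp add: r_def field_simps\<close>)
  qed
  have bd: "\<bar>r s / jacobian s \<theta>\<bar> \<le> B * \<bar>\<eta> - \<theta>\<bar>\<^sup>2" if s: "s \<in> {0..t}" for s
  proof -
    have sT: "s \<in> {0..T}" using s t by auto
    have J: "exp (- (C * T)) \<le> jacobian s \<theta>" by (rule jacobian_bounds(2)[OF sT])
    have "\<bar>\<phi> s \<eta> - \<phi> s \<theta>\<bar>\<^sup>2 \<le> (exp (C * T) * \<bar>\<eta> - \<theta>\<bar>)\<^sup>2"
      by (rule power_mono[OF flow_separation_T(1)[OF vb sT]]) simp
    then have "\<bar>r s\<bar> \<le> C * (exp (C * T) * \<bar>\<eta> - \<theta>\<bar>)\<^sup>2"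
      using taylor[OF sT, of "\<phi> s \<eta>" "\<phi> s \<theta>"] C unfolding r_def by (meson mult_left_mono less_imp_le order_trans)
    then have "\<bar>r s\<bar> / jacobian s \<theta> \<le> C * (exp (C * T) * \<bar>\<eta> - \<theta>\<bar>)\<^sup>2 / exp (- (C * T))"
      using J C by (intro frac_le) auto
    also have "\<dots> = B * \<bar>\<eta> - \<theta>\<bar>\<^sup>2"
      by (simp add: B_def exp_minus divide_inverse power2_eq_square)
    finally show ?thesis using jacobian_pos[of s \<theta>] by simp
  qed
  have "norm (E t - E 0) \<le> (B * \<bar>\<eta> - \<theta>\<bar>\<^sup>2) * norm (t - 0)"
    by (rule field_differentiable_bound[OF _ dE]) (use bd t in auto)
  also have "\<dots> \<le> (B * \<bar>\<eta> - \<theta>\<bar>\<^sup>2) * T" using t B0 by (intro mult_left_mono) auto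
  finally have "\<bar>E t - (\<eta> - \<theta>)\<bar> \<le> (B * \<bar>\<eta> - \<theta>\<bar>\<^sup>2) * T" by (simp add: E_def flow_0 jacobian_0)
  then have "jacobian t \<theta> * \<bar>E t - (\<eta> - \<theta>)\<bar> \<le> exp (C * T) * ((B * \<bar>\<eta> - \<theta>\<bar>\<^sup>2) * T)"
    using jacobian_bounds(1)[OF t, of \<theta>] jacobian_pos[of t \<theta>] by (intro mult_mono) auto
  moreover have "jacobian t \<theta> * \<bar>E t - (\<eta> - \<theta>)\<bar> = \<bar>\<phi> t \<eta> - \<phi> t \<theta> - jacobian t \<theta> * (\<eta> - \<theta>)\<bar>"
  proof -
    have "jacobian t \<theta> * (E t - (\<eta> - \<theta>)) = \<phi> t \<eta> - \<phi> t \<theta> - jacobian t \<theta> * (\<eta> - \<theta>)"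
      using jacobian_pos[of t \<theta>] by (simp add: E_def field_simps)
    then show ?thesis using jacobian_pos[of t \<theta>] by (metis abs_mult abs_of_pos)
  qed
  ultimately show "\<bar>\<phi> t \<eta> - \<phi> t \<theta> - jacobian t \<theta> * (\<eta> - \<theta>)\<bar> \<le> (exp (C * T) * B * T) * \<bar>\<eta> - \<theta>\<bar>\<^sup>2"
    by (simp add: mult_ac)
qed

end

end

section \<open>Uniqueness and symmetry\<close>

text \<open>The velocity difference of the two flows is at most \<open>R\<close> times the largest
  displacement between them. In the supremum norm weighted by \<open>exp (- 2 * R * s)\<close>,
  integration in time therefore halves any bound on that displacement, on the whole interval at
  once, and iterating forces it to be 0.\<close>

lemma lagrangian_flow_unique:
  assumes A: "lagrangian_solution h0 h H H' \<phi>" and B: "lagrangian_solution h0 g G G' \<psi>" and t: "0 \<le> t"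
  shows "\<phi> t \<theta> = \<psi> t \<theta>"
proof -
  interpret A: lagrangian_solution h0 h H H' \<phi> by (rule A)
  interpret B: lagrangian_solution h0 g G G' \<psi> by (rule B)
  define T where "T = t"
  have T: "0 \<le> T" using t by (simp add: T_def)
  obtain C1 where C1: "A.velocity_bound T C1" by (rule A.velocity_bound_exists[OF T])
  obtain C where C: "B.velocity_bound T C" by (rule B.velocity_bound_exists[OF T])
  obtain K where K: "K-lipschitz_on UNIV h0" using A.lipschitz_initial by blast
  have C0: "0 < C" "0 < C1" using C C1 by (auto simp: A.velocity_bound_def B.velocity_bound_def)
  define L where "L = K * exp (C * T)"
  have g_lip: "L-lipschitz_on UNIV (g s)" if "s \<in> {0..T}" for s
    unfolding L_def by (rule B.h_lipschitz_from_flow[OF C that K B.flow_separation_T(2)[OF C that]]) simp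
  have L0: "0 \<le> L" using g_lip[of 0] T lipschitz_on_nonneg by fastforce
  \<comment> \<open>The first summand is the cost of changing the profile,
    \<open>2 * (5 * pi * L)\<close>; the second is the cost of evaluating one velocity at two
    points.\<close>
  define R where "R = 10 * pi * L + C"
  have "0 \<le> pi * L" using L0 by simp
  then have R0: "0 < R" using C0 unfolding R_def mult.assoc by linarith
  define u where "u s \<theta> = \<phi> s \<theta> - \<psi> s \<theta>" for s \<theta>
  define v where "v s \<theta> = 2 * H s (\<phi> s \<theta>) - 2 * G s (\<psi> s \<theta>)" for s \<theta>
  have du: "((\<lambda>s. u s \<theta>) has_real_derivative v s \<theta>) (at s within {0..})" if "0 \<le> s" for s \<theta>
    unfolding u_def v_def by (intro DERIV_diff A.flow_deriv B.flow_deriv that)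
  have v: "\<bar>v s \<theta>\<bar> \<le> R * D" if s: "s \<in> {0..T}" and D: "\<And>\<theta>. \<bar>u s \<theta>\<bar> \<le> D" for s \<theta> D
  proof -
    have s0: "0 \<le> s" using s by simp
    have "\<bar>h s x - g s x\<bar> \<le> L * D" for x
    proof -
      \<comment> \<open>At the common label both profiles take the value of \<open>h0\<close>, so
        the comparison at \<open>x\<close> reduces to two values of \<open>g\<close>, whose
        Lipschitz constant is known.\<close>
      obtain \<eta> where \<eta>: "\<phi> s \<eta> = x" using A.flow_surj[OF C1 s] by blast
      have "h s x = g s (\<psi> s \<eta>)" using A.transported[OF s0, of \<eta>] B.transported[OF s0, of \<eta>] \<eta> by simp
      then have "\<bar>h s x - g s x\<bar> \<le> L * \<bar>\<psi> s \<eta> - \<phi> s \<eta>\<bar>"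
        using lipschitz_onD[OF g_lip[OF s], of "\<psi> s \<eta>" x] \<eta> by (simp add: dist_real_def)
      also have "\<dots> \<le> L * D" using D[of \<eta>] L0 by (intro mult_left_mono) (auto simp: u_def abs_minus_commute)
      finally show ?thesis .
    qed
    then have "\<bar>H s (\<phi> s \<theta>) - G s (\<phi> s \<theta>)\<bar> \<le> 5 * pi * (L * D)"
      by (rule stream_pair_bound(1)[OF stream_pair_diff[OF A.stream[OF s0] B.stream[OF s0]]])
    moreover have "\<bar>2 * G s (\<phi> s \<theta>) - 2 * G s (\<psi> s \<theta>)\<bar> \<le> C * D"
    proof -
      have "\<bar>2 * G s (\<phi> s \<theta>) - 2 * G s (\<psi> s \<theta>)\<bar> \<le> C * \<bar>\<phi> s \<theta> - \<psi> s \<theta>\<bar>" by (rule B.H_lipschitz[OF C s])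
      also have "\<dots> \<le> C * D" using D[of \<theta>] C0 by (intro mult_left_mono) (auto simp: u_def)
      finally show ?thesis .
    qed
    ultimately show ?thesis unfolding v_def R_def by (simp add: abs_le_iff distrib_right mult.assoc)
  qed
  have halve: "\<bar>u s \<theta>\<bar> \<le> M / 2 * exp (2 * R * s)"
    if M: "\<And>s \<theta>. s \<in> {0..T} \<Longrightarrow> \<bar>u s \<theta>\<bar> \<le> M * exp (2 * R * s)" and s: "s \<in> {0..T}" for M s \<theta>
  proof -
    have M0: "0 \<le> M" using order_trans[OF abs_ge_zero M[of 0 0]] T by simp
    have b: "\<bar>v r \<theta>\<bar> \<le> R * (M * exp (2 * R * r))" if "0 \<le> r" "r \<le> s" for r
      by (rule v) (use M that s in auto)
    have dE: "((\<lambda>s. M / 2 * exp (2 * R * s)) has_real_derivative R * (M * exp (2 * R * r))) (at r within {0..})" for r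
      by (auto intro!: derivative_eq_intros)
    have nn: "0 \<le> R * (M * exp (2 * R * r)) - v r \<theta>" "0 \<le> R * (M * exp (2 * R * r)) + v r \<theta>" if "0 \<le> r" "r \<le> s" for r
      using b[OF that] by linarith+
    have "M / 2 * exp (2 * R * 0) - u 0 \<theta> \<le> M / 2 * exp (2 * R * s) - u s \<theta>"
      by (rule nondecreasing_within_atLeast[where f = "\<lambda>s. M / 2 * exp (2 * R * s) - u s \<theta>", OF DERIV_diff[OF dE du]])
        (use nn s in auto)
    moreover have "M / 2 * exp (2 * R * 0) + u 0 \<theta> \<le> M / 2 * exp (2 * R * s) + u s \<theta>"
      by (rule nondecreasing_within_atLeast[where f = "\<lambda>s. M / 2 * exp (2 * R * s) + u s \<theta>", OF DERIV_add[OF dE du]])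
        (use nn s in auto)
    moreover have "u 0 \<theta> = 0" by (simp add: u_def A.flow_0 B.flow_0)
    ultimately show ?thesis using M0 by (simp add: abs_le_iff)
  qed
  \<comment> \<open>The starting bound: each flow has displaced a point by at most its own speed
    limit times the elapsed time.\<close>
  define M where "M = (C1 + C) * T"
  have iter: "s \<in> {0..T} \<Longrightarrow> \<bar>u s \<theta>\<bar> \<le> M / 2 ^ n * exp (2 * R * s)" for n s \<theta>
  proof (induction n arbitrary: s \<theta>)
    case 0
    have a: "\<bar>\<phi> s \<theta> - \<theta>\<bar> \<le> C1 * s" using A.flow_time_lipschitz[OF C1, of 0 s \<theta>] 0 by (simp add: A.flow_0)
    have b: "\<bar>\<psi> s \<theta> - \<theta>\<bar> \<le> C * s" using B.flow_time_lipschitz[OF C, of 0 s \<theta>] 0 by (simp add: B.flow_0)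
    have "(C1 + C) * s \<le> M" unfolding M_def using 0 C0 by (intro mult_left_mono) auto
    then have "\<bar>u s \<theta>\<bar> \<le> M * 1" using a b unfolding u_def distrib_right by linarith
    also have "\<dots> \<le> M * exp (2 * R * s)"
      using 0 R0 C0 T by (intro mult_left_mono) (auto simp: M_def)
    finally show ?case by simp
  next
    case (Suc n)
    from halve[OF Suc.IH Suc.prems] show ?case by (simp add: divide_divide_eq_left mult.commute)
  qed
  have "(\<lambda>n. M * exp (2 * R * T) * (1 / 2) ^ n) \<longlonglongrightarrow> M * exp (2 * R * T) * 0"
    by (intro tendsto_intros LIMSEQ_power_zero) simp
  then have "\<bar>u T \<theta>\<bar> \<le> 0"
  proof (intro LIMSEQ_le_const[of _ 0] exI allI impI)
    fix n show "\<bar>u T \<theta>\<bar> \<le> M * exp (2 * R * T) * (1 / 2) ^ n"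
    proof -
      have "M * exp (2 * R * T) * (1 / 2) ^ n = M / 2 ^ n * exp (2 * R * T)" unfolding power_one_over by simp
      then show ?thesis using iter[of T \<theta> n] T by simp
    qed
  qed simp
  then show ?thesis by (simp add: u_def T_def)
qed

lemma stream_pair_unique:
  assumes "stream_pair f F F'" "stream_pair f G G'"
  shows "F x = G x" "F' x = G' x"
proof -
  have "\<bar>f x - f x\<bar> \<le> 0" for x by simp
  from stream_pair_bound[OF stream_pair_diff[OF assms] this, of x] show "F x = G x" "F' x = G' x" by simp_all
qed

text \<open>Integrating the rotated pair over \<open>[0, \<pi>/4]\<close> gives Green's formula for \<open>F'' + 4 F = f\<close> with
  Dirichlet conditions.\<close>

lemma stream_pair_dirichlet:
  assumes sp: "stream_pair f F F'" and cont: "continuous_on UNIV f"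
    and nonneg: "\<And>x. x \<in> {0..pi/4} \<Longrightarrow> 0 \<le> f x" and F0: "F 0 = 0" "F (pi / 4) = 0"
  shows "F' (pi / 4) = integral {0..pi/4} (\<lambda>x. f x * sin (2 * x))"
    and "F' 0 = - integral {0..pi/4} (\<lambda>x. f x * cos (2 * x))"
    and "x \<in> {0..pi/4} \<Longrightarrow> F x \<le> 0"
    and "x \<in> {0..pi/4} \<Longrightarrow> F' 0 \<le> F' x"
    and "((\<lambda>x. 2 * F' x * f x) has_integral (F' (pi / 4))\<^sup>2 - (F' 0)\<^sup>2) {0..pi/4}"
proof -
  note D = stream_pair_D[OF sp]
  obtain A B where defs: "\<And>x. A x = F x * cos (2 * x) - F' x / 2 * sin (2 * x)"
      "\<And>x. B x = F x * sin (2 * x) + F' x / 2 * cos (2 * x)"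
    and AB: "\<And>x. (A has_real_derivative - (f x * sin (2 * x)) / 2) (at x)"
      "\<And>x. (B has_real_derivative f x * cos (2 * x) / 2) (at x)"
      "\<And>x. F x = A x * cos (2 * x) + B x * sin (2 * x)"
      "\<And>x. F' x = 2 * (B x * cos (2 * x) - A x * sin (2 * x))"
    by (rule stream_pair_rotate[OF sp]) (rule that, assumption+)
  have ends: "A 0 = 0" "B (pi / 4) = 0" "F' 0 = 2 * B 0" "F' (pi / 4) = - 2 * A (pi / 4)"
    using F0 by (simp_all add: defs)
  have le: "(0::real) \<le> pi / 4" by simp
  have trig: "0 \<le> sin (2 * x)" "0 \<le> cos (2 * x)" "cos (2 * x) \<le> 1" if "x \<in> {0..pi/4}" for x
    using that by (auto intro!: sin_ge_zero cos_ge_zero)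
  have "((\<lambda>x. - (f x * sin (2 * x)) / 2) has_integral A (pi / 4) - A 0) {0..pi/4}"
    by (rule fundamental_theorem_of_calculus[OF le])
      (use AB(1) has_field_derivative_at_within in \<open>blast intro: has_real_derivative_iff_has_vector_derivative[THEN iffD1]\<close>)
  from has_integral_mult_right[OF this, of "-2"]
  have "((\<lambda>x. f x * sin (2 * x)) has_integral F' (pi / 4)) {0..pi/4}" by (simp add: ends)
  then show "F' (pi / 4) = integral {0..pi/4} (\<lambda>x. f x * sin (2 * x))" by (simp add: integral_unique)
  have "((\<lambda>x. f x * cos (2 * x) / 2) has_integral B (pi / 4) - B 0) {0..pi/4}"
    by (rule fundamental_theorem_of_calculus[OF le])
      (use AB(2) has_field_derivative_at_within in \<open>blast intro: has_real_derivative_iff_has_vector_derivative[THEN iffD1]\<close>)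
  from has_integral_mult_right[OF this, of "2"]
  have "((\<lambda>x. f x * cos (2 * x)) has_integral - F' 0) {0..pi/4}" by (simp add: ends)
  then show "F' 0 = - integral {0..pi/4} (\<lambda>x. f x * cos (2 * x))" by (simp add: integral_unique)
  \<comment> \<open>\<open>A\<close> vanishes at 0 and decreases, while \<open>B\<close> vanishes at
    \<open>pi / 4\<close> and increases; both are thus nonpositive on the quarter, which drives the
    sign of \<open>F\<close> and the minimum of \<open>F'\<close>.\<close>
  have A_le: "A x \<le> 0" if x: "x \<in> {0..pi/4}" for x
  proof -
    have "- A 0 \<le> - A x"
    proof (rule DERIV_nonneg_imp_nondecreasing[where f = "\<lambda>x. - A x"])
      fix z assume z: "0 \<le> z" "z \<le> x"
      have "0 \<le> f z * sin (2 * z) / 2" using nonneg[of z] trig(1)[of z] z x by auto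
      moreover have "((\<lambda>x. - A x) has_real_derivative f z * sin (2 * z) / 2) (at z)"
        using DERIV_minus[OF AB(1)[of z]] by simp
      ultimately show "\<exists>y. ((\<lambda>x. - A x) has_real_derivative y) (at z) \<and> 0 \<le> y" by blast
    qed (use x in auto)
    then show ?thesis by (simp add: ends)
  qed
  have B_mono: "B x \<le> B y" if xy: "0 \<le> x" "x \<le> y" "y \<le> pi / 4" for x y
  proof (rule DERIV_nonneg_imp_nondecreasing[OF xy(2)])
    fix z assume z: "x \<le> z" "z \<le> y"
    have "0 \<le> f z * cos (2 * z) / 2" using nonneg[of z] trig(2)[of z] z xy by auto
    then show "\<exists>d. (B has_real_derivative d) (at z) \<and> 0 \<le> d" using AB(2) by blast
  qed
  show "F x \<le> 0" if x: "x \<in> {0..pi/4}"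
  proof -
    have "A x * cos (2 * x) \<le> 0" "B x * sin (2 * x) \<le> 0"
      using A_le[OF x] B_mono[of x "pi/4"] trig[OF x] x ends(2) by (auto intro!: mult_nonpos_nonneg)
    then show ?thesis using AB(3)[of x] by linarith
  qed
  \<comment> \<open>In F'/2 = B cos 2x - A sin 2x, dropping the second term and replacing the cosine
    by 1 can only lower the value, since \<open>A\<close> and \<open>B\<close> are
    nonpositive.\<close>
  show "F' 0 \<le> F' x" if x: "x \<in> {0..pi/4}"
  proof -
    have "A x * sin (2 * x) \<le> 0" using A_le[OF x] trig[OF x] by (intro mult_nonpos_nonneg)
    moreover have "B x * 1 \<le> B x * cos (2 * x)"
      using B_mono[of x "pi/4"] trig(3)[OF x] x ends(2) by (intro mult_left_mono_neg) auto
    moreover have "B 0 \<le> B x" using B_mono[of 0 x] x by auto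
    ultimately have "B 0 \<le> B x * cos (2 * x) - A x * sin (2 * x)" by linarith
    then show ?thesis by (simp add: AB(4)[of x] ends(3))
  qed
  \<comment> \<open>The primitive is the energy of the oscillator F'' + 4 F = f, which changes only
    through the work of \<open>f\<close>.\<close>
  have "((\<lambda>x. 2 * F' x * f x) has_integral (4 * (F (pi / 4))\<^sup>2 + (F' (pi / 4))\<^sup>2) - (4 * (F 0)\<^sup>2 + (F' 0)\<^sup>2)) {0..pi/4}"
  proof (rule fundamental_theorem_of_calculus[OF le])
    fix x
    have "((\<lambda>x. 4 * (F x)\<^sup>2 + (F' x)\<^sup>2) has_real_derivative 2 * F' x * f x) (at x)"
      by (rule derivative_eq_intros D refl | simp add: algebra_simps)+
    then show "((\<lambda>x. 4 * (F x)\<^sup>2 + (F' x)\<^sup>2) has_vector_derivative 2 * F' x * f x) (at x within {0..pi/4})"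
      using has_field_derivative_at_within has_real_derivative_iff_has_vector_derivative by blast
  qed
  then show "((\<lambda>x. 2 * F' x * f x) has_integral (F' (pi / 4))\<^sup>2 - (F' 0)\<^sup>2) {0..pi/4}"
    by (simp add: F0)
qed

section \<open>Consequences of oddness and of the fourfold symmetry\<close>

locale symmetric_solution = lagrangian_solution +
  assumes odd_initial: "h0 (- \<theta>) = - h0 \<theta>"
    and fourfold_initial: "h0 (\<theta> + pi / 2) = h0 \<theta>"
begin

text \<open>The reflected solution has the same initial profile, because \<open>h0\<close> is odd;
  uniqueness then identifies its flow with the original one. The fourfold symmetry is obtained in
  the same way from the rotated solution.\<close>

lemma flow_odd: assumes t: "0 \<le> t" shows "\<phi> t (- \<theta>) = - \<phi> t \<theta>"
proof -
  have "lagrangian_solution h0 (\<lambda>t x. - h t (- x)) (\<lambda>t x. - H t (- x)) (\<lambda>t x. H' t (- x)) (\<lambda>t \<theta>. - \<phi> t (- \<theta>))"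
  proof
    show "periodic (\<lambda>x. - h t (- x))" if "0 \<le> t" for t
      unfolding periodic_def
    proof
      fix x
      show "- h t (- (x + 2 * pi)) = - h t (- x)"
        using periodic_h[OF that, unfolded periodic_def, rule_format, of "- x - 2 * pi"] by simp
    qed
    have "continuous_on ({0..} \<times> UNIV) (\<lambda>z. (\<lambda>(t, \<theta>). h t \<theta>) (fst z, - snd z))"
      by (rule continuous_on_compose2[OF continuous_h]) (auto intro!: continuous_intros)
    then show "continuous_on ({0..} \<times> UNIV) (\<lambda>(t, x). - h t (- x))"
      by (auto simp: split_beta intro!: continuous_intros)
    show "((\<lambda>s. - \<phi> s (- \<theta>)) has_real_derivative 2 * - H t (- (- \<phi> t (- \<theta>)))) (at t within {0..})" if "0 \<le> t" for t \<theta>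
      using DERIV_minus[OF flow_deriv[OF that, of "-\<theta>"]] by simp
    show "- h t (- (- \<phi> t (- \<theta>))) = h0 \<theta>" if "0 \<le> t" for t \<theta>
      using transported[OF that, of "-\<theta>"] odd_initial[of \<theta>] by simp
  qed (use lipschitz_initial flow_0 stream_pair_reflect[OF stream] in auto)
  from lagrangian_flow_unique[OF lagrangian_solution_axioms this t, of \<theta>] show ?thesis by simp
qed

lemma flow_fourfold: assumes t: "0 \<le> t" shows "\<phi> t (\<theta> + pi / 2) = \<phi> t \<theta> + pi / 2"
proof -
  have "lagrangian_solution h0 (\<lambda>t x. h t (x + pi / 2)) (\<lambda>t x. H t (x + pi / 2)) (\<lambda>t x. H' t (x + pi / 2)) (\<lambda>t \<theta>. \<phi> t (\<theta> + pi / 2) - pi / 2)"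
  proof
    show "periodic (\<lambda>x. h t (x + pi / 2))" if "0 \<le> t" for t
      unfolding periodic_def
    proof
      fix x
      show "h t (x + 2 * pi + pi / 2) = h t (x + pi / 2)"
        using periodic_h[OF that, unfolded periodic_def, rule_format, of "x + pi / 2"] by (simp only: add_ac)
    qed
    have "continuous_on ({0..} \<times> UNIV) (\<lambda>z. (\<lambda>(t, \<theta>). h t \<theta>) (fst z, snd z + pi / 2))"
      by (rule continuous_on_compose2[OF continuous_h]) (auto intro!: continuous_intros)
    then show "continuous_on ({0..} \<times> UNIV) (\<lambda>(t, x). h t (x + pi / 2))"
      by (simp add: split_beta)
    show "((\<lambda>s. \<phi> s (\<theta> + pi / 2) - pi / 2) has_real_derivative 2 * H t (\<phi> t (\<theta> + pi / 2) - pi / 2 + pi / 2)) (at t within {0..})" if "0 \<le> t" for t \<theta>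
      using DERIV_diff[OF flow_deriv[OF that, of "\<theta> + pi / 2"] DERIV_const[of "pi / 2"]] by simp
    show "h t (\<phi> t (\<theta> + pi / 2) - pi / 2 + pi / 2) = h0 \<theta>" if "0 \<le> t" for t \<theta>
      using transported[OF that, of "\<theta> + pi / 2"] fourfold_initial[of \<theta>] by simp
  qed (use lipschitz_initial flow_0 stream_pair_shift[OF stream] in auto)
  from lagrangian_flow_unique[OF lagrangian_solution_axioms this t, of \<theta>] show ?thesis by simp
qed

lemma flow_ex: "0 \<le> t \<Longrightarrow> \<exists>\<theta>. \<phi> t \<theta> = y"
  using velocity_bound_exists flow_surj by (metis atLeastAtMost_iff order_refl)

lemma h_odd: "0 \<le> t \<Longrightarrow> h t (- x) = - h t x"
  using flow_ex[of t x] flow_odd[of t] transported[of t] odd_initial by metis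

lemma h_fourfold: "0 \<le> t \<Longrightarrow> h t (x + pi / 2) = h t x"
  using flow_ex[of t x] flow_fourfold[of t] transported[of t] fourfold_initial by metis

lemma stream_odd:
  assumes t: "0 \<le> t" shows "H t (- x) = - H t x" "H' t (- x) = H' t x"
proof -
  have "(\<lambda>x. - h t (- x)) = h t" using h_odd[OF t] by auto
  then have "stream_pair (h t) (\<lambda>x. - H t (- x)) (\<lambda>x. H' t (- x))"
    using stream_pair_reflect[OF stream[OF t]] by simp
  from stream_pair_unique[OF this stream[OF t], of x] show "H t (- x) = - H t x" "H' t (- x) = H' t x" by auto
qed

lemma stream_fourfold:
  assumes t: "0 \<le> t" shows "H t (x + pi / 2) = H t x" "H' t (x + pi / 2) = H' t x"
proof -
  have "(\<lambda>x. h t (x + pi / 2)) = h t" using h_fourfold[OF t] by auto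
  then have "stream_pair (h t) (\<lambda>x. H t (x + pi / 2)) (\<lambda>x. H' t (x + pi / 2))"
    using stream_pair_shift[OF stream[OF t]] by simp
  from stream_pair_unique[OF this stream[OF t], of x] show "H t (x + pi / 2) = H t x" "H' t (x + pi / 2) = H' t x" by auto
qed

text \<open>The point \<open>pi / 4\<close> is fixed by a reflection followed by a quarter turn, and
  the flow commutes with both.\<close>

lemma flow_fixed: assumes t: "0 \<le> t" shows "\<phi> t 0 = 0" "\<phi> t (pi / 4) = pi / 4"
  using flow_odd[OF t, of 0] flow_odd[OF t, of "pi / 4"] flow_fourfold[OF t, of "- (pi / 4)"] by simp_all

lemma stream_ends: assumes t: "0 \<le> t" shows "H t 0 = 0" "H t (pi / 4) = 0"
  using stream_odd(1)[OF t, of 0] stream_odd(1)[OF t, of "pi / 4"] stream_fourfold(1)[OF t, of "- (pi / 4)"] by simp_all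

lemma flow_strict_mono:
  assumes t: "0 \<le> t" and "x < y" shows "\<phi> t x < \<phi> t y"
proof -
  obtain C where C: "velocity_bound t C" by (rule velocity_bound_exists[OF t])
  show ?thesis
    by (rule DERIV_pos_imp_increasing[OF \<open>x < y\<close>])
      (use flow_deriv_space[OF C, of t] jacobian_pos t in auto)
qed

lemma flow_mono: "0 \<le> t \<Longrightarrow> x \<le> y \<Longrightarrow> \<phi> t x \<le> \<phi> t y"
  using flow_strict_mono[of t x y] by (cases "x = y") auto

lemma flow_preimage:
  assumes t: "0 \<le> t" and y: "y \<in> {0..pi/4}"
  obtains \<theta> where "\<theta> \<in> {0..pi/4}" "\<phi> t \<theta> = y"
proof -
  obtain \<theta> where \<theta>: "\<phi> t \<theta> = y" using flow_ex[OF t] by blast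
  have "\<not> \<theta> < 0" using flow_strict_mono[OF t, of \<theta> 0] flow_fixed[OF t] \<theta> y by auto
  moreover have "\<not> pi / 4 < \<theta>" using flow_strict_mono[OF t, of "pi / 4" \<theta>] flow_fixed[OF t] \<theta> y by auto
  ultimately show ?thesis using that[of \<theta>] \<theta> by auto
qed

lemma flow_maps: "0 \<le> t \<Longrightarrow> \<theta> \<in> {0..pi/4} \<Longrightarrow> \<phi> t \<theta> \<in> {0..pi/4}"
  using flow_mono[of t 0 \<theta>] flow_mono[of t \<theta> "pi / 4"] flow_fixed[of t] by auto

lemma h_continuous: "0 \<le> t \<Longrightarrow> continuous_on UNIV (h t)"
proof -
  assume t: "0 \<le> t"
  have "continuous_on UNIV (\<lambda>x. (\<lambda>(t, \<theta>). h t \<theta>) (t, x))"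
    by (rule continuous_on_compose2[OF continuous_h]) (use t in \<open>auto intro!: continuous_intros\<close>)
  then show ?thesis by simp
qed

end

section \<open>Evolution of the mass and of the gradient\<close>

lemma quarter_reduce:
  obtains n :: int where "x + pi / 2 * of_int n \<in> {-(pi/4)..pi/4}"
proof (rule shift_into_interval[of "pi / 2" x])
  fix n :: int assume "x + pi / 2 * of_int n \<in> {-(pi / 2 / 2)..<pi / 2 / 2}"
  then show ?thesis by (intro that[of n]) simp
qed simp

lemma cos_ge_parabola: "1 - x\<^sup>2 / 2 \<le> cos (x :: real)"
proof -
  have "\<bar>sin (x / 2)\<bar> \<le> \<bar>x / 2\<bar>" by (rule abs_sin_x_le_abs_x)
  then have "(sin (x / 2))\<^sup>2 \<le> (x / 2)\<^sup>2" by (simp only: abs_le_square_iff)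
  then show ?thesis using cos_double_sin[of "x / 2"] by (simp add: power_divide)
qed

locale localized_solution = symmetric_solution +
  fixes \<epsilon> :: real
  assumes nontrivial: "\<exists>\<theta>. h0 \<theta> \<noteq> 0"
    and nonneg_initial: "\<theta> \<in> {0..pi/4} \<Longrightarrow> 0 \<le> h0 \<theta>"
    and eps: "0 < \<epsilon>" "\<epsilon> \<le> 1 / 4"
    and support_initial: "\<theta> \<in> {0..pi/4} \<Longrightarrow> h0 \<theta> \<noteq> 0 \<Longrightarrow> \<theta> \<le> \<epsilon>"
begin

definition mass :: "real \<Rightarrow> real" where "mass t = integral {0..pi/4} (h t)"

lemma h_integrable: "0 \<le> t \<Longrightarrow> h t integrable_on {a..b}"
  by (rule integrable_continuous_real) (rule continuous_on_subset[OF h_continuous], simp_all)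

lemma h_nonneg:
  assumes t: "0 \<le> t" and y: "y \<in> {0..pi/4}" shows "0 \<le> h t y"
proof -
  obtain \<theta> where "\<theta> \<in> {0..pi/4}" "\<phi> t \<theta> = y" by (rule flow_preimage[OF t y])
  then show ?thesis using transported[OF t, of \<theta>] nonneg_initial by auto
qed

lemma stream_quarter:
  assumes t: "0 \<le> t"
  shows "H' t (pi / 4) = integral {0..pi/4} (\<lambda>x. h t x * sin (2 * x))"
    and "H' t 0 = - integral {0..pi/4} (\<lambda>x. h t x * cos (2 * x))"
    and "x \<in> {0..pi/4} \<Longrightarrow> H t x \<le> 0"
    and "x \<in> {0..pi/4} \<Longrightarrow> H' t 0 \<le> H' t x"
    and "((\<lambda>x. 2 * H' t x * h t x) has_integral (H' t (pi / 4))\<^sup>2 - (H' t 0)\<^sup>2) {0..pi/4}"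
proof -
  note X = stream_pair_dirichlet[OF stream[OF t] h_continuous[OF t] h_nonneg[OF t] stream_ends[OF t]]
  show "H' t (pi / 4) = integral {0..pi/4} (\<lambda>x. h t x * sin (2 * x))" by (rule X(1))
  show "H' t 0 = - integral {0..pi/4} (\<lambda>x. h t x * cos (2 * x))" by (rule X(2))
  show "x \<in> {0..pi/4} \<Longrightarrow> H t x \<le> 0" by (rule X(3))
  show "x \<in> {0..pi/4} \<Longrightarrow> H' t 0 \<le> H' t x" by (rule X(4))
  show "((\<lambda>x. 2 * H' t x * h t x) has_integral (H' t (pi / 4))\<^sup>2 - (H' t 0)\<^sup>2) {0..pi/4}" by (rule X(5))
qed

lemma flow_le:
  assumes t: "0 \<le> t" and \<theta>: "\<theta> \<in> {0..pi/4}" shows "\<phi> t \<theta> \<le> \<theta>"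
proof -
  have "- \<phi> 0 \<theta> \<le> - \<phi> t \<theta>"
  proof (rule nondecreasing_within_atLeast[where f = "\<lambda>s. - \<phi> s \<theta>", OF DERIV_minus[OF flow_deriv]])
    show "0 \<le> - (2 * H s (\<phi> s \<theta>))" if "0 \<le> s" for s
      using stream_quarter(3)[OF that, of "\<phi> s \<theta>"] flow_maps[OF that \<theta>] by simp
  qed (use t in auto)
  then show ?thesis by (simp add: flow_0)
qed

lemma h_support:
  assumes t: "0 \<le> t" and y: "y \<in> {0..pi/4}" "h t y \<noteq> 0" shows "y \<le> \<epsilon>"
proof -
  obtain \<theta> where \<theta>: "\<theta> \<in> {0..pi/4}" "\<phi> t \<theta> = y" by (rule flow_preimage[OF t y(1)])
  then have "\<theta> \<le> \<epsilon>" using transported[OF t, of \<theta>] support_initial y by auto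
  then show ?thesis using flow_le[OF t \<theta>(1)] \<theta>(2) by simp
qed

text \<open>A point where \<open>h0\<close> is nonzero can be moved into the quarter by the
  symmetries. The flow carries its value along, so the nonnegative continuous profile is never
  identically zero there.\<close>

lemma mass_pos: assumes t: "0 \<le> t" shows "0 < mass t"
proof -
  obtain \<theta> where \<theta>: "h0 \<theta> \<noteq> 0" using nontrivial by blast
  obtain n :: int where n: "\<theta> + pi / 2 * of_int n \<in> {-(pi/4)..pi/4}" by (rule quarter_reduce)
  define \<eta> where "\<eta> = \<theta> + pi / 2 * of_int n"
  have "\<bar>\<eta>\<bar> \<le> pi / 4" using n unfolding \<eta>_def[symmetric] by (intro abs_leI) auto
  have "h0 \<eta> \<noteq> 0" using \<theta> shift_invariant_int[of h0, OF fourfold_initial] by (simp add: \<eta>_def)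
  moreover have "h0 \<bar>\<eta>\<bar> = h0 \<eta> \<or> h0 \<bar>\<eta>\<bar> = - h0 \<eta>" using odd_initial[of \<eta>] by (simp add: abs_if)
  ultimately have \<eta>: "h0 \<bar>\<eta>\<bar> \<noteq> 0" "\<bar>\<eta>\<bar> \<in> {0..pi/4}" using \<open>\<bar>\<eta>\<bar> \<le> pi / 4\<close> by auto
  have "mass t \<noteq> 0"
  proof
    assume "mass t = 0"
    then have "\<forall>x\<in>{0..pi/4}. h t x = 0"
      unfolding mass_def
      by (subst (asm) integral_eq_0_iff)
        (use h_nonneg[OF t] continuous_on_subset[OF h_continuous[OF t]] in auto)
    then have "h t (\<phi> t \<bar>\<eta>\<bar>) = 0" using flow_maps[OF t \<eta>(2)] by blast
    then show False using transported[OF t] \<eta>(1) by simp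
  qed
  moreover have "0 \<le> mass t" unfolding mass_def by (rule integral_nonneg[OF h_integrable[OF t]]) (use h_nonneg[OF t] in auto)
  ultimately show ?thesis by simp
qed

lemma L1_norm_eq_mass:
  assumes t: "0 \<le> t" shows "L1_norm (h t) = mass t"
proof -
  have c: "continuous_on {0..pi/4} (\<lambda>x. \<bar>h t x\<bar>)"
    by (intro continuous_intros continuous_on_subset[OF h_continuous[OF t]]) simp
  have "L1_norm (h t) = integral {0..pi/4} (\<lambda>x. \<bar>h t x\<bar>)"
    unfolding L1_norm_def using set_borel_integral_eq_integral(2)[OF borel_integrable_atLeastAtMost'[OF c]] .
  also have "\<dots> = mass t"
    unfolding mass_def by (rule integral_cong) (use h_nonneg[OF t] in auto)
  finally show ?thesis .
qed

text \<open>These two are the C and S of the overview, recorded as boundary values of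
  \<open>H'\<close>; \<open>stream_quarter\<close> supplies their integral form.\<close>

definition inner_strain :: "real \<Rightarrow> real" where "inner_strain t = - H' t 0"
definition outer_strain :: "real \<Rightarrow> real" where "outer_strain t = H' t (pi / 4)"

text \<open>Only points x \<le> \<epsilon> contribute to the moments, and there cos 2x \<ge> 1 - 2
  \<epsilon>^2 and sin 2x \<le> 2 \<epsilon>.\<close>

lemma strain_bounds:
  assumes t: "0 \<le> t"
  shows "inner_strain t \<le> mass t" "(1 - 2 * \<epsilon>\<^sup>2) * mass t \<le> inner_strain t"
    "0 \<le> outer_strain t" "outer_strain t \<le> 2 * \<epsilon> * mass t"
proof -
  have C: "inner_strain t = integral {0..pi/4} (\<lambda>x. h t x * cos (2 * x))"
    and S: "outer_strain t = integral {0..pi/4} (\<lambda>x. h t x * sin (2 * x))"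
    using stream_quarter(2)[OF t] stream_quarter(1)[OF t]
    by (auto simp: inner_strain_def outer_strain_def)
  have ci: "(\<lambda>x. h t x * k (2 * x)) integrable_on {0..pi/4}" if "continuous_on UNIV k" for k
    by (intro integrable_continuous_real continuous_intros continuous_on_subset[OF h_continuous[OF t]]
        continuous_on_compose2[OF that]) auto
  have ic: "(\<lambda>x. h t x * cos (2 * x)) integrable_on {0..pi/4}" and isin: "(\<lambda>x. h t x * sin (2 * x)) integrable_on {0..pi/4}"
    by (rule ci, intro continuous_intros)+
  have hi: "((\<lambda>x. h t x * c) has_integral mass t * c) {0..pi/4}" for c
    unfolding mass_def by (rule has_integral_mult_left[OF integrable_integral[OF h_integrable[OF t]]])
  have im: "(\<lambda>x. h t x * c) integrable_on {0..pi/4}" "integral {0..pi/4} (\<lambda>x. h t x * c) = c * mass t" for c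
    using has_integral_integrable[OF hi] integral_unique[OF hi, of c] by (simp_all only: mult.commute)
  have trig: "0 \<le> sin (2 * x)" if "x \<in> {0..pi/4}" for x using that by (auto intro!: sin_ge_zero)
  have "inner_strain t \<le> integral {0..pi/4} (h t)" unfolding C
    by (rule integral_le[OF ic h_integrable[OF t]]) (use h_nonneg[OF t] in \<open>auto intro: mult_left_le\<close>)
  then show "inner_strain t \<le> mass t" by (simp add: mass_def)
  show "0 \<le> outer_strain t" unfolding S
    by (rule integral_nonneg[OF isin]) (use h_nonneg[OF t] trig in auto)
  have "integral {0..pi/4} (\<lambda>x. h t x * (1 - 2 * \<epsilon>\<^sup>2)) \<le> inner_strain t" unfolding C
  proof (rule integral_le[OF im(1) ic])
    fix x assume x: "x \<in> {0..pi/4}"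
    show "h t x * (1 - 2 * \<epsilon>\<^sup>2) \<le> h t x * cos (2 * x)"
    proof (cases "h t x = 0")
      case False
      then have "x \<le> \<epsilon>" using h_support[OF t x] by simp
      then have "x\<^sup>2 \<le> \<epsilon>\<^sup>2" using x by (intro power_mono) auto
      then have "1 - 2 * \<epsilon>\<^sup>2 \<le> cos (2 * x)" using cos_ge_parabola[of "2 * x"] by (simp add: power_mult_distrib)
      then show ?thesis using h_nonneg[OF t x] by (rule mult_left_mono)
    qed simp
  qed
  then show "(1 - 2 * \<epsilon>\<^sup>2) * mass t \<le> inner_strain t" by (simp only: im)
  have "outer_strain t \<le> integral {0..pi/4} (\<lambda>x. h t x * (2 * \<epsilon>))" unfolding S
  proof (rule integral_le[OF isin im(1)])
    fix x assume x: "x \<in> {0..pi/4}"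
    show "h t x * sin (2 * x) \<le> h t x * (2 * \<epsilon>)"
    proof (cases "h t x = 0")
      case False
      then have "x \<le> \<epsilon>" using h_support[OF t x] by simp
      then have "sin (2 * x) \<le> 2 * \<epsilon>" using sin_x_le_x[of "2 * x"] x by simp
      then show ?thesis using h_nonneg[OF t x] by (rule mult_left_mono)
    qed simp
  qed
  then show "outer_strain t \<le> 2 * \<epsilon> * mass t" by (simp only: im)
qed

lemma eps_sq: "\<epsilon>\<^sup>2 \<le> 1 / 16"
  using power_mono[OF eps(2), of 2] eps(1) by (simp add: power_divide)

lemma strain_sq_bounds:
  assumes t: "0 \<le> t"
  shows "(inner_strain t)\<^sup>2 - (outer_strain t)\<^sup>2 \<le> (mass t)\<^sup>2"
    "(1 - 8 * \<epsilon>\<^sup>2) * (mass t)\<^sup>2 \<le> (inner_strain t)\<^sup>2 - (outer_strain t)\<^sup>2"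
proof -
  note b = strain_bounds[OF t]
  have m: "0 \<le> mass t" using mass_pos[OF t] by simp
  have e: "0 \<le> 1 - 2 * \<epsilon>\<^sup>2" using eps_sq by linarith
  have i0: "0 \<le> inner_strain t" using mult_nonneg_nonneg[OF e m] b(2) by linarith
  have "(inner_strain t)\<^sup>2 \<le> (mass t)\<^sup>2" using b(1) i0 by (rule power_mono)
  then show "(inner_strain t)\<^sup>2 - (outer_strain t)\<^sup>2 \<le> (mass t)\<^sup>2"
    using zero_le_power2[of "outer_strain t"] by linarith
  have "((1 - 2 * \<epsilon>\<^sup>2) * mass t)\<^sup>2 \<le> (inner_strain t)\<^sup>2" by (rule power_mono[OF b(2)]) (use e m in simp)
  moreover have "(outer_strain t)\<^sup>2 \<le> (2 * \<epsilon> * mass t)\<^sup>2" by (rule power_mono[OF b(4,3)])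
  \<comment> \<open>The constant 8 appears here: 4 from expanding the square and 4 from the outer
    strain. The quartic remainder has a favourable sign.\<close>
  moreover have "((1 - 2 * \<epsilon>\<^sup>2) * mass t)\<^sup>2 - (2 * \<epsilon> * mass t)\<^sup>2 = (1 - 8 * \<epsilon>\<^sup>2) * (mass t)\<^sup>2 + 4 * (\<epsilon>\<^sup>2 * mass t)\<^sup>2"
    by (simp add: power2_eq_square algebra_simps)
  moreover have "0 \<le> 4 * (\<epsilon>\<^sup>2 * mass t)\<^sup>2" by simp
  ultimately show "(1 - 8 * \<epsilon>\<^sup>2) * (mass t)\<^sup>2 \<le> (inner_strain t)\<^sup>2 - (outer_strain t)\<^sup>2" by linarith
qed

lemma integral_flow:
  assumes t: "0 \<le> t" and g: "continuous_on UNIV g"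
  shows "((\<lambda>\<theta>. jacobian t \<theta> * g (\<phi> t \<theta>)) has_integral integral {0..pi/4} g) {0..pi/4}"
proof -
  obtain C where C: "velocity_bound t C" by (rule velocity_bound_exists[OF t])
  have "((\<lambda>\<theta>. jacobian t \<theta> *\<^sub>R g (\<phi> t \<theta>)) has_integral integral {\<phi> t 0..\<phi> t (pi / 4)} g) {0..pi/4}"
  proof (rule has_integral_substitution[where c = 0 and d = "pi / 4"])
    show "\<phi> t ` {0..pi/4} \<subseteq> {0..pi/4}" using flow_maps[OF t] by blast
    show "(\<phi> t has_real_derivative jacobian t x) (at x within {0..pi/4})" for x
      by (rule has_field_derivative_at_within[OF flow_deriv_space[OF C]]) (use t in auto)
  qed (use continuous_on_subset[OF g] in \<open>auto simp: flow_fixed[OF t]\<close>)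
  then show ?thesis by (simp add: flow_fixed[OF t])
qed

text \<open>In Lagrangian coordinates the mass is \<open>\<integral> h0 * jacobian\<close>, so only the Jacobian depends on time.\<close>

lemma mass_deriv:
  assumes t: "0 \<le> t"
  shows "(mass has_real_derivative (outer_strain t)\<^sup>2 - (inner_strain t)\<^sup>2) (at t within {0..})"
proof -
  \<comment> \<open>The extra unit makes \<open>{0..T}\<close> a neighbourhood of \<open>t\<close>
    within the half-line, so the two derivatives agree.\<close>
  define T where "T = t + 1"
  have T: "0 \<le> T" "t \<in> {0..T}" "t < T" using t by (auto simp: T_def)
  obtain C where C: "velocity_bound T C" by (rule velocity_bound_exists[OF T(1)])
  have c0: "continuous_on UNIV h0" using lipschitz_initial lipschitz_on_continuous_on by blast
  let ?f = "\<lambda>s \<theta>. h0 \<theta> * jacobian s \<theta>"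
  let ?f' = "\<lambda>s \<theta>. h0 \<theta> * (jacobian s \<theta> * (2 * H' s (\<phi> s \<theta>)))"
  have mass_eq: "mass s = integral (cbox 0 (pi / 4)) (?f s)" if "0 \<le> s" for s
  proof -
    have "((\<lambda>\<theta>. jacobian s \<theta> * h s (\<phi> s \<theta>)) has_integral mass s) {0..pi/4}"
      unfolding mass_def by (rule integral_flow[OF that h_continuous[OF that]])
    then show ?thesis by (simp add: transported[OF that] mult.commute integral_unique)
  qed
  have cJ: "continuous_on ({0..T} \<times> cbox 0 (pi / 4)) (\<lambda>(t, \<theta>). jacobian t \<theta>)"
    by (rule continuous_on_subset[OF jacobian_continuous[OF C]]) auto
  have cs: "continuous_on ({0..T} \<times> cbox 0 (pi / 4)) (\<lambda>(t, \<theta>). 2 * H' t (\<phi> t \<theta>))"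
    by (rule continuous_on_subset[OF strain_continuous[OF C]]) auto
  have ch: "continuous_on ({0..T} \<times> cbox 0 (pi / 4)) (\<lambda>(t, \<theta>). h0 \<theta>)"
    unfolding split_beta by (rule continuous_on_compose2[OF c0]) (auto intro!: continuous_intros)
  have "((\<lambda>s. integral (cbox 0 (pi / 4)) (?f s)) has_real_derivative integral (cbox 0 (pi / 4)) (?f' t)) (at t within {0..T})"
  proof (rule leibniz_rule_field_derivative)
    show "((\<lambda>s. ?f s \<theta>) has_real_derivative ?f' s \<theta>) (at s within {0..T})" if "s \<in> {0..T}" for s \<theta>
      by (rule DERIV_cmult[OF jacobian_deriv_time[OF C that]])
    show "?f s integrable_on cbox 0 (pi / 4)" if "s \<in> {0..T}" for s
    proof -
      have "((\<lambda>\<theta>. jacobian s \<theta> * h s (\<phi> s \<theta>)) has_integral mass s) {0..pi/4}"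
        unfolding mass_def by (rule integral_flow) (use that h_continuous in auto)
      then show ?thesis using that by (auto simp: transported mult.commute has_integral_integrable)
    qed
    show "continuous_on ({0..T} \<times> cbox 0 (pi / 4)) (\<lambda>(t, \<theta>). ?f' t \<theta>)"
      using continuous_on_mult[OF ch continuous_on_mult[OF cJ cs]] by (simp add: split_beta)
  qed (use T in auto)
  \<comment> \<open>Changing variables back by the flow leaves the integral of \<open>2 H' h\<close>
    at the fixed time \<open>t\<close>, which the energy identity evaluates.\<close>
  moreover have "integral (cbox 0 (pi / 4)) (?f' t) = (outer_strain t)\<^sup>2 - (inner_strain t)\<^sup>2"
  proof -
    have "continuous_on UNIV (\<lambda>x. 2 * H' t x * h t x)"
      using stream_pair_D(4)[OF stream[OF t]] h_continuous[OF t] by (intro continuous_intros)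
    from integral_flow[OF t this]
    have "integral {0..pi/4} (?f' t) = integral {0..pi/4} (\<lambda>x. 2 * H' t x * h t x)"
      by (simp add: transported[OF t] integral_unique mult_ac)
    also have "\<dots> = (outer_strain t)\<^sup>2 - (inner_strain t)\<^sup>2"
      using integral_unique[OF stream_quarter(5)[OF t]] by (simp add: outer_strain_def inner_strain_def)
    finally show ?thesis by simp
  qed
  ultimately have "((\<lambda>s. integral (cbox 0 (pi / 4)) (?f s)) has_real_derivative (outer_strain t)\<^sup>2 - (inner_strain t)\<^sup>2) (at t within {0..T})"
    by (simp only:)
  then have "(mass has_real_derivative (outer_strain t)\<^sup>2 - (inner_strain t)\<^sup>2) (at t within {0..T})"
    by (rule has_field_derivative_transform_within[OF _ zero_less_one]) (use T mass_eq in auto)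
  moreover have "at t within {0..T} = at t within {0..}"
    by (rule at_within_nhd[of _ "{..<T}"]) (use T in auto)
  ultimately show ?thesis by simp
qed

text \<open>The mass obeys a Riccati inequality, which becomes linear for the reciprocal: its
  derivative lies between \<open>1 - 8 * \<epsilon>\<^sup>2\<close> and 1.\<close>

lemma inverse_mass_bounds:
  assumes t: "0 \<le> t"
  shows "inverse (mass t) \<le> t + inverse (mass 0)"
    "(1 - 8 * \<epsilon>\<^sup>2) * t + inverse (mass 0) \<le> inverse (mass t)"
proof -
  let ?d = "\<lambda>s. ((inner_strain s)\<^sup>2 - (outer_strain s)\<^sup>2) / (mass s)\<^sup>2"
  have d: "((\<lambda>s. inverse (mass s)) has_real_derivative ?d s) (at s within {0..})" if "0 \<le> s" for s
    using DERIV_inverse_fun[OF mass_deriv[OF that]] mass_pos[OF that]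
    by (auto elim!: DERIV_cong simp: divide_simps power2_eq_square)
  have b: "?d s \<le> 1" "1 - 8 * \<epsilon>\<^sup>2 \<le> ?d s" if "0 \<le> s" for s
    using strain_sq_bounds[OF that] mass_pos[OF that] by (simp_all add: pos_divide_le_eq pos_le_divide_eq)
  have "1 * 0 - inverse (mass 0) \<le> 1 * t - inverse (mass t)"
    by (rule nondecreasing_within_atLeast[where f = "\<lambda>s. 1 * s - inverse (mass s)", OF DERIV_diff[OF DERIV_cmult_Id d]])
      (use b t in auto)
  then show "inverse (mass t) \<le> t + inverse (mass 0)" by simp
  have "inverse (mass 0) - (1 - 8 * \<epsilon>\<^sup>2) * 0 \<le> inverse (mass t) - (1 - 8 * \<epsilon>\<^sup>2) * t"
    by (rule nondecreasing_within_atLeast[where f = "\<lambda>s. inverse (mass s) - (1 - 8 * \<epsilon>\<^sup>2) * s", OF DERIV_diff[OF d DERIV_cmult_Id]])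
      (use b t in auto)
  then show "(1 - 8 * \<epsilon>\<^sup>2) * t + inverse (mass 0) \<le> inverse (mass t)" by simp
qed

lemma rate_pos: "0 < 1 - 8 * \<epsilon>\<^sup>2"
  using eps_sq by linarith

lemma mass_bounds:
  assumes t: "0 \<le> t"
  shows "1 / (t + inverse (mass 0)) \<le> mass t"
    "mass t \<le> 1 / ((1 - 8 * \<epsilon>\<^sup>2) * t + inverse (mass 0))"
proof -
  have p: "0 < mass t" "0 < mass 0" using mass_pos t by auto
  have "inverse (t + inverse (mass 0)) \<le> inverse (inverse (mass t))"
    by (rule le_imp_inverse_le[OF inverse_mass_bounds(1)[OF t]]) (use p in simp)
  then show "1 / (t + inverse (mass 0)) \<le> mass t" by (simp add: inverse_eq_divide)
  have "inverse (inverse (mass t)) \<le> inverse ((1 - 8 * \<epsilon>\<^sup>2) * t + inverse (mass 0))"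
    by (rule le_imp_inverse_le[OF inverse_mass_bounds(2)[OF t]]) (use p rate_pos t in \<open>auto intro: add_nonneg_pos\<close>)
  then show "mass t \<le> 1 / ((1 - 8 * \<epsilon>\<^sup>2) * t + inverse (mass 0))" by (simp add: inverse_eq_divide)
qed

lemma mass_tendsto_0: "(mass \<longlongrightarrow> 0) at_top"
proof (rule tendsto_sandwich[of "\<lambda>_. 0"])
  show "\<forall>\<^sub>F t in at_top. 0 \<le> mass t"
    using eventually_ge_at_top[of 0] by eventually_elim (use mass_pos in \<open>simp add: less_imp_le\<close>)
  show "\<forall>\<^sub>F t in at_top. mass t \<le> 1 / ((1 - 8 * \<epsilon>\<^sup>2) * t + inverse (mass 0))"
    using eventually_ge_at_top[of 0] by eventually_elim (rule mass_bounds)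
  have "filterlim (\<lambda>t. inverse (mass 0) + (1 - 8 * \<epsilon>\<^sup>2) * t) at_top at_top"
    by (intro filterlim_tendsto_add_at_top[OF tendsto_const] filterlim_tendsto_pos_mult_at_top[OF tendsto_const rate_pos] filterlim_ident)
  then show "((\<lambda>t. 1 / ((1 - 8 * \<epsilon>\<^sup>2) * t + inverse (mass 0))) \<longlongrightarrow> 0) at_top"
    by (intro tendsto_divide_0[OF tendsto_const] filterlim_at_top_imp_at_infinity) (simp add: add.commute)
qed simp

section \<open>Compression of the flow and growth of the gradient\<close>

lemma strain_ge:
  assumes t: "0 \<le> t" shows "- mass t \<le> H' t x"
proof -
  \<comment> \<open>Quarter turns and reflection bring any point into the quarter, where
    \<open>H'\<close> is smallest at the origin.\<close>
  obtain n :: int where n: "x + pi / 2 * of_int n \<in> {-(pi/4)..pi/4}" by (rule quarter_reduce)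
  define y where "y = x + pi / 2 * of_int n"
  have "\<bar>y\<bar> \<le> pi / 4" using n unfolding y_def[symmetric] by (intro abs_leI) auto
  then have y: "\<bar>y\<bar> \<in> {0..pi/4}" by simp
  have "H' t x = H' t y" using shift_invariant_int[of "H' t", OF stream_fourfold(2)[OF t]] by (simp add: y_def)
  also have "\<dots> = H' t \<bar>y\<bar>" using stream_odd(2)[OF t, of y] by (simp add: abs_if)
  finally have "H' t 0 \<le> H' t x" using stream_quarter(4)[OF t y] by simp
  then show ?thesis using strain_bounds(1)[OF t] by (simp add: inner_strain_def)
qed

lemma stream_diff_ge:
  assumes t: "0 \<le> t" and xy: "x \<le> y" shows "- mass t * (y - x) \<le> H t y - H t x"
proof -
  have "H t x + mass t * x \<le> H t y + mass t * y"
  proof (rule DERIV_nonneg_imp_nondecreasing[where f = "\<lambda>x. H t x + mass t * x", OF xy])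
    fix z
    have "((\<lambda>x. H t x + mass t * x) has_real_derivative H' t z + mass t) (at z)"
      by (intro DERIV_add H_deriv[OF t] DERIV_cmult_Id)
    moreover have "0 \<le> H' t z + mass t" using strain_ge[OF t, of z] by linarith
    ultimately show "\<exists>d. ((\<lambda>x. H t x + mass t * x) has_real_derivative d) (at z) \<and> 0 \<le> d" by blast
  qed
  then show ?thesis by (simp add: algebra_simps)
qed

text \<open>With \<open>q = m * mass 0 * s + 1\<close> and
  \<open>m = 1 - 8 * \<epsilon>\<^sup>2\<close>, the weight \<open>q powr (2 / m)\<close> grows at
  the relative rate \<open>2 * mass 0 / q\<close>. The mass is at most \<open>mass 0 / q\<close>, so
  two trajectories approach each other no faster than this rate, and the weighted separation never
  decreases.\<close>

lemma flow_compression: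
  assumes t: "0 \<le> t"
  shows "\<bar>\<eta> - \<theta>\<bar> \<le> ((1 - 8 * \<epsilon>\<^sup>2) * mass 0 * t + 1) powr (2 * inverse (1 - 8 * \<epsilon>\<^sup>2)) * \<bar>\<phi> t \<eta> - \<phi> t \<theta>\<bar>"
proof -
  define m where "m = 1 - 8 * \<epsilon>\<^sup>2"
  have m: "0 < m" using rate_pos by (simp add: m_def)
  define q where "q s = m * mass 0 * s + 1" for s
  have m0: "0 < mass 0" using mass_pos by simp
  have q1: "1 \<le> q s" if "0 \<le> s" for s using that m m0 by (simp add: q_def)
  have mq: "mass s * q s \<le> mass 0" if s: "0 \<le> s" for s
  proof -
    have "q s = mass 0 * (m * s + inverse (mass 0))" using m0 by (simp add: q_def algebra_simps)
    also have "\<dots> \<le> mass 0 * inverse (mass s)"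
      using inverse_mass_bounds(2)[OF s] m0 by (intro mult_left_mono) (auto simp: m_def)
    finally show ?thesis using mass_pos[OF s] by (simp add: field_simps)
  qed
  have main: "\<eta> - \<theta> \<le> q t powr (2 * inverse m) * (\<phi> t \<eta> - \<phi> t \<theta>)" if le: "\<theta> \<le> \<eta>" for \<eta> \<theta>
  proof -
    let ?u = "\<lambda>s. \<phi> s \<eta> - \<phi> s \<theta>"
    have d: "((\<lambda>s. q s powr (2 * inverse m) * ?u s) has_real_derivative
        q s powr (2 * inverse m) * (2 * mass 0 / q s * ?u s + (2 * H s (\<phi> s \<eta>) - 2 * H s (\<phi> s \<theta>)))) (at s within {0..})"
      if s: "0 \<le> s" for s
    proof -
      have qs: "0 < q s" using q1[OF s] by linarith
      have dq: "(q has_real_derivative m * mass 0) (at s)"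
        unfolding q_def[abs_def] by (auto intro!: derivative_eq_intros)
      have p: "((\<lambda>s. q s powr (2 * inverse m)) has_real_derivative q s powr (2 * inverse m) * (2 * mass 0 / q s)) (at s within {0..})"
        by (rule has_field_derivative_at_within, rule DERIV_cong[OF DERIV_powr[OF dq qs DERIV_const]]) (use m in \<open>simp add: field_simps\<close>)
      have "(?u has_real_derivative 2 * H s (\<phi> s \<eta>) - 2 * H s (\<phi> s \<theta>)) (at s within {0..})"
        by (intro DERIV_diff flow_deriv s)
      from DERIV_mult[OF p this] show ?thesis by (rule DERIV_cong) (simp add: algebra_simps)
    qed
    have "q 0 powr (2 * inverse m) * ?u 0 \<le> q t powr (2 * inverse m) * ?u t"
    proof (rule nondecreasing_within_atLeast[where f = "\<lambda>s. q s powr (2 * inverse m) * ?u s", OF d])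
      fix s :: real assume s: "0 \<le> s"
      have u0: "0 \<le> ?u s" using flow_mono[OF s le] by simp
      have qs: "0 < q s" using q1[OF s] by linarith
      have "mass s \<le> mass 0 / q s" using mq[OF s] qs by (simp add: pos_le_divide_eq)
      then have "mass s * ?u s \<le> mass 0 / q s * ?u s" using u0 by (rule mult_right_mono)
      moreover have "- mass s * ?u s \<le> H s (\<phi> s \<eta>) - H s (\<phi> s \<theta>)"
        by (rule stream_diff_ge[OF s flow_mono[OF s le]])
      ultimately have "0 \<le> 2 * (mass 0 / q s * ?u s) + (2 * H s (\<phi> s \<eta>) - 2 * H s (\<phi> s \<theta>))" by linarith
      then show "0 \<le> q s powr (2 * inverse m) * (2 * mass 0 / q s * ?u s + (2 * H s (\<phi> s \<eta>) - 2 * H s (\<phi> s \<theta>)))"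
        by simp
    qed (use t in auto)
    then show ?thesis by (simp add: q_def flow_0)
  qed
  show ?thesis
  proof (cases "\<theta> \<le> \<eta>")
    case True
    then show ?thesis using main[OF True] flow_mono[OF t True] by (simp add: q_def m_def)
  next
    case False
    then have "\<eta> \<le> \<theta>" by simp
    then show ?thesis using main[OF \<open>\<eta> \<le> \<theta>\<close>] flow_mono[OF t \<open>\<eta> \<le> \<theta>\<close>] by (simp add: q_def m_def)
  qed
qed

lemma h_lipschitz:
  assumes t: "0 \<le> t" and K: "K-lipschitz_on UNIV h0"
  shows "(K * ((1 - 8 * \<epsilon>\<^sup>2) * mass 0 * t + 1) powr (2 * inverse (1 - 8 * \<epsilon>\<^sup>2)))-lipschitz_on UNIV (h t)"
proof -
  obtain C where C: "velocity_bound t C" by (rule velocity_bound_exists[OF t])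
  show ?thesis by (rule h_lipschitz_from_flow[OF C _ K flow_compression[OF t]]) (use t in auto)
qed

text \<open>The origin is a fixed point, so its Jacobian decays at the relative rate
  \<open>2 * inner_strain s\<close>. This is at least \<open>2 * k * mass s\<close>, hence at least
  \<open>2 * k * mass 0 / q s\<close>, the relative growth rate of the weight; the product cannot
  increase.\<close>

lemma jacobian_origin:
  assumes t: "0 \<le> t"
  shows "(mass 0 * t + 1) powr (2 * (1 - 2 * \<epsilon>\<^sup>2)) * jacobian t 0 \<le> 1"
proof -
  define k where "k = 1 - 2 * \<epsilon>\<^sup>2"
  define q where "q s = mass 0 * s + 1" for s
  have m0: "0 < mass 0" using mass_pos by simp
  have k0: "0 \<le> k" using eps_sq by (simp add: k_def)
  obtain C where C: "velocity_bound t C" by (rule velocity_bound_exists[OF t])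
  have q1: "1 \<le> q s" if "0 \<le> s" for s using that m0 by (simp add: q_def)
  define g where "g s = - (q s powr (2 * k) * jacobian s 0)" for s
  define g' where "g' s = - (q s powr (2 * k) * jacobian s 0 * (2 * k * mass 0 / q s + 2 * H' s 0))" for s
  have d: "(g has_real_derivative g' s) (at s within {0..t})" if s: "s \<in> {0..t}" for s
  proof -
    have s0: "0 \<le> s" using s by simp
    have qs: "0 < q s" using q1[OF s0] by linarith
    have dq: "(q has_real_derivative mass 0) (at s)"
      unfolding q_def[abs_def] by (auto intro!: derivative_eq_intros)
    have p: "((\<lambda>s. q s powr (2 * k)) has_real_derivative q s powr (2 * k) * (2 * k * mass 0 / q s)) (at s within {0..t})"
      by (rule has_field_derivative_at_within, rule DERIV_cong[OF DERIV_powr[OF dq qs DERIV_const]]) (simp add: field_simps)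
    from DERIV_minus[OF DERIV_mult[OF p jacobian_deriv_time[OF C s, of 0]]]
    show ?thesis unfolding g_def[abs_def] g'_def by (rule DERIV_cong) (simp add: flow_fixed[OF s0] algebra_simps)
  qed
  have nn: "0 \<le> g' s" if s: "s \<in> {0..t}" for s
  proof -
    have s0: "0 \<le> s" using s by simp
    have qs: "0 < q s" using q1[OF s0] by linarith
    have "mass 0 / q s = 1 / (s + inverse (mass 0))" using m0 qs by (simp add: q_def field_simps)
    then have "k * (mass 0 / q s) \<le> k * mass s" using mass_bounds(1)[OF s0] k0 by (intro mult_left_mono) auto
    also have "\<dots> \<le> - H' s 0" using strain_bounds(2)[OF s0] by (simp add: k_def inner_strain_def)
    finally have "2 * k * mass 0 / q s + 2 * H' s 0 \<le> 0" by simp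
    then have "q s powr (2 * k) * jacobian s 0 * (2 * k * mass 0 / q s + 2 * H' s 0) \<le> 0"
      using jacobian_pos[of s 0] by (intro mult_nonneg_nonpos) auto
    then show ?thesis by (simp add: g'_def)
  qed
  have "g 0 \<le> g t"
  proof (cases "t = 0")
    case False
    have "\<exists>s\<in>{0<..<t}. g t - g 0 = (\<lambda>x. g' s * x) (t - 0)"
      by (rule mvt_simple[where f = g and f' = "\<lambda>s x. g' s * x"])
        (use d t False in \<open>auto simp: has_field_derivative_def\<close>)
    then obtain s where s: "s \<in> {0<..<t}" "g t - g 0 = g' s * t" by auto
    have "0 \<le> g' s * t" by (rule mult_nonneg_nonneg[OF nn t]) (use s in auto)
    then show ?thesis using s(2) by linarith
  qed simp
  then show ?thesis by (simp add: g_def q_def k_def jacobian_0)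
qed

text \<open>To the right of 0, \<open>h0\<close> lies below
  \<open>\<Lambda> * \<phi> t \<theta>\<close>, and both vanish at 0. Comparing slopes there gives
  \<open>D \<le> \<Lambda> * jacobian t 0\<close>, and the Jacobian is small.\<close>

lemma gradient_lower_bound:
  assumes t: "0 \<le> t" and L: "\<Lambda>-lipschitz_on UNIV (h t)" and d0: "(h0 has_real_derivative D) (at 0)" and D: "0 < D"
  shows "D * (mass 0 * t + 1) powr (2 * (1 - 2 * \<epsilon>\<^sup>2)) \<le> \<Lambda>"
proof -
  obtain C where C: "velocity_bound t C" by (rule velocity_bound_exists[OF t])
  have L0: "0 \<le> \<Lambda>" using L lipschitz_on_nonneg by blast
  have le: "h0 \<theta> \<le> \<Lambda> * \<phi> t \<theta>" if "0 \<le> \<theta>" for \<theta>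
  proof -
    have "\<bar>h t (\<phi> t \<theta>) - h t 0\<bar> \<le> \<Lambda> * \<bar>\<phi> t \<theta> - 0\<bar>"
      using lipschitz_onD[OF L, of "\<phi> t \<theta>" 0] by (simp add: dist_real_def)
    moreover have "h t 0 = 0" using h_odd[OF t, of 0] by simp
    moreover have "0 \<le> \<phi> t \<theta>" using flow_mono[OF t that] flow_fixed[OF t] by simp
    ultimately show ?thesis using transported[OF t, of \<theta>] by simp
  qed
  have "D \<le> \<Lambda> * jacobian t 0"
  \<comment> \<open>Otherwise \<open>\<Lambda> * \<phi> t \<theta> - h0 \<theta>\<close> would have
    a negative derivative at 0 and become negative just to the right of it.\<close>
  proof (rule ccontr)
    assume "\<not> D \<le> \<Lambda> * jacobian t 0"
    moreover have "((\<lambda>\<theta>. \<Lambda> * \<phi> t \<theta> - h0 \<theta>) has_real_derivative \<Lambda> * jacobian t 0 - D) (at 0)"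
      by (intro DERIV_diff DERIV_cmult flow_deriv_space[OF C] d0) (use t in auto)
    ultimately obtain d where d: "d > 0" "\<And>h. 0 < h \<Longrightarrow> h < d \<Longrightarrow> \<Lambda> * \<phi> t (0 + h) - h0 (0 + h) < \<Lambda> * \<phi> t 0 - h0 0"
      using DERIV_neg_dec_right[of "\<lambda>\<theta>. \<Lambda> * \<phi> t \<theta> - h0 \<theta>" "\<Lambda> * jacobian t 0 - D" 0] by auto
    have "h0 0 = 0" using odd_initial[of 0] by simp
    then show False using d(2)[of "d / 2"] d(1) le[of "d / 2"] flow_fixed[OF t] by simp
  qed
  then have "D * (mass 0 * t + 1) powr (2 * (1 - 2 * \<epsilon>\<^sup>2)) \<le> \<Lambda> * jacobian t 0 * (mass 0 * t + 1) powr (2 * (1 - 2 * \<epsilon>\<^sup>2))"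
    by (intro mult_right_mono) auto
  also have "\<dots> = \<Lambda> * ((mass 0 * t + 1) powr (2 * (1 - 2 * \<epsilon>\<^sup>2)) * jacobian t 0)" by (simp only: mult_ac)
  also have "\<dots> \<le> \<Lambda> * 1" by (rule mult_left_mono[OF jacobian_origin[OF t] L0])
  finally show ?thesis by simp
qed

end

lemma Linf_norm_real_cases:
  assumes g: "is_weak_derivative f g" and f: "continuous_on UNIV f" "periodic f"
  obtains (infinite) "Linf_norm g = \<infinity>" | (finite) K where "Linf_norm g = ereal K" "K-lipschitz_on UNIV f"
proof (cases "Linf_norm g")
  case (real K)
  then show ?thesis using weak_derivative_bound_imp_lipschitz[OF g f, of K] finite by simp
next
  case MInf
  \<comment> \<open>The value minus infinity is an extended-real artefact; it would give a negative
    Lipschitz constant.\<close>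
  then have "(-1)-lipschitz_on UNIV f" by (intro weak_derivative_bound_imp_lipschitz[OF g f]) simp
  then show ?thesis using lipschitz_on_nonneg by fastforce
qed (use infinite in simp)

theorem theorem3:
  fixes h0 :: "real \<Rightarrow> real" and h :: "real \<Rightarrow> real \<Rightarrow> real" and \<epsilon> :: real
  assumes "h0 \<in> W1inf"
    and "\<exists>\<theta>. h0 \<theta> \<noteq> 0"
    and "\<forall>\<theta>. h0 (\<theta> + pi / 2) = h0 \<theta>"
    and "\<forall>\<theta>. h0 (- \<theta>) = - h0 \<theta>"
    and "\<forall>\<theta>\<in>{0..pi/4}. 0 \<le> h0 \<theta>"
    and "0 < \<epsilon>" and "\<epsilon> \<le> 1 / 4"
    and "closure {\<theta> \<in> {0..pi/4}. h0 \<theta> \<noteq> 0} \<subseteq> {0..\<epsilon>}"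
    and "is_solution h0 h"
  shows "(\<forall>t\<ge>0.
            1 / (t + inverse (L1_norm h0)) \<le> L1_norm (h t) \<and>
            L1_norm (h t) \<le> 1 / ((1 - 8 * \<epsilon>\<^sup>2) * t + inverse (L1_norm h0))) \<and>
         ((\<lambda>t. L1_norm (h t)) \<longlongrightarrow> 0) at_top \<and>
         (h0 differentiable (at 0) \<and> deriv h0 0 > 0 \<longrightarrow>
           (\<forall>t\<ge>0.
             ereal (deriv h0 0 * (L1_norm h0 * t + 1) powr (2 * (1 - 2 * \<epsilon>\<^sup>2)))
               \<le> Linf_norm (weak_derivative (h t)) \<and>
             Linf_norm (weak_derivative (h t))
               \<le> Linf_norm (weak_derivative h0) *
                 ereal (((1 - 8 * \<epsilon>\<^sup>2) * L1_norm h0 * t + 1) powr (2 * inverse (1 - 8 * \<epsilon>\<^sup>2)))))"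
proof -
  from assms(9) obtain H \<phi> where h0: "h 0 = h0" and W: "\<And>t. 0 \<le> t \<Longrightarrow> h t \<in> W1inf"
    and cont: "continuous_on ({0..} \<times> UNIV) (\<lambda>(t, \<theta>). h t \<theta>)"
    and H: "\<And>t. 0 \<le> t \<Longrightarrow> stream_function (h t) (H t)" and \<phi>: "flow_map H \<phi>"
    and tr: "\<And>t \<theta>. 0 \<le> t \<Longrightarrow> h t (\<phi> t \<theta>) = h0 \<theta>"
    unfolding is_solution_def by blast
  interpret localized_solution h0 h H "\<lambda>t. deriv (H t)" \<phi> \<epsilon>
  proof
    show "\<exists>K. K-lipschitz_on UNIV h0" by (rule W1inf_weak_derivative(2)[OF assms(1)])
    show "periodic (h t)" if "0 \<le> t" for t by (rule W1inf_weak_derivative(3)[OF W[OF that]])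
    show "stream_pair (h t) (H t) (deriv (H t))" if "0 \<le> t" for t by (rule stream_function_pair[OF H[OF that]])
    show "\<phi> 0 \<theta> = \<theta>" for \<theta> using \<phi> by (simp add: flow_map_def)
    show "((\<lambda>s. \<phi> s \<theta>) has_real_derivative 2 * H t (\<phi> t \<theta>)) (at t within {0..})" if "0 \<le> t" for t \<theta>
      using \<phi> that unfolding flow_map_def by blast
    show "\<theta> \<le> \<epsilon>" if "\<theta> \<in> {0..pi/4}" "h0 \<theta> \<noteq> 0" for \<theta>
    proof -
      have "\<theta> \<in> closure {\<theta> \<in> {0..pi/4}. h0 \<theta> \<noteq> 0}" using that closure_subset by fast
      then show ?thesis using assms(8) by auto
    qed
  qed (use assms cont tr in auto)
  have L1: "L1_norm (h t) = mass t" if "0 \<le> t" for t by (rule L1_norm_eq_mass[OF that])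
  have L10: "L1_norm h0 = mass 0" using L1[of 0] h0 by simp
  note wd = W1inf_weak_derivative(1,4,3)[OF W]
  have "((\<lambda>t. L1_norm (h t)) \<longlongrightarrow> 0) at_top"
    by (rule Lim_transform_eventually[OF mass_tendsto_0])
      (use eventually_ge_at_top[of "0::real"] in \<open>eventually_elim, simp add: L1\<close>)
  moreover have "ereal (deriv h0 0 * (L1_norm h0 * t + 1) powr (2 * (1 - 2 * \<epsilon>\<^sup>2))) \<le> Linf_norm (weak_derivative (h t))"
    if d: "h0 differentiable (at 0)" "deriv h0 0 > 0" and t: "0 \<le> t" for t
  proof (rule Linf_norm_real_cases[OF wd[OF t]])
    fix K assume finite: "Linf_norm (weak_derivative (h t)) = ereal K" "K-lipschitz_on UNIV (h t)"
    have "(h0 has_real_derivative deriv h0 0) (at 0)" using d(1) by (simp add: DERIV_deriv_iff_real_differentiable)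
    from gradient_lower_bound[OF t finite(2) this d(2)] show ?thesis by (simp add: finite(1) L10)
  qed simp
  moreover have "Linf_norm (weak_derivative (h t)) \<le> Linf_norm (weak_derivative h0) *
      ereal (((1 - 8 * \<epsilon>\<^sup>2) * L1_norm h0 * t + 1) powr (2 * inverse (1 - 8 * \<epsilon>\<^sup>2)))" if t: "0 \<le> t" for t
  proof (rule Linf_norm_real_cases[OF W1inf_weak_derivative(1,4,3)[OF assms(1)]])
    assume infinite: "Linf_norm (weak_derivative h0) = \<infinity>"
    \<comment> \<open>Strict positivity matters: infinity times a positive real is infinity in
      \<open>ereal\<close>, while infinity times 0 is 0.\<close>
    have "0 < (1 - 8 * \<epsilon>\<^sup>2) * L1_norm h0 * t + 1"
      using rate_pos mass_pos[of 0] t by (simp add: L10 add_nonneg_pos)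
    then show ?thesis by (simp add: infinite)
  next
    fix K assume finite: "Linf_norm (weak_derivative h0) = ereal K" "K-lipschitz_on UNIV h0"
    from lipschitz_imp_weak_derivative_bound[OF wd(1)[OF t] h_lipschitz[OF t finite(2)]]
    show ?thesis by (simp add: finite(1) L10)
  qed
  ultimately show ?thesis using mass_bounds L1 L10 by auto
qed

end
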